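(* Let $G$ be a finite solvable group with $G\in\mathcal{D}_n$. Then the derived length of $G$ is at most $3\log_2(n+1)+9$.
   Context: $\mathcal{D}(G)$ denotes the number of conjugacy classes of nontrivial subgroups $H$ of the finite group $G$ with $N_G(H)\neq H$; $\mathcal{D}_n$ is the family of finite groups $G$ with $\mathcal{D}(G)=n$. *)

theory Defs
  imports Complex_Main "HOL-Algebra.Algebra"
begin

definition subgroup_conj_class :: "('a, 'b) monoid_scheme \<Rightarrow> 'a set \<Rightarrow> 'a set set" where
  "subgroup_conj_class G H = {g <#\<^bsub>G\<^esub> H #>\<^bsub>G\<^esub> inv\<^bsub>G\<^esub> g | g. g \<in> carrier G}"

definition D_count :: "('a, 'b) monoid_scheme \<Rightarrow> nat" where
  "D_count G = card {subgroup_conj_class G H | H.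
       subgroup H G \<and> H \<noteq> {\<one>\<^bsub>G\<^esub>} \<and> normalizer G H \<noteq> H}"

definition derived_length :: "('a, 'b) monoid_scheme \<Rightarrow> nat" where
  "derived_length G = (LEAST k. (derived G ^^ k) (carrier G) = {\<one>\<^bsub>G\<^esub>})"

end

(* A composition series of G consists of subnormal subgroups of pairwise different orders, so the number c of
   prime factors of |G|, counted with multiplicity, is at most D(G) + 1. It remains to bound the derived length
   by 3 log_2 c + 9. If a chief series of G has l factors, of rank at most R, then R + l <= c + 1, and a subgroup
   centralizing all chief factors has derived length at most log_2 l + 1. So everything rests on bounding the
   derived length of a solvable group G acting irreducibly on a module V of order p^R by 2 log_2 R + 10. This is
   proved by induction on |V| together with the companion bound 2 R log_2 p - 1 (sharpened by 1 for p = 2), which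
   controls small modules and gives the bound 2 log_2 k for the action on the cosets of a subgroup of index k:
   a point stabilizer of a primitive solvable permutation group of degree p^m acts irreducibly on the socle.
   Let A be a normal subgroup of G acting on V through an abelian group, and let K be the subring of End(V) that
   it generates. If K is not a field for some A, then V is a direct sum of k > 1 subspaces permuted by G.
   Otherwise take A maximal. Then G' centralizes A since the unit group of K is cyclic, and for every chief factor
   L/A with L <= C_G(A) coset representatives of A in L are linearly independent over K, so |L/A| <= dim_K(V)^2,
   and the induction hypothesis applies to the action of G on L/A. *)

theory Submission
  imports Defs
begin

section \<open>Numerical bounds\<close>

text \<open>The delicate point is an additive loss of 3 in the primitive case: up to two derived
  steps are spent on passing from L/A to L, and one on A itself. A bound of the form 2 log_2 r +
  const absorbs this loss because the rank u of L/A is only logarithmic in the dimension: q^u <= s^2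
  with s = dim_K(V). The comparison behind this, 8 u^2 <= q^u, fails for small u; there the
  companion bound, linear in the rank, takes over. The two ranges meet at q = 2 and u = 9, and this
  is the origin of 1024 = 2^10. The square in 1024 r^2 matches the bound k^2 for a subgroup of index
  k, so the form is preserved along r = k s in the imprimitive case. The final factor 512 is 1024 *
  2 / 4: the chief series contributes 2 l, and 4 R^2 l <= c^3 once c >= 10. All estimates are kept
  in the form 2^j <= ...; logarithms occur only in the last proof.\<close>

text \<open>The bound on the derived length \<open>j\<close> of a solvable linear group of degree \<open>r\<close> over the field with \<open>p\<close>
  elements. The second part matters for small \<open>r\<close>: it says that adding the translations still leaves
  \<open>2 ^ (j + 1) \<le> k\<^sup>2\<close> for a primitive permutation group of degree \<open>k = p ^ r\<close>. The extra unit for \<open>p = 2\<close>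
  is what the case of degree 2 over the field with 3 elements needs.\<close>
definition length_bound :: "nat \<Rightarrow> nat \<Rightarrow> nat \<Rightarrow> bool" where
  "length_bound p r j \<longleftrightarrow> 2 ^ j \<le> 1024 * r\<^sup>2 \<and> 2 ^ (j + (if p = 2 then 2 else 1)) \<le> p ^ (2 * r)"

lemma length_bound_imp_le: "length_bound p r j \<Longrightarrow> j \<le> 1024 * r\<^sup>2"
  unfolding length_bound_def using less_exp[of j] by linarith

text \<open>Ensures that the greatest admissible exponent in \<open>primitive_bound\<close> is at
  least 2, so that the term of the derived series before it already lies in the derived subgroup.
  The companion bound is the equality 16 = 16 at p = r = 2, and p ^ r = 2 is the one order where it
  fails.\<close>

lemma length_bound_two:
  assumes "p \<ge> 2" "r \<ge> 1" "p ^ r \<noteq> 2"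
  shows "length_bound p r 2"
proof -
  have r1: "1024 * r\<^sup>2 \<ge> 1024" using assms(2) by simp
  have "2 ^ (2 + (if p = 2 then 2 else 1)) \<le> p ^ (2 * r)"
  proof (cases "p = 2")
    case True
    then have "r \<noteq> 1" using assms(3) by auto
    then have "r \<ge> 2" using assms(2) by linarith
    then have "(2::nat) ^ 4 \<le> 2 ^ (2 * r)" by (intro power_increasing) auto
    then show ?thesis using True by simp
  next
    case False
    then have "p \<ge> 3" using assms(1) by simp
    then have "(3::nat) ^ 2 \<le> p ^ 2" by (intro power_mono) auto
    also have "\<dots> \<le> p ^ (2 * r)" using assms by (intro power_increasing) auto
    finally show ?thesis using False by simp
  qed
  then show ?thesis unfolding length_bound_def using r1 by simp
qed

text \<open>Meant for k blocks of dimension s, with i derived steps spent on permuting them. The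
  quadratic part is multiplicative; the companion part has room for the factor
  \<open>k\<^sup>2\<close> because k <= p ^ ((k - 1) s), the order of k - 1 further blocks.\<close>

lemma length_bound_mult:
  assumes "2 ^ i \<le> k\<^sup>2" "length_bound p s j" "k * s \<le> r" "k \<ge> 1" "s \<ge> 1" "p \<ge> 2"
  shows "length_bound p r (i + j)"
proof -
  have "k \<le> 2 ^ (k - 1)" using less_exp[of "k - 1"] assms(4) by linarith
  also have "\<dots> \<le> p ^ (k - 1)" using assms(6) by (intro power_mono) auto
  also have "\<dots> \<le> p ^ ((k - 1) * s)" using assms by (intro power_increasing) auto
  finally have "k\<^sup>2 \<le> (p ^ ((k - 1) * s))\<^sup>2" by (intro power_mono) auto
  then have k2: "k\<^sup>2 \<le> p ^ (2 * ((k - 1) * s))" by (metis mult.commute power_mult)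
  have c: "2 ^ (i + j + c) \<le> p ^ (2 * r)" if "2 ^ (j + c) \<le> p ^ (2 * s)" for c
  proof -
    have "2 ^ (i + j + c) = 2 ^ i * (2::nat) ^ (j + c)" by (simp add: power_add)
    also have "\<dots> \<le> p ^ (2 * ((k - 1) * s)) * p ^ (2 * s)"
      using assms(1) k2 that by (intro mult_mono) auto
    also have "\<dots> = p ^ (2 * (k * s))"
    proof -
      have "(k - 1) * s + s = k * s" using assms(4) by (metis add.commute mult_Suc Suc_diff_1 less_eq_Suc_le One_nat_def)
      then have "2 * ((k - 1) * s) + 2 * s = 2 * (k * s)" by linarith
      then show ?thesis by (metis power_add)
    qed
    also have "\<dots> \<le> p ^ (2 * r)" using assms by (intro power_increasing) auto
    finally show ?thesis .
  qed
  have "2 ^ (i + j) = 2 ^ i * (2::nat) ^ j" by (simp add: power_add)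
  also have "\<dots> \<le> k\<^sup>2 * (1024 * s\<^sup>2)"
    using assms(1,2) unfolding length_bound_def by (intro mult_mono) auto
  also have "\<dots> = 1024 * (k * s)\<^sup>2" by (simp add: power_mult_distrib)
  also have "\<dots> \<le> 1024 * r\<^sup>2" using assms(3) by (simp add: power_mono)
  finally show ?thesis using c assms(2) unfolding length_bound_def by auto
qed

section \<open>Polynomial against exponential growth\<close>

lemma sixteen_power: "s \<ge> 2 \<Longrightarrow> 16 * s ^ 4 \<le> (16::nat) ^ s"
proof -
  assume "s \<ge> 2"
  have "s \<le> 2 ^ (s - 1)" using less_exp[of "s - 1"] \<open>s \<ge> 2\<close> by linarith
  then have "s ^ 4 \<le> (2 ^ (s - 1)) ^ 4" by (intro power_mono) auto
  also have "\<dots> = (2 ^ 4) ^ (s - 1)" by (metis power_mult mult.commute)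
  finally have "16 * s ^ 4 \<le> 16 ^ Suc (s - 1)" by simp
  then show ?thesis using \<open>s \<ge> 2\<close> by simp
qed

lemma four_nine_power: "s \<ge> 2 \<Longrightarrow> 4 * s ^ 4 \<le> (9::nat) ^ s"
proof (induction s rule: dec_induct)
  case (step n)
  have "(Suc n) ^ 4 * 16 \<le> 81 * n ^ 4"
  proof -
    have "2 * Suc n \<le> 3 * n" using step by simp
    then have "(2 * Suc n) ^ 4 \<le> (3 * n) ^ 4" by (intro power_mono) auto
    then show ?thesis by (simp only: power_mult_distrib) simp
  qed
  then show ?case using step by simp
qed simp

lemma eight_nine_power: "s \<ge> 3 \<Longrightarrow> 8 * s ^ 4 \<le> (9::nat) ^ s"
proof (induction s rule: dec_induct)
  case (step n)
  have "(Suc n) ^ 4 * 81 \<le> 256 * n ^ 4"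
  proof -
    have "3 * Suc n \<le> 4 * n" using step by simp
    then have "(3 * Suc n) ^ 4 \<le> (4 * n) ^ 4" by (intro power_mono) auto
    then show ?thesis by (simp only: power_mult_distrib) simp
  qed
  then show ?case using step by simp
qed simp

lemma eight_square_le_two_power: "u \<ge> 10 \<Longrightarrow> 8 * u\<^sup>2 \<le> (2::nat) ^ u"
proof (induction u rule: dec_induct)
  case (step n)
  have "(Suc n)\<^sup>2 \<le> 2 * n\<^sup>2"
  proof -
    have "10 * n \<le> n * n" using step by simp
    moreover have "(Suc n)\<^sup>2 = n * n + 2 * n + 1" by (simp add: power2_eq_square)
    ultimately show ?thesis using step by (simp only: power2_eq_square)
  qed
  then show ?case using step by simp
qed simp

lemma eight_square_le_three_power: "u \<ge> 6 \<Longrightarrow> 8 * u\<^sup>2 \<le> (3::nat) ^ u"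
proof (induction u rule: dec_induct)
  case (step n)
  have "(Suc n)\<^sup>2 \<le> 3 * n\<^sup>2"
  proof -
    have "6 * n \<le> n * n" using step by simp
    moreover have "(Suc n)\<^sup>2 = n * n + 2 * n + 1" by (simp add: power2_eq_square)
    ultimately show ?thesis using step by (simp only: power2_eq_square)
  qed
  then show ?case using step by simp
qed simp

text \<open>The numbers come from a chief factor L/A of order q ^ u over a field K of order p ^ e,
  with s = dim_K(V) and r = e s; q divides p ^ e - 1 because K contains a root of unity of order q.
  The 3 is the price in derived steps of L and A. For an extraspecial group acting faithfully and
  irreducibly q ^ u = s^2.\<close>

lemma length_bound_extraspecial:
  assumes bq: "length_bound q u j" and le: "q ^ u \<le> s\<^sup>2"
    and p: "Factorial_Ring.prime p" and q: "Factorial_Ring.prime q" and dvd: "q dvd p ^ e - 1"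
    and pos: "e \<ge> 1" "u \<ge> 1"
  shows "length_bound p (e * s) (3 + j)"
proof -
  define c where "c x = (if x = 2 then 2 else 1::nat)" for x :: nat
  have q2: "q \<ge> 2" and p2: "p \<ge> 2" using p q prime_ge_2_nat by auto
  have qu: "q \<le> q ^ u" using q2 pos self_le_power[of q u] by simp
  have "p ^ e \<ge> 1" using p2 by simp
  have npq: "p \<noteq> q"
  proof
    assume "p = q"
    then have "q dvd p ^ e" using pos by (simp add: dvd_power)
    then have "q dvd p ^ e - (p ^ e - 1)" using dvd dvd_diff_nat by blast
    then show False using \<open>p ^ e \<ge> 1\<close> q by simp
  qed
  have s2: "s \<ge> 2"
  proof (rule ccontr)
    assume "\<not> 2 \<le> s"
    then have "s \<le> 1" by simp
    then have "s\<^sup>2 \<le> 1\<^sup>2" by (intro power_mono) auto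
    then show False using le q2 qu by simp
  qed
  have s3: "s \<ge> 3" if "q \<ge> 5"
  proof (rule ccontr)
    assume "\<not> 3 \<le> s"
    then have "s \<le> 2" by simp
    then have "s\<^sup>2 \<le> 2\<^sup>2" by (intro power_mono) auto
    then show False using le that qu by simp
  qed
  have jq: "2 ^ (j + c q) \<le> s ^ 4"
  proof -
    have "2 ^ (j + c q) \<le> q ^ (2 * u)" using bq by (simp add: length_bound_def c_def)
    also have "\<dots> = (q ^ u)\<^sup>2" by (simp add: power_mult mult.commute)
    also have "\<dots> \<le> (s\<^sup>2)\<^sup>2" using le by (intro power_mono) auto
    finally show ?thesis by simp
  qed
  have second: "2 ^ (3 + j + c p) \<le> p ^ (2 * (e * s))"
  proof -
    consider "p = 2" | "p = 3" | "p \<ge> 5"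
    proof -
      have "p \<noteq> 4" using p by auto
      then show ?thesis using p2 that by linarith
    qed
    then show ?thesis
    proof cases
      case 1
      \<comment> \<open>No prime divides 2 - 1, so p = 2 forces e >= 2; the doubled exponent pays
        for the larger unit demanded at p = 2.\<close>
      have "e \<noteq> 1" using dvd 1 q by auto
      then have e: "e \<ge> 2" using pos by simp
      have cq: "c q = 1" using npq 1 by (simp add: c_def)
      have "2 ^ (3 + j + c p) = 16 * (2::nat) ^ (j + c q)"
        using 1 cq by (simp add: c_def power_add)
      also have "\<dots> \<le> 16 * s ^ 4" using jq by simp
      also have "\<dots> \<le> 16 ^ s" by (rule sixteen_power[OF s2])
      also have "\<dots> = 2 ^ (2 * (2 * s))" by (simp add: power_mult)
      also have "\<dots> \<le> p ^ (2 * (e * s))" unfolding 1 using e by (intro power_increasing) auto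
      finally show ?thesis .
    next
      case 2
      have cp: "c p = 1" using 2 by (simp add: c_def)
      \<comment> \<open>This is where the extra unit at q = 2 is spent: for s = 2 it leaves 4 * 16
        <= 81, whereas 8 * 16 would be too large. For q >= 5 there is no such gain, but q <= s^2
        excludes s = 2.\<close>
      have *: "2 ^ (3 + j + c p) \<le> (9::nat) ^ s"
      proof (cases "q = 2")
        case True
        have "2 ^ (3 + j + c p) = 4 * (2::nat) ^ (j + c q)"
          using True cp by (simp add: c_def power_add)
        also have "\<dots> \<le> 4 * s ^ 4" using jq by simp
        also have "\<dots> \<le> 9 ^ s" by (rule four_nine_power[OF s2])
        finally show ?thesis .
      next
        case False
        have "q \<noteq> 3" "q \<noteq> 4" using npq 2 q by auto
        then have q5: "q \<ge> 5" using False q2 by linarith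
        have "2 ^ (3 + j + c p) = 8 * (2::nat) ^ (j + c q)"
          using False cp by (simp add: c_def power_add)
        also have "\<dots> \<le> 8 * s ^ 4" using jq by simp
        also have "\<dots> \<le> 9 ^ s" by (rule eight_nine_power[OF s3[OF q5]])
        finally show ?thesis .
      qed
      have "(9::nat) ^ s = 3 ^ (2 * s)" by (simp add: power_mult)
      also have "\<dots> \<le> p ^ (2 * (e * s))" unfolding 2 using pos by (intro power_increasing) auto
      finally show ?thesis using * by linarith
    next
      case 3
      have cp: "c p = 1" using 3 by (simp add: c_def)
      have "2 ^ (3 + j + c p) \<le> 16 * (2::nat) ^ (j + c q)"
        using cp by (simp add: c_def power_add)
      also have "\<dots> \<le> 16 * s ^ 4" using jq by simp
      also have "\<dots> \<le> 16 ^ s" by (rule sixteen_power[OF s2])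
      also have "\<dots> = 4 ^ (2 * s)" by (simp add: power_mult)
      also have "\<dots> \<le> p ^ (2 * s)" using 3 by (intro power_mono) auto
      also have "\<dots> \<le> p ^ (2 * (e * s))" using pos p2 by (intro power_increasing) auto
      finally show ?thesis .
    qed
  qed
  have first: "2 ^ (3 + j) \<le> 1024 * s\<^sup>2"
  proof -
    \<comment> \<open>For small q ^ u the companion bound decides, with exactly 2 ^ 19 = 1024 * 2 ^
      9 at q = 2, u = 9, and with threshold 256 = 1024 / 4 for odd q. Beyond that, 8 u^2 <= q ^ u
      absorbs the factor 2 ^ 3.\<close>
    have "2 ^ (3 + j) \<le> 1024 * q ^ u"
    proof (cases "q = 2")
      case True
      show ?thesis
      proof (cases "u \<le> 9")
        case u: True
        have "2 ^ (j + 2) \<le> (2::nat) ^ (2 * u)" using bq True by (simp add: length_bound_def)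
        then have "j + 2 \<le> 2 * u" by (simp only: power_increasing_iff)
        then have "3 + j \<le> 10 + u" using u by linarith
        then have "2 ^ (3 + j) \<le> (2::nat) ^ (10 + u)" by (intro power_increasing) auto
        then show ?thesis using True by (simp add: power_add)
      next
        case False
        then have "8 * u\<^sup>2 \<le> 2 ^ u" by (intro eight_square_le_two_power) auto
        then show ?thesis using bq True by (simp add: length_bound_def power_add)
      qed
    next
      case False
      then have q3: "q \<ge> 3" using q2 by simp
      show ?thesis
      proof (cases "q ^ u \<le> 256")
        case y: True
        have "2 ^ (j + 1) \<le> (q ^ u)\<^sup>2"
          using bq False by (simp add: length_bound_def power_mult mult.commute)
        then have "2 ^ (3 + j) \<le> 4 * (q ^ u * q ^ u)"
          by (simp add: power_add power2_eq_square)
        also have "\<dots> \<le> 4 * (256 * q ^ u)" using y by simp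
        finally show ?thesis by simp
      next
        case y: False
        have "8 * u\<^sup>2 \<le> q ^ u"
        proof (cases "u \<le> 5")
          case True
          then have "u\<^sup>2 \<le> 5\<^sup>2" by (intro power_mono) auto
          then show ?thesis using y by simp
        next
          case False
          then have "8 * u\<^sup>2 \<le> 3 ^ u" by (intro eight_square_le_three_power) auto
          also have "\<dots> \<le> q ^ u" using q3 by (intro power_mono) auto
          finally show ?thesis .
        qed
        moreover have "2 ^ j \<le> 1024 * u\<^sup>2" using bq by (simp add: length_bound_def)
        ultimately show ?thesis by (simp add: power_add)
      qed
    qed
    also have "\<dots> \<le> 1024 * s\<^sup>2" using le by simp
    finally show ?thesis .
  qed
  have "s\<^sup>2 \<le> (e * s)\<^sup>2" using pos by (intro power_mono) auto
  then show ?thesis using first second unfolding length_bound_def c_def by linarith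
qed

section \<open>Commutators and chief factors\<close>

lemma maximal_subset:
  assumes "finite U" "P Y0" "\<And>Y. P Y \<Longrightarrow> Y \<subseteq> U"
  shows "\<exists>M. P M \<and> (\<forall>Y. P Y \<longrightarrow> M \<subseteq> Y \<longrightarrow> Y = M)"
proof -
  have "{Y. P Y} \<subseteq> Pow U"
  proof
    fix Y assume "Y \<in> {Y. P Y}"
    then have "P Y" by (rule CollectD)
    from assms(3)[OF this] show "Y \<in> Pow U" by (rule PowI)
  qed
  then have "finite {Y. P Y}" by (rule finite_subset) (simp add: assms(1))
  moreover have "{Y. P Y} \<noteq> {}" using assms(2) by auto
  ultimately have "\<exists>M\<in>{Y. P Y}. \<forall>Y\<in>{Y. P Y}. M \<subseteq> Y \<longrightarrow> M = Y" by (rule finite_has_maximal)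
  then show ?thesis by (simp add: eq_commute)
qed

lemma minimal_subset:
  assumes "finite U" "P Y0" "\<And>Y. P Y \<Longrightarrow> Y \<subseteq> U"
  shows "\<exists>M. P M \<and> (\<forall>Y. P Y \<longrightarrow> Y \<subseteq> M \<longrightarrow> Y = M)"
proof -
  have "{Y. P Y} \<subseteq> Pow U"
  proof
    fix Y assume "Y \<in> {Y. P Y}"
    then have "P Y" by (rule CollectD)
    from assms(3)[OF this] show "Y \<in> Pow U" by (rule PowI)
  qed
  then have "finite {Y. P Y}" by (rule finite_subset) (simp add: assms(1))
  moreover have "{Y. P Y} \<noteq> {}" using assms(2) by auto
  ultimately have "\<exists>M\<in>{Y. P Y}. \<forall>Y\<in>{Y. P Y}. Y \<subseteq> M \<longrightarrow> M = Y" by (rule finite_has_minimal)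
  then show ?thesis by (simp add: eq_commute)
qed

definition cmt :: "('g, 'm) monoid_scheme \<Rightarrow> 'g \<Rightarrow> 'g \<Rightarrow> 'g" where
  "cmt G x y = x \<otimes>\<^bsub>G\<^esub> y \<otimes>\<^bsub>G\<^esub> inv\<^bsub>G\<^esub> x \<otimes>\<^bsub>G\<^esub> inv\<^bsub>G\<^esub> y"

definition chief_factor :: "('g, 'm) monoid_scheme \<Rightarrow> 'g set \<Rightarrow> 'g set \<Rightarrow> bool" where
  "chief_factor G N L \<longleftrightarrow> N \<lhd> G \<and> L \<lhd> G \<and> N \<subset> L \<and>
     (\<forall>K. K \<lhd> G \<and> N \<subseteq> K \<and> K \<subseteq> L \<longrightarrow> K = N \<or> K = L)"

context group
begin

lemma inv_mult_cancel [simp]: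
  assumes "x \<in> carrier G" "y \<in> carrier G"
  shows "inv x \<otimes> (x \<otimes> y) = y" "x \<otimes> (inv x \<otimes> y) = y"
  using assms by (simp_all flip: m_assoc)

lemma cmt_closed [simp]: "x \<in> carrier G \<Longrightarrow> y \<in> carrier G \<Longrightarrow> cmt G x y \<in> carrier G"
  by (simp add: cmt_def)

lemma mult_eq_cmt_mult:
  assumes "x \<in> carrier G" "y \<in> carrier G"
  shows "x \<otimes> y = cmt G x y \<otimes> (y \<otimes> x)"
  using assms by (simp add: cmt_def m_assoc)

lemma conj_eq_cmt_mult:
  assumes "x \<in> carrier G" "y \<in> carrier G"
  shows "x \<otimes> y \<otimes> inv x = cmt G x y \<otimes> y"
  using assms by (simp add: cmt_def m_assoc)

lemma cmt_mem_derived: "x \<in> H \<Longrightarrow> y \<in> H \<Longrightarrow> cmt G x y \<in> derived G H"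
  unfolding derived_def cmt_def by (rule generate.incl) blast

lemma derived_subsetI:
  assumes "subgroup K G" "\<And>x y. x \<in> H \<Longrightarrow> y \<in> H \<Longrightarrow> cmt G x y \<in> K"
  shows "derived G H \<subseteq> K"
  unfolding derived_def using assms by (intro generate_subgroup_incl) (auto simp: cmt_def)

lemma exp_of_derived_normal: "(derived G ^^ j) (carrier G) \<lhd> G"
  by (induction j) (auto intro: normal_self derived_is_normal)

lemma exp_of_derived_add: "(derived G ^^ (i + j)) H = (derived G ^^ j) ((derived G ^^ i) H)"
  by (metis add.commute comp_apply funpow_add)

lemma exp_of_derived_subset: "subgroup H G \<Longrightarrow> (derived G ^^ j) H \<subseteq> H"
proof (induction j)
  case (Suc j)
  then show ?case using derived_incl[of "(derived G ^^ j) H" H] by simp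
qed simp

lemma exp_of_derived_antimono:
  assumes "i \<le> j"
  shows "(derived G ^^ j) (carrier G) \<subseteq> (derived G ^^ i) (carrier G)"
proof -
  have "(derived G ^^ (i + (j - i))) (carrier G) \<subseteq> (derived G ^^ i) (carrier G)"
    unfolding exp_of_derived_add
    by (intro exp_of_derived_subset normal_imp_subgroup exp_of_derived_normal)
  then show ?thesis using assms by simp
qed

lemma exp_of_derived_consistent:
  assumes "subgroup H G"
  shows "(derived (G\<lparr>carrier := H\<rparr>) ^^ j) H = (derived G ^^ j) H"
proof (induction j)
  case (Suc j)
  then show ?case using derived_consistent[OF exp_of_derived_subset[OF assms] assms] by simp
qed simp

lemma solvable_restrict:
  assumes "subgroup H G" "solvable G"
  shows "solvable (G\<lparr>carrier := H\<rparr>)"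
proof -
  obtain n where n: "(derived G ^^ n) (carrier G) = {\<one>}"
    using assms(2) solvable_iff_trivial_derived_seq by blast
  have "(derived G ^^ n) H \<subseteq> {\<one>}"
    using mono_exp_of_derived[OF subgroup.subset[OF assms(1)], of n] n by simp
  moreover have "\<one> \<in> (derived G ^^ n) H"
    using exp_of_derived_is_subgroup[OF assms(1)] subgroup.one_closed by blast
  ultimately have "(derived (G\<lparr>carrier := H\<rparr>) ^^ n) H = {\<one>}"
    unfolding exp_of_derived_consistent[OF assms(1)] by blast
  then show ?thesis
    using group.solvable_iff_trivial_derived_seq[OF subgroup_imp_group[OF assms(1)]] by auto
qed

lemma normalI_conj:
  assumes "subgroup N G" "\<And>g x. g \<in> carrier G \<Longrightarrow> x \<in> N \<Longrightarrow> g \<otimes> x \<otimes> inv g \<in> N"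
  shows "N \<lhd> G"
  using assms normal_inv_iff by blast

lemma normal_conj: "N \<lhd> G \<Longrightarrow> g \<in> carrier G \<Longrightarrow> x \<in> N \<Longrightarrow> g \<otimes> x \<otimes> inv g \<in> N"
  using normal_inv_iff by blast

lemma normal_cmt:
  assumes "N \<lhd> G" "g \<in> carrier G" "x \<in> N"
  shows "cmt G g x \<in> N" "cmt G x g \<in> N"
proof -
  have N: "subgroup N G" using assms(1) normal_imp_subgroup by blast
  have x: "x \<in> carrier G" using subgroup.mem_carrier[OF N assms(3)] .
  show "cmt G g x \<in> N"
    unfolding cmt_def using normal_conj[OF assms] N assms(3)
    by (simp add: subgroup.m_closed subgroup.m_inv_closed)
  have "g \<otimes> inv x \<otimes> inv g \<in> N"
    using normal_conj[OF assms(1,2)] subgroup.m_inv_closed[OF N assms(3)] by blast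
  then have "x \<otimes> (g \<otimes> inv x \<otimes> inv g) \<in> N" using subgroup.m_closed[OF N assms(3)] by blast
  then show "cmt G x g \<in> N" using x assms(2) by (simp add: cmt_def m_assoc)
qed

lemma normal_set_mult:
  assumes "N \<lhd> G" "L \<lhd> G"
  shows "N <#> L \<lhd> G"
proof (rule normalI_conj)
  show "subgroup (N <#> L) G"
    using second_isomorphism_grp.normal_set_mult_subgroup[of N G L] assms
    by (simp add: second_isomorphism_grp_def second_isomorphism_grp_axioms_def normal_imp_subgroup)
  fix g x assume g: "g \<in> carrier G" and "x \<in> N <#> L"
  then obtain n l where nl: "n \<in> N" "l \<in> L" "x = n \<otimes> l" by (auto simp: set_mult_def)
  have "n \<in> carrier G" "l \<in> carrier G"
    using nl assms normal_imp_subgroup subgroup.mem_carrier by metis+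
  then have "g \<otimes> x \<otimes> inv g = (g \<otimes> n \<otimes> inv g) \<otimes> (g \<otimes> l \<otimes> inv g)"
    using g nl(3) by (simp add: m_assoc)
  then show "g \<otimes> x \<otimes> inv g \<in> N <#> L"
    using normal_conj[OF assms(1) g nl(1)] normal_conj[OF assms(2) g nl(2)]
    by (auto simp: set_mult_def)
qed

lemma subgroup_set_mult:
  assumes "N \<lhd> G" "subgroup H G"
  shows "subgroup (N <#> H) G" "N \<subseteq> N <#> H" "H \<subseteq> N <#> H"
proof -
  have N: "subgroup N G" using assms(1) normal_imp_subgroup by blast
  show "subgroup (N <#> H) G"
    using second_isomorphism_grp.normal_set_mult_subgroup[of N G H] assms
    by (simp add: second_isomorphism_grp_def second_isomorphism_grp_axioms_def)
  show "N \<subseteq> N <#> H"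
  proof
    fix x assume x: "x \<in> N"
    then have "x = x \<otimes> \<one>" using subgroup.mem_carrier[OF N] by simp
    then show "x \<in> N <#> H" using x subgroup.one_closed[OF assms(2)] unfolding set_mult_def by blast
  qed
  show "H \<subseteq> N <#> H"
  proof
    fix x assume x: "x \<in> H"
    then have "x = \<one> \<otimes> x" using subgroup.mem_carrier[OF assms(2)] by simp
    then show "x \<in> N <#> H" using x subgroup.one_closed[OF N] unfolding set_mult_def by blast
  qed
qed


lemma normal_mem_carrier: "N \<lhd> G \<Longrightarrow> x \<in> N \<Longrightarrow> x \<in> carrier G"
  by (rule subgroup.mem_carrier[OF normal_imp_subgroup])

lemma normal_subset: "N \<lhd> G \<Longrightarrow> N \<subseteq> carrier G"
  by (rule subgroup.subset[OF normal_imp_subgroup])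

section \<open>Chief factors and centralizers modulo a normal subgroup\<close>

lemma chief_factor_exists:
  assumes "N \<lhd> G" "L \<lhd> G" "N \<subset> L" "finite (carrier G)"
  shows "\<exists>K. chief_factor G N K \<and> K \<subseteq> L"
proof -
  let ?P = "\<lambda>K. K \<lhd> G \<and> N \<subset> K \<and> K \<subseteq> L"
  have "?P L" using assms by simp
  moreover have "\<And>K. ?P K \<Longrightarrow> K \<subseteq> L" by simp
  ultimately obtain K where K1_K2: "?P K \<and> (\<forall>K'. ?P K' \<longrightarrow> K' \<subseteq> K \<longrightarrow> K' = K)"
    by (rule minimal_subset[of L ?P, OF finite_subset[OF normal_subset[OF assms(2)] assms(4)], THEN exE])
  note K1 = K1_K2[THEN conjunct1] and K2 = K1_K2[THEN conjunct2, rule_format]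
  have "K' = N \<or> K' = K" if K': "K' \<lhd> G" "N \<subseteq> K'" "K' \<subseteq> K" for K'
  proof (rule disjCI)
    assume "K' \<noteq> K"
    moreover have "K' \<subseteq> L" by (rule subset_trans[OF K'(3)]) (use K1 in simp)
    ultimately show "K' = N" using K'(1,2) K2[OF _ K'(3)] by (metis psubsetI)
  qed
  then have "chief_factor G N K" using K1 assms(1) unfolding chief_factor_def by simp
  then show ?thesis using K1 by auto
qed

text \<open>For normal N, the preimage of the centralizer of the image of S in G/N. With N the
  kernel of a representation it expresses that operators commute; with N < S consecutive in a chief
  series it is the kernel of the action on S/N. Staying inside G avoids a change of group.\<close>

definition cent_mod :: "'a set \<Rightarrow> 'a set \<Rightarrow> 'a set" where
  "cent_mod N S = {g \<in> carrier G. \<forall>x\<in>S. cmt G g x \<in> N}"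

lemma subgroup_cent_mod:
  assumes N: "N \<lhd> G" and S: "S \<subseteq> carrier G"
  shows "subgroup (cent_mod N S) G"
proof (rule subgroupI)
  have Ns: "subgroup N G" using N normal_imp_subgroup by blast
  show "cent_mod N S \<subseteq> carrier G" by (auto simp: cent_mod_def)
  have "\<one> \<in> cent_mod N S" using subgroup.one_closed[OF Ns] S by (auto simp: cent_mod_def cmt_def)
  then show "cent_mod N S \<noteq> {}" by blast
  fix g assume g: "g \<in> cent_mod N S"
  then have gc: "g \<in> carrier G" by (simp add: cent_mod_def)
  have "cmt G (inv g) x \<in> N" if x: "x \<in> S" for x
  proof -
    have xc: "x \<in> carrier G" using x S by blast
    have "inv (cmt G g x) \<in> N" using g x subgroup.m_inv_closed[OF Ns] by (auto simp: cent_mod_def)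
    then have "inv g \<otimes> inv (cmt G g x) \<otimes> inv (inv g) \<in> N" using normal_conj[OF N] gc by blast
    moreover have "inv g \<otimes> inv (cmt G g x) \<otimes> inv (inv g) = cmt G (inv g) x"
      using gc xc by (simp add: cmt_def inv_mult_group m_assoc)
    ultimately show ?thesis by simp
  qed
  then show "inv g \<in> cent_mod N S" using gc by (simp add: cent_mod_def)
  fix h assume h: "h \<in> cent_mod N S"
  then have hc: "h \<in> carrier G" by (simp add: cent_mod_def)
  have "cmt G (g \<otimes> h) x \<in> N" if x: "x \<in> S" for x
  proof -
    have xc: "x \<in> carrier G" using x S by blast
    have "g \<otimes> cmt G h x \<otimes> inv g \<otimes> cmt G g x \<in> N"
      using g h x normal_conj[OF N gc] subgroup.m_closed[OF Ns] by (auto simp: cent_mod_def)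
    moreover have "g \<otimes> cmt G h x \<otimes> inv g \<otimes> cmt G g x = cmt G (g \<otimes> h) x"
      using gc hc xc by (simp add: cmt_def inv_mult_group m_assoc)
    ultimately show ?thesis by simp
  qed
  then show "g \<otimes> h \<in> cent_mod N S" using gc hc by (simp add: cent_mod_def)
qed

lemma normal_cent_mod:
  assumes N: "N \<lhd> G" and S: "S \<lhd> G"
  shows "cent_mod N S \<lhd> G"
proof (rule normalI_conj)
  have Ss: "subgroup S G" using S normal_imp_subgroup by blast
  show "subgroup (cent_mod N S) G" using subgroup_cent_mod[OF N subgroup.subset[OF Ss]] .
  fix h g assume h: "h \<in> carrier G" and g: "g \<in> cent_mod N S"
  then have gc: "g \<in> carrier G" by (simp add: cent_mod_def)
  have "cmt G (h \<otimes> g \<otimes> inv h) x \<in> N" if x: "x \<in> S" for x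
  proof -
    have xc: "x \<in> carrier G" using x subgroup.mem_carrier[OF Ss] by blast
    have "inv h \<otimes> x \<otimes> inv (inv h) \<in> S" using normal_conj[OF S _ x, of "inv h"] h by blast
    then have "cmt G g (inv h \<otimes> x \<otimes> h) \<in> N" using g h by (simp add: cent_mod_def)
    then have "h \<otimes> cmt G g (inv h \<otimes> x \<otimes> h) \<otimes> inv h \<in> N" using normal_conj[OF N h] by blast
    moreover have "h \<otimes> cmt G g (inv h \<otimes> x \<otimes> h) \<otimes> inv h = cmt G (h \<otimes> g \<otimes> inv h) x"
      using gc h xc by (simp add: cmt_def inv_mult_group m_assoc)
    ultimately show ?thesis by simp
  qed
  then show "h \<otimes> g \<otimes> inv h \<in> cent_mod N S" using gc h by (simp add: cent_mod_def)
qed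

text \<open>From [x,y]^-1 = [y,x]. Together with \<open>subgroup_cent_mod\<close> it lets
  centralization by a product be checked on its factors, in either argument of the
  commutator.\<close>

lemma cent_mod_sym:
  assumes N: "N \<lhd> G" and "S \<subseteq> carrier G" "Y \<subseteq> carrier G" "S \<subseteq> cent_mod N Y"
  shows "Y \<subseteq> cent_mod N S"
proof
  fix y assume y: "y \<in> Y"
  have "cmt G y x \<in> N" if x: "x \<in> S" for x
  proof -
    have "inv (cmt G x y) \<in> N"
    proof (rule subgroup.m_inv_closed[OF normal_imp_subgroup[OF N]])
      show "cmt G x y \<in> N" using subsetD[OF assms(4) x] y by (simp add: cent_mod_def)
    qed
    moreover have "inv (cmt G x y) = cmt G y x"
    proof -
      have "x \<in> carrier G" "y \<in> carrier G" using x y assms(2,3) by auto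
      then show ?thesis by (simp add: cmt_def inv_mult_group m_assoc)
    qed
    ultimately show ?thesis by simp
  qed
  then show "y \<in> cent_mod N S" using y assms(3) by (auto simp: cent_mod_def)
qed

lemma normal_subset_cent_mod: "N \<lhd> G \<Longrightarrow> S \<subseteq> carrier G \<Longrightarrow> N \<subseteq> cent_mod N S"
  using normal_cmt(2)[of N] subgroup.mem_carrier[OF normal_imp_subgroup[of N G]]
  by (auto simp: cent_mod_def subset_iff)

lemma set_mult_subset:
  assumes "subgroup K G" "A \<subseteq> K" "B \<subseteq> K"
  shows "A <#> B \<subseteq> K"
  using subgroup.m_closed[OF assms(1)] assms(2,3) by (auto simp: set_mult_def subset_iff)

text \<open>Let D j be the last derived subgroup of L not contained in N. By minimality N D j = L,
  and D j commutes with itself modulo N, so L does.\<close>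

lemma chief_factor_abelian:
  assumes "chief_factor G N L" "solvable G"
  shows "derived G L \<subseteq> N"
proof -
  have N: "N \<lhd> G" and L: "L \<lhd> G" and NL: "N \<subset> L" using assms(1) by (auto simp: chief_factor_def)
  have Ns: "subgroup N G" and Ls: "subgroup L G" using N L normal_imp_subgroup by auto
  have Lc: "L \<subseteq> carrier G" using subgroup.subset[OF Ls] .
  define D where "D j = (derived G ^^ j) L" for j
  have Dn: "D j \<lhd> G" for j
    unfolding D_def by (induction j) (use L derived_is_normal in auto)
  have Dc: "D j \<subseteq> carrier G" for j using Dn normal_imp_subgroup subgroup.subset by blast
  obtain m where m: "(derived G ^^ m) (carrier G) = {\<one>}"
    using assms(2) solvable_iff_trivial_derived_seq by blast
  have "D m \<subseteq> N"
    using mono_exp_of_derived[OF Lc, of m] m subgroup.one_closed[OF Ns] by (auto simp: D_def)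
  moreover have "\<not> D 0 \<subseteq> N" using NL by (auto simp: D_def)
  ultimately obtain j where j: "\<not> D j \<subseteq> N" "D (Suc j) \<subseteq> N"
    using ex_least_nat_less[of "\<lambda>j. D j \<subseteq> N" m] by blast
  let ?K = "N <#> D j"
  have "D j \<subseteq> L" unfolding D_def using exp_of_derived_subset[OF Ls] .
  then have "?K \<subseteq> L" using set_mult_subset[OF Ls] NL by blast
  moreover have K: "N \<subseteq> ?K" "D j \<subseteq> ?K" using subgroup_set_mult[OF N normal_imp_subgroup[OF Dn]] by auto
  ultimately have KL: "?K = L"
    using assms(1) normal_set_mult[OF N Dn, of j] j(1) unfolding chief_factor_def by blast
  have "D j \<subseteq> cent_mod N (D j)"
    using j(2) Dc[of j] cmt_mem_derived[of _ "D j"] by (fastforce simp: cent_mod_def D_def)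
  \<comment> \<open>The left argument of the commutator grows from D j to L;
    \<open>cent_mod_sym\<close> then exchanges the arguments so that the other one can grow
    too.\<close>
  then have "L \<subseteq> cent_mod N (D j)"
    unfolding KL[symmetric] using set_mult_subset[OF subgroup_cent_mod[OF N Dc]] normal_subset_cent_mod[OF N Dc] by blast
  then have "D j \<subseteq> cent_mod N L" using cent_mod_sym[OF N Lc Dc] by blast
  then have "L \<subseteq> cent_mod N L"
    using set_mult_subset[OF subgroup_cent_mod[OF N Lc], of N "D j"] normal_subset_cent_mod[OF N Lc] KL by blast
  then show ?thesis by (intro derived_subsetI[OF Ns]) (auto simp: cent_mod_def)
qed

end

section \<open>Finite modules over a group\<close>

definition invariant_subgroup :: "'g set \<Rightarrow> ('v, 'n) monoid_scheme \<Rightarrow> ('g \<Rightarrow> 'v \<Rightarrow> 'v) \<Rightarrow> 'v set \<Rightarrow> bool" where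
  "invariant_subgroup H V act W \<longleftrightarrow> subgroup W V \<and> (\<forall>g\<in>H. \<forall>w\<in>W. act g w \<in> W)"

text \<open>Group and module are explicit sets so that the predicate also applies to a subgroup of V
  under a block stabilizer.\<close>

definition irreducible_on :: "'g set \<Rightarrow> ('v, 'n) monoid_scheme \<Rightarrow> ('g \<Rightarrow> 'v \<Rightarrow> 'v) \<Rightarrow> 'v set \<Rightarrow> bool" where
  "irreducible_on H V act Y \<longleftrightarrow> Y \<noteq> {\<one>\<^bsub>V\<^esub>} \<and> invariant_subgroup H V act Y \<and>
     (\<forall>W. invariant_subgroup H V act W \<and> W \<subseteq> Y \<longrightarrow> W = {\<one>\<^bsub>V\<^esub>} \<or> W = Y)"

text \<open>No ground field is fixed and V is written multiplicatively, because chief factors arrive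
  as quotient groups; the prime is recovered by \<open>irreducible_on_prime_power\<close>. The
  action may have a kernel, so later statements about commuting are made modulo
  \<open>Ker\<close>.\<close>

locale group_module = group G + V: comm_group V
  for G :: "('g, 'm) monoid_scheme" (structure) and V :: "('v, 'n) monoid_scheme" +
  fixes act :: "'g \<Rightarrow> 'v \<Rightarrow> 'v"
  assumes act_hom: "g \<in> carrier G \<Longrightarrow> act g \<in> hom V V"
    and act_mult: "g \<in> carrier G \<Longrightarrow> h \<in> carrier G \<Longrightarrow> v \<in> carrier V \<Longrightarrow> act (g \<otimes> h) v = act g (act h v)"
    and act_one: "v \<in> carrier V \<Longrightarrow> act \<one> v = v"
    and finG: "finite (carrier G)" and finV: "finite (carrier V)"
begin

lemma act_closed [simp]: "g \<in> carrier G \<Longrightarrow> v \<in> carrier V \<Longrightarrow> act g v \<in> carrier V"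
  using act_hom by (auto simp: hom_def)

lemma act_add:
  "g \<in> carrier G \<Longrightarrow> v \<in> carrier V \<Longrightarrow> w \<in> carrier V \<Longrightarrow> act g (v \<otimes>\<^bsub>V\<^esub> w) = act g v \<otimes>\<^bsub>V\<^esub> act g w"
  using act_hom by (auto simp: hom_def)

lemma act_group_hom: "g \<in> carrier G \<Longrightarrow> group_hom V V (act g)"
  using act_hom by (simp add: group_hom_def group_hom_axioms_def V.is_group)

lemma act_unit [simp]: "g \<in> carrier G \<Longrightarrow> act g \<one>\<^bsub>V\<^esub> = \<one>\<^bsub>V\<^esub>"
  using group_hom.hom_one[OF act_group_hom] .

lemma act_inv: "g \<in> carrier G \<Longrightarrow> v \<in> carrier V \<Longrightarrow> act g (inv\<^bsub>V\<^esub> v) = inv\<^bsub>V\<^esub> act g v"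
  using group_hom.hom_inv[OF act_group_hom] .

lemma act_pow: "g \<in> carrier G \<Longrightarrow> v \<in> carrier V \<Longrightarrow> act g (v [^]\<^bsub>V\<^esub> (n::nat)) = act g v [^]\<^bsub>V\<^esub> n"
  using group_hom.hom_nat_pow[OF act_group_hom] .

lemma act_cancel [simp]:
  assumes "g \<in> carrier G" "v \<in> carrier V"
  shows "act (inv g) (act g v) = v" "act g (act (inv g) v) = v"
  using assms act_mult[of "inv g" g v] act_mult[of g "inv g" v] act_one by auto

lemma act_inj: "g \<in> carrier G \<Longrightarrow> inj_on (act g) (carrier V)"
  by (metis act_cancel(1) inj_onI)

lemma subgroup_image: "g \<in> carrier G \<Longrightarrow> subgroup W V \<Longrightarrow> subgroup (act g ` W) V"
  by (intro group_hom.subgroup_img_is_subgroup[OF act_group_hom])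

lemma card_image: "g \<in> carrier G \<Longrightarrow> subgroup W V \<Longrightarrow> card (act g ` W) = card W"
  by (intro card_image inj_on_subset[OF act_inj]) (auto dest: subgroup.subset)

lemma group_module_restrict:
  assumes M: "subgroup M G" and Y: "invariant_subgroup M V act Y"
  shows "group_module (G\<lparr>carrier := M\<rparr>) (V\<lparr>carrier := Y\<rparr>) act"
proof -
  have Ys: "subgroup Y V" and Yi: "\<And>g w. g \<in> M \<Longrightarrow> w \<in> Y \<Longrightarrow> act g w \<in> Y" using Y by (auto simp: invariant_subgroup_def)
  have Mc: "\<And>g. g \<in> M \<Longrightarrow> g \<in> carrier G" and Yc: "\<And>v. v \<in> Y \<Longrightarrow> v \<in> carrier V"
    using subgroup.mem_carrier[OF M] subgroup.mem_carrier[OF Ys] by auto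
  interpret Mg: group "G\<lparr>carrier := M\<rparr>" using subgroup_imp_group[OF M] .
  interpret Yg: comm_group "V\<lparr>carrier := Y\<rparr>"
    using V.subgroup_imp_group[OF Ys] Yc by (intro group.group_comm_groupI) (auto simp: V.m_comm)
  show ?thesis
  proof unfold_locales
    show "act g \<in> hom (V\<lparr>carrier := Y\<rparr>) (V\<lparr>carrier := Y\<rparr>)" if "g \<in> carrier (G\<lparr>carrier := M\<rparr>)" for g
      using that Yi Mc Yc by (auto simp: hom_def act_add)
    show "finite (carrier (G\<lparr>carrier := M\<rparr>))"
      using finite_subset[OF subgroup.subset[OF M] finG] by simp
    show "finite (carrier (V\<lparr>carrier := Y\<rparr>))"
      using finite_subset[OF subgroup.subset[OF Ys] finV] by simp
  qed (use Mc Yc act_mult act_one in auto)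
qed

lemma irreducible_on_restrict:
  assumes "irreducible_on M V act Y"
  shows "irreducible_on (carrier (G\<lparr>carrier := M\<rparr>)) (V\<lparr>carrier := Y\<rparr>) act (carrier (V\<lparr>carrier := Y\<rparr>))"
proof -
  have Ys: "subgroup Y V" using assms by (simp add: irreducible_on_def invariant_subgroup_def)
  have Yg: "group (V\<lparr>carrier := Y\<rparr>)" using V.subgroup_imp_group[OF Ys] .
  have "subgroup W V" if "subgroup W (V\<lparr>carrier := Y\<rparr>)" for W
    using V.incl_subgroup[OF Ys that] .
  moreover have "subgroup Y (V\<lparr>carrier := Y\<rparr>)" using group.subgroup_self[OF Yg] by simp
  ultimately show ?thesis using assms subgroup.subset[of _ "V\<lparr>carrier := Y\<rparr>"] by (auto simp: irreducible_on_def invariant_subgroup_def)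
qed

text \<open>Spreads triviality: a normal subgroup fixing a nonzero vector of an irreducible module
  fixes every vector.\<close>

lemma fix_invariant_subgroup:
  assumes D: "D \<lhd> G"
  shows "invariant_subgroup (carrier G) V act {v \<in> carrier V. \<forall>d\<in>D. act d v = v}"
  unfolding invariant_subgroup_def
proof (intro conjI ballI)
  have Dc: "d \<in> carrier G" if "d \<in> D" for d using that normal_mem_carrier[OF D] by blast
  show "subgroup {v \<in> carrier V. \<forall>d\<in>D. act d v = v} V"
    by (rule V.subgroupI) (use Dc in \<open>auto simp: act_add act_inv intro!: exI[of _ "\<one>\<^bsub>V\<^esub>"]\<close>)
  fix g v assume g: "g \<in> carrier G" and v: "v \<in> {v \<in> carrier V. \<forall>d\<in>D. act d v = v}"
  have "act d (act g v) = act g v" if d: "d \<in> D" for d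
  proof -
    have "inv g \<otimes> d \<otimes> g \<in> D" using normal.inv_op_closed1[OF D g d] .
    then have "act (inv g \<otimes> d \<otimes> g) v = v" using v by blast
    then have "act g (act (inv g \<otimes> d \<otimes> g) v) = act g v" by simp
    then have "act (g \<otimes> (inv g \<otimes> d \<otimes> g)) v = act g v" using g v Dc[OF d] by (simp add: act_mult)
    moreover have "g \<otimes> (inv g \<otimes> d \<otimes> g) = d \<otimes> g" using g Dc[OF d] by (simp add: m_assoc)
    ultimately show ?thesis using g v Dc[OF d] by (simp add: act_mult)
  qed
  then show "act g v \<in> {v \<in> carrier V. \<forall>d\<in>D. act d v = v}" using g v by auto
qed

lemma irreducible_on_exists:
  assumes "invariant_subgroup H V act U" "U \<noteq> {\<one>\<^bsub>V\<^esub>}"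
  shows "\<exists>Y. irreducible_on H V act Y \<and> Y \<subseteq> U"
proof -
  let ?P = "\<lambda>Y. invariant_subgroup H V act Y \<and> Y \<noteq> {\<one>\<^bsub>V\<^esub>} \<and> Y \<subseteq> U"
  have finU: "finite U" using assms(1) finite_subset[OF subgroup.subset finV] by (simp add: invariant_subgroup_def)
  have "?P U" using assms by simp
  moreover have "\<And>Y. ?P Y \<Longrightarrow> Y \<subseteq> U" by simp
  ultimately obtain Y where Y1_Y2: "?P Y \<and> (\<forall>W. ?P W \<longrightarrow> W \<subseteq> Y \<longrightarrow> W = Y)"
    by (rule minimal_subset[of U ?P, OF finU, THEN exE])
  note Y1 = Y1_Y2[THEN conjunct1] and Y2 = Y1_Y2[THEN conjunct2, rule_format]
  have "W = {\<one>\<^bsub>V\<^esub>} \<or> W = Y" if "invariant_subgroup H V act W" "W \<subseteq> Y" for W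
    using that Y2[of W] Y1 by auto
  then have "irreducible_on H V act Y" using Y1 by (simp add: irreducible_on_def)
  then show ?thesis using Y1 by auto
qed

end

section \<open>Irreducible finite modules have prime power order\<close>

lemma (in group) cauchy:
  assumes "finite (carrier G)" "Factorial_Ring.prime p" "p dvd card (carrier G)"
  shows "\<exists>x\<in>carrier G. x \<noteq> \<one> \<and> x [^] p = \<one>"
proof -
  \<comment> \<open>Sylow's theorem is used with exponent 1, so m may still be divisible by
    p.\<close>
  obtain m where "order G = p ^ 1 * m" using assms(3) by (auto simp: order_def dvd_def)
  then obtain H where H: "subgroup H G" "card H = p"
    using sylow_thm[OF assms(2) is_group _ assms(1)] by (metis power_one_right)
  have Hg: "group (G\<lparr>carrier := H\<rparr>)" using subgroup_imp_group[OF H(1)] .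
  have "p \<ge> 2" using assms(2) prime_ge_2_nat by blast
  then have "\<not> H \<subseteq> {\<one>}" using H(2) card_mono[of "{\<one>}" H] by auto
  then obtain x where x: "x \<in> H" "x \<noteq> \<one>" by blast
  have "x [^] p = \<one>"
    using group.pow_order_eq_1[OF Hg, of x] x(1) H(2) by (simp add: order_def nat_pow_consistent[symmetric])
  then show ?thesis using x subgroup.mem_carrier[OF H(1)] by blast
qed

lemma (in group) pow_coprime_eq_one:
  assumes "x \<in> carrier G" "x [^] (a::nat) = \<one>" "x [^] (b::nat) = \<one>" "coprime a b"
  shows "x = \<one>"
proof -
  have "ord x dvd a" "ord x dvd b" using pow_eq_id assms by auto
  then have "ord x = 1" using assms(4) coprime_common_divisor_nat[of a b "ord x"] by auto
  then show ?thesis using assms(1) ord_eq_1 by blast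
qed

lemma eq_prime_power:
  assumes "n > 0" "\<And>q. Factorial_Ring.prime q \<Longrightarrow> q dvd n \<Longrightarrow> q = p" "Factorial_Ring.prime p"
  shows "\<exists>r. (n::nat) = p ^ r"
proof -
  have "\<not> is_unit p" using assms(3) by auto
  then obtain y where y: "n = p ^ multiplicity p n * y" "\<not> p dvd y"
    using multiplicity_decompose'[of n p] assms(1) by auto
  have "y = 1"
  proof (rule ccontr)
    assume "y \<noteq> 1"
    then obtain q where q: "Factorial_Ring.prime q" "q dvd y" using prime_factor_nat by blast
    then have "q dvd n" using y(1) by (metis dvd_mult)
    then show False using assms(2)[OF q(1)] q(2) y(2) by blast
  qed
  then show ?thesis using y(1) by auto
qed

context group_module
begin

text \<open>For a prime q dividing the order, the elements killed by q form an invariant subgroup,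
  nontrivial by Cauchy's theorem and therefore everything. Two different primes would annihilate V
  at once.\<close>

lemma irreducible_on_prime_power:
  assumes irreducible_on: "irreducible_on (carrier G) V act (carrier V)"
  obtains p r where "Factorial_Ring.prime p" "r \<ge> 1" "card (carrier V) = p ^ r"
    "\<And>v. v \<in> carrier V \<Longrightarrow> v [^]\<^bsub>V\<^esub> p = \<one>\<^bsub>V\<^esub>"
proof -
  have all: "v [^]\<^bsub>V\<^esub> q = \<one>\<^bsub>V\<^esub>"
    if q: "Factorial_Ring.prime q" "q dvd card (carrier V)" and v: "v \<in> carrier V" for q v
  proof -
    let ?W = "{v \<in> carrier V. v [^]\<^bsub>V\<^esub> q = \<one>\<^bsub>V\<^esub>}"
    have "subgroup ?W V"
      by (rule V.subgroupI) (auto simp: V.nat_pow_distrib V.nat_pow_inv intro!: exI[of _ "\<one>\<^bsub>V\<^esub>"])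
    then have "invariant_subgroup (carrier G) V act ?W"
      unfolding invariant_subgroup_def by (auto simp flip: act_pow)
    moreover have "?W \<noteq> {\<one>\<^bsub>V\<^esub>}" using V.cauchy[OF finV q] by blast
    ultimately have "?W = carrier V" using irreducible_on unfolding irreducible_on_def by blast
    then show ?thesis using v by blast
  qed
  have pos: "card (carrier V) > 0" using finV V.one_closed card_gt_0_iff by blast
  have "card (carrier V) \<noteq> 1"
  proof
    assume "card (carrier V) = 1"
    then obtain x where "carrier V = {x}" using card_1_singletonE by blast
    then show False using irreducible_on V.one_closed unfolding irreducible_on_def by auto
  qed
  then obtain p where p: "Factorial_Ring.prime p" "p dvd card (carrier V)" using prime_factor_nat by blast
  have "q = p" if q: "Factorial_Ring.prime q" "q dvd card (carrier V)" for q
  proof (rule ccontr)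
    assume "q \<noteq> p"
    then have "coprime q p" using primes_coprime q(1) p(1) by blast
    moreover obtain x where "x \<in> carrier V" "x \<noteq> \<one>\<^bsub>V\<^esub>" using V.cauchy[OF finV q] by blast
    ultimately show False using V.pow_coprime_eq_one[of x q p] all[OF q] all[OF p] by blast
  qed
  then obtain r where r: "card (carrier V) = p ^ r" using eq_prime_power[OF pos _ p(1)] by blast
  then have "r \<ge> 1" using \<open>card (carrier V) \<noteq> 1\<close> by (cases r) auto
  then show thesis using that[OF p(1) _ r] all[OF p] by blast
qed

end

section \<open>Independent families of subgroups, counted by cardinality\<close>

lemma (in comm_group) hom_finprod:
  assumes "\<theta> \<in> hom G G" "finite I" "w \<in> I \<rightarrow> carrier G"
  shows "\<theta> (finprod G w I) = finprod G (\<lambda>i. \<theta> (w i)) I"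
proof -
  interpret h: group_hom G G \<theta> using assms(1) by (simp add: group_hom_def group_hom_axioms_def is_group)
  have cl: "\<theta> x \<in> carrier G" if "x \<in> carrier G" for x using that by simp
  show ?thesis using assms(2,3)
  proof (induction I rule: finite_induct)
    case (insert i I)
    then have "w i \<in> carrier G" "w \<in> I \<rightarrow> carrier G" by auto
    then show ?case using insert cl by (simp add: Pi_iff)
  qed simp
qed

text \<open>The situation of Dedekind's independence argument: \<open>\<theta>\<close> kills \<open>U i\<close> but nothing in \<open>U j\<close>, so it shortens any
  relation in which both take part.\<close>
definition separated :: "('v, 'n) monoid_scheme \<Rightarrow> 'i set \<Rightarrow> ('i \<Rightarrow> 'v set) \<Rightarrow> bool" where
  "separated V I U \<longleftrightarrow> finite I \<and> (\<forall>i\<in>I. subgroup (U i) V) \<and>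
     (\<forall>i\<in>I. \<forall>j\<in>I. i \<noteq> j \<longrightarrow> (\<exists>\<theta>\<in>hom V V. (\<forall>l\<in>I. \<theta> ` U l \<subseteq> U l) \<and>
        (\<forall>x\<in>U i. \<theta> x = \<one>\<^bsub>V\<^esub>) \<and> (\<forall>x\<in>U j. \<theta> x = \<one>\<^bsub>V\<^esub> \<longrightarrow> x = \<one>\<^bsub>V\<^esub>)))"

lemma (in comm_group) separated_independent:
  assumes sep: "separated G I U"
  shows "J \<subseteq> I \<Longrightarrow> w \<in> Pi J U \<Longrightarrow> finprod G w J = \<one> \<Longrightarrow> \<forall>j\<in>J. w j = \<one>"
proof (induction "card J" arbitrary: J w)
  case 0
  moreover have "finite J" using 0 sep by (auto simp: separated_def intro: finite_subset)
  ultimately have "J = {}" by simp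
  then show ?case by simp
next
  case (Suc n)
  have finJ: "finite J" using Suc.prems(1) sep finite_subset by (auto simp: separated_def)
  have Uc: "x \<in> carrier G" if "i \<in> I" "x \<in> U i" for i x
    using that sep subgroup.mem_carrier by (force simp: separated_def)
  have wc: "w \<in> J \<rightarrow> carrier G" using Suc.prems Uc by blast
  obtain i where i: "i \<in> J" using Suc.hyps(2) by fastforce
  have rest: "w j = \<one>" if j: "j \<in> J - {i}" for j
  proof -
    have ij: "i \<in> I" "j \<in> I" "i \<noteq> j" using i j Suc.prems(1) by auto
    have "\<exists>\<theta>\<in>hom G G. (\<forall>l\<in>I. \<theta> ` U l \<subseteq> U l) \<and>
        (\<forall>x\<in>U i. \<theta> x = \<one>) \<and> (\<forall>x\<in>U j. \<theta> x = \<one> \<longrightarrow> x = \<one>)"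
      by (rule mp[OF bspec[OF bspec[OF conjunct2[OF conjunct2[OF sep[unfolded separated_def]]] ij(1)] ij(2)] ij(3)])
    then obtain \<theta> where th: "\<theta> \<in> hom G G" "\<And>l. l \<in> I \<Longrightarrow> \<theta> ` U l \<subseteq> U l"
      "\<And>x. x \<in> U i \<Longrightarrow> \<theta> x = \<one>" "\<And>x. x \<in> U j \<Longrightarrow> \<theta> x = \<one> \<Longrightarrow> x = \<one>"
      by (elim bexE conjE) simp
    have thw: "\<theta> (w l) \<in> U l" if "l \<in> J" for l using that th(2)[of l] Suc.prems(1,2) by blast
    have thc: "(\<lambda>l. \<theta> (w l)) \<in> J \<rightarrow> carrier G" using thw Uc Suc.prems(1) by blast
    \<comment> \<open>\<open>\<theta>\<close> removes the term at i, so the induction hypothesis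
      covers the image of the relation, and the trivial kernel of \<open>\<theta>\<close> on U j
      recovers w j.\<close>
    have "\<one> = \<theta> (finprod G w J)"
      using Suc.prems(3) th(1) hom_one[OF th(1) is_group is_group] by simp
    also have "\<dots> = finprod G (\<lambda>l. \<theta> (w l)) J" by (rule hom_finprod[OF th(1) finJ wc])
    also have "\<dots> = finprod G (\<lambda>l. \<theta> (w l)) (insert i (J - {i}))" using i by (simp add: insert_absorb)
    also have "\<dots> = finprod G (\<lambda>l. \<theta> (w l)) (J - {i})"
    proof -
      have "\<theta> (w i) = \<one>" using th(3) i Suc.prems(2) by blast
      moreover have "finprod G (\<lambda>l. \<theta> (w l)) (J - {i}) \<in> carrier G" using thc by (intro finprod_closed) auto
      ultimately show ?thesis using finJ thc i by (subst finprod_insert) (auto simp: Pi_iff)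
    qed
    finally have "finprod G (\<lambda>l. \<theta> (w l)) (J - {i}) = \<one>" by simp
    then have "\<forall>l\<in>J - {i}. \<theta> (w l) = \<one>"
      using Suc.prems(1) thw i finJ Suc.hyps(2) by (intro Suc.hyps(1)) auto
    then show ?thesis using th(4)[of "w j"] j Suc.prems(2) by auto
  qed
  have "finprod G w (insert i (J - {i})) = w i \<otimes> finprod G w (J - {i})"
    using finJ wc i by (subst finprod_insert) auto
  also have "finprod G w (J - {i}) = \<one>" using rest by (intro finprod_one_eqI) auto
  finally have "w i = \<one>" using Suc.prems(3) wc i by (auto simp: insert_absorb Pi_iff)
  then show ?case using rest by blast
qed

text \<open>Counting replaces dimensions here, so that one statement serves both the blocks of an
  imprimitive module and the K-multiples of coset representatives inside a commutant.\<close>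

lemma (in comm_group) separated_card:
  assumes sep: "separated G I U" and fin: "finite (carrier G)"
  shows "(\<Prod>i\<in>I. card (U i)) \<le> card (carrier G)"
proof -
  have finI: "finite I" and Us: "\<And>i. i \<in> I \<Longrightarrow> subgroup (U i) G" using sep by (auto simp: separated_def)
  have Uc: "x \<in> carrier G" if "i \<in> I" "x \<in> U i" for i x
    using that Us subgroup.mem_carrier by force
  have "inj_on (\<lambda>w. finprod G w I) (Pi\<^sub>E I U)"
  proof (rule inj_onI)
    fix w w' assume w: "w \<in> Pi\<^sub>E I U" and w': "w' \<in> Pi\<^sub>E I U" and eq: "finprod G w I = finprod G w' I"
    have c: "w \<in> I \<rightarrow> carrier G" "w' \<in> I \<rightarrow> carrier G" using w w' Uc by (auto simp: PiE_iff Pi_iff)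
    let ?d = "\<lambda>i. w i \<otimes> inv w' i"
    have "finprod G ?d I \<otimes> finprod G w' I = finprod G (\<lambda>i. ?d i \<otimes> w' i) I"
      using c by (subst finprod_multf) (auto simp: Pi_iff)
    also have "\<dots> = finprod G w I" using c by (intro finprod_cong) (auto simp: Pi_iff m_assoc)
    finally have "finprod G ?d I \<otimes> finprod G w' I = \<one> \<otimes> finprod G w' I" using eq c by simp
    moreover have "finprod G ?d I \<in> carrier G" "finprod G w' I \<in> carrier G" using c by (auto simp: Pi_iff intro!: finprod_closed)
    ultimately have "finprod G ?d I = \<one>" by (simp only: r_cancel one_closed)
    moreover have "?d \<in> Pi I U"
      using w w' Us by (auto simp: PiE_iff subgroup.m_closed subgroup.m_inv_closed)
    ultimately have "\<forall>i\<in>I. ?d i = \<one>" using separated_independent[OF sep subset_refl] by blast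
    then have "w i = w' i" if "i \<in> I" for i
      using that c inv_equality[of "w i" "inv w' i"] by (auto simp: Pi_iff)
    then show "w = w'" using w w' by (metis PiE_ext)
  qed
  moreover have "(\<lambda>w. finprod G w I) ` Pi\<^sub>E I U \<subseteq> carrier G"
    using Uc by (auto simp: PiE_iff intro!: finprod_closed)
  ultimately have "card (Pi\<^sub>E I U) \<le> card (carrier G)" using fin card_inj_on_le by blast
  then show ?thesis using finI by (simp add: card_PiE)
qed

section \<open>Chief factors as modules and the index bound\<close>

abbreviation conj_on_cosets :: "('g, 'm) monoid_scheme \<Rightarrow> 'g \<Rightarrow> 'g set \<Rightarrow> 'g set" where
  "conj_on_cosets G \<equiv> \<lambda>g A. g <#\<^bsub>G\<^esub> A #>\<^bsub>G\<^esub> inv\<^bsub>G\<^esub> g"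

context group
begin

lemma conj_rcoset:
  assumes "N \<lhd> G" "g \<in> carrier G" "x \<in> carrier G"
  shows "g <# (N #> x) #> inv g = N #> (g \<otimes> x \<otimes> inv g)"
proof -
  have Nc: "n \<in> carrier G" if "n \<in> N" for n using subgroup.mem_carrier[OF normal_imp_subgroup[OF assms(1)] that] .
  show ?thesis
  proof (intro equalityI subsetI)
    fix y assume "y \<in> g <# (N #> x) #> inv g"
    then obtain n where n: "n \<in> N" "y = g \<otimes> (n \<otimes> x) \<otimes> inv g" by (auto simp: l_coset_def r_coset_def)
    then have "y = (g \<otimes> n \<otimes> inv g) \<otimes> (g \<otimes> x \<otimes> inv g)" using assms Nc by (simp add: m_assoc)
    then show "y \<in> N #> (g \<otimes> x \<otimes> inv g)"
      using normal_conj[OF assms(1,2) n(1)] by (auto simp: r_coset_def)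
  next
    fix y assume "y \<in> N #> (g \<otimes> x \<otimes> inv g)"
    then obtain n where n: "n \<in> N" "y = n \<otimes> (g \<otimes> x \<otimes> inv g)" by (auto simp: r_coset_def)
    have "inv g \<otimes> n \<otimes> g \<in> N" using normal.inv_op_closed1[OF assms(1,2) n(1)] .
    moreover have "y = g \<otimes> ((inv g \<otimes> n \<otimes> g) \<otimes> x) \<otimes> inv g" using n assms Nc by (simp add: m_assoc)
    ultimately show "y \<in> g <# (N #> x) #> inv g" unfolding l_coset_def r_coset_def by blast
  qed
qed

lemma rcoset_eq_iff:
  assumes "subgroup N G" "x \<in> carrier G" "y \<in> carrier G"
  shows "N #> x = N #> y \<longleftrightarrow> x \<otimes> inv y \<in> N"
proof
  assume "N #> x = N #> y"
  then have "x \<in> N #> y" using rcos_self[OF assms(2,1)] by simp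
  then show "x \<otimes> inv y \<in> N" using subgroup.rcos_module_imp[OF assms(1) is_group assms(3)] by blast
next
  assume "x \<otimes> inv y \<in> N"
  then have "x \<in> N #> y" using subgroup.rcos_module_rev[OF assms(1) is_group assms(3,2)] by blast
  then show "N #> x = N #> y" using repr_independence[OF _ assms(3,1)] by simp
qed

lemma card_quotient:
  assumes "subgroup L G" "subgroup N G" "N \<subseteq> L"
  shows "card (carrier ((G\<lparr>carrier := L\<rparr>) Mod N)) * card N = card L"
proof -
  interpret L: group "G\<lparr>carrier := L\<rparr>" using subgroup_imp_group[OF assms(1)] .
  have "subgroup N (G\<lparr>carrier := L\<rparr>)" using subgroup_incl assms by blast
  then show ?thesis using L.lagrange by (simp add: FactGroup_def order_def)
qed

lemma quotient_group_module:
  assumes ch: "chief_factor G N L" and sol: "solvable G" and fin: "finite (carrier G)"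
  defines "Q \<equiv> (G\<lparr>carrier := L\<rparr>) Mod N"
  shows "group_module G Q (conj_on_cosets G)" and "irreducible_on (carrier G) Q (conj_on_cosets G) (carrier Q)"
    and "card (carrier Q) * card N = card L"
proof -
  have N: "N \<lhd> G" and L: "L \<lhd> G" and NL: "N \<subset> L" using ch by (auto simp: chief_factor_def)
  have Ns: "subgroup N G" and Ls: "subgroup L G" using N L normal_imp_subgroup by auto
  have Nc: "N \<subseteq> carrier G" and Lc: "\<And>x. x \<in> L \<Longrightarrow> x \<in> carrier G"
    using subgroup.subset[OF Ns] subgroup.mem_carrier[OF Ls] by auto
  interpret N: normal N G using N .
  interpret NL: normal N "G\<lparr>carrier := L\<rparr>" using normal_restrict_supergroup[OF Ls N] NL by blast
  have cQ: "carrier Q = (\<lambda>x. N #> x) ` L" by (simp add: Q_def carrier_FactGroup)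
  have mQ: "(N #> x) \<otimes>\<^bsub>Q\<^esub> (N #> y) = N #> (x \<otimes> y)" if "x \<in> L" "y \<in> L" for x y
    using that Lc by (simp add: Q_def N.rcos_sum)
  have oQ: "\<one>\<^bsub>Q\<^esub> = N" by (simp add: Q_def)
  have act: "conj_on_cosets G g (N #> x) = N #> (g \<otimes> x \<otimes> inv g)" if "g \<in> carrier G" "x \<in> L" for g x
    using conj_rcoset[OF N] that Lc by simp
  have Lconj: "g \<otimes> x \<otimes> inv g \<in> L" if "g \<in> carrier G" "x \<in> L" for g x using normal_conj[OF L that] .
  have gQ: "group Q" unfolding Q_def by (rule NL.factorgroup_is_group)
  interpret Q: comm_group Q
  proof (rule group.group_comm_groupI[OF gQ])
    fix A B assume "A \<in> carrier Q" "B \<in> carrier Q"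
    then obtain x y where xy: "x \<in> L" "y \<in> L" "A = N #> x" "B = N #> y" using cQ by auto
    have "cmt G x y \<in> N" using chief_factor_abelian[OF ch sol] cmt_mem_derived[of x L y] xy by blast
    then have "N #> (x \<otimes> y) = N #> (y \<otimes> x)"
      using xy Lc by (simp add: rcoset_eq_iff[OF Ns] cmt_def inv_mult_group m_assoc)
    then show "A \<otimes>\<^bsub>Q\<^esub> B = B \<otimes>\<^bsub>Q\<^esub> A" using xy by (simp add: mQ)
  qed
  have finL: "finite L" using finite_subset[OF subgroup.subset[OF Ls] fin] .
  have Lm: "x \<otimes> y \<in> L" if "x \<in> L" "y \<in> L" for x y using subgroup.m_closed[OF Ls that] .
  show gm: "group_module G Q (conj_on_cosets G)"
  proof (unfold_locales, goal_cases)
    case (1 g)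
    show ?case
    proof (rule homI)
      fix A B assume "A \<in> carrier Q" "B \<in> carrier Q"
      then obtain x y where xy: "x \<in> L" "y \<in> L" "A = N #> x" "B = N #> y" using cQ by auto
      have "g \<otimes> (x \<otimes> y) \<otimes> inv g = (g \<otimes> x \<otimes> inv g) \<otimes> (g \<otimes> y \<otimes> inv g)"
        using 1 xy Lc by (simp add: m_assoc)
      then show "conj_on_cosets G g (A \<otimes>\<^bsub>Q\<^esub> B) = conj_on_cosets G g A \<otimes>\<^bsub>Q\<^esub> conj_on_cosets G g B"
        using xy 1 by (simp only: mQ act Lm Lconj)
    qed (use 1 act Lconj cQ in auto)
  next
    case (2 g h v)
    then obtain x where x: "x \<in> L" "v = N #> x" using cQ by auto
    then show ?case using 2 Lc by (simp only: act Lconj m_closed) (simp add: inv_mult_group m_assoc)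
  next
    case (3 v)
    then obtain x where x: "x \<in> L" "v = N #> x" using cQ by auto
    then show ?case using Lc by (simp only: act one_closed) simp
  next
    case 4
    show ?case by (rule fin)
  next
    case 5
    show ?case unfolding cQ using finL by blast
  qed
  show "card (carrier Q) * card N = card L"
    unfolding Q_def using card_quotient[OF Ls Ns] NL by blast
  show "irreducible_on (carrier G) Q (conj_on_cosets G) (carrier Q)"
    unfolding irreducible_on_def
  proof (intro conjI allI impI)
    obtain x where x: "x \<in> L" "x \<notin> N" using NL by blast
    have "N #> x \<noteq> N" using x Lc coset_join1[OF _ _ Ns] by blast
    moreover have "N #> x \<in> carrier Q" using x cQ by blast
    ultimately show "carrier Q \<noteq> {\<one>\<^bsub>Q\<^esub>}" using oQ by auto
    show "invariant_subgroup (carrier G) Q (conj_on_cosets G) (carrier Q)"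
      unfolding invariant_subgroup_def using Q.subgroup_self act Lconj cQ by auto
    fix W assume W: "invariant_subgroup (carrier G) Q (conj_on_cosets G) W \<and> W \<subseteq> carrier Q"
    then have Ws: "subgroup W Q" and Wi: "\<And>g A. g \<in> carrier G \<Longrightarrow> A \<in> W \<Longrightarrow> conj_on_cosets G g A \<in> W"
      by (auto simp: invariant_subgroup_def)
    \<comment> \<open>The preimage of W is normal in G and lies between N and L, so the chief factor
      property decides W.\<close>
    define K where "K = {x \<in> L. N #> x \<in> W}"
    have invL: "inv x \<in> L" if "x \<in> L" for x using subgroup.m_inv_closed[OF Ls that] .
    have iQ: "inv\<^bsub>Q\<^esub> (N #> x) = N #> inv x" if "x \<in> L" for x
      using that mQ[of "inv x" x] oQ invL cQ Lc Nc by (intro Q.inv_equality) auto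
    have "K \<lhd> G"
    proof (rule normalI_conj)
      show "subgroup K G"
      proof (rule subgroupI)
        show "K \<subseteq> carrier G" using Lc by (auto simp: K_def)
        have "\<one> \<in> K" using subgroup.one_closed[OF Ls] subgroup.one_closed[OF Ws] oQ Nc by (simp add: K_def)
        then show "K \<noteq> {}" by blast
        show "inv x \<in> K" if "x \<in> K" for x
          using that invL iQ[of x] subgroup.m_inv_closed[OF Ws, of "N #> x"] by (simp add: K_def)
        show "x \<otimes> y \<in> K" if "x \<in> K" "y \<in> K" for x y
          using that Lm mQ[of x y] subgroup.m_closed[OF Ws, of "N #> x" "N #> y"] by (simp add: K_def)
      qed
      show "g \<otimes> x \<otimes> inv g \<in> K" if "g \<in> carrier G" "x \<in> K" for g x
        using that Wi[of g "N #> x"] act[of g x] Lconj by (simp add: K_def)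
    qed
    moreover have "N \<subseteq> K"
    proof
      fix x assume x: "x \<in> N"
      then have "N #> x = N" using coset_join2[OF _ Ns x] Nc by blast
      then show "x \<in> K" using x NL subgroup.one_closed[OF Ws] oQ by (auto simp: K_def)
    qed
    moreover have "K \<subseteq> L" by (auto simp: K_def)
    ultimately have "K = N \<or> K = L" using ch by (simp add: chief_factor_def)
    moreover have WK: "W = (\<lambda>x. N #> x) ` K" using W cQ by (auto simp: K_def)
    moreover have "(\<lambda>x. N #> x) ` N = {N}"
    proof -
      have "N #> x = N" if "x \<in> N" for x using coset_join2[OF _ Ns that] that Nc by blast
      then have "(\<lambda>x. N #> x) ` N = (\<lambda>x. N) ` N" by (rule image_cong[OF refl])
      then show ?thesis using subgroup.one_closed[OF Ns] by (simp only: image_constant)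
    qed
    ultimately show "W = {\<one>\<^bsub>Q\<^esub>} \<or> W = carrier Q" using oQ cQ by auto
  qed
qed

lemma conj_on_cosets_trivial_imp:
  assumes "N \<lhd> G" "g \<in> carrier G" "x \<in> carrier G" "conj_on_cosets G g (N #> x) = N #> x"
  shows "cmt G g x \<in> N"
  using assms conj_rcoset[OF assms(1-3)] rcoset_eq_iff[OF normal_imp_subgroup[OF assms(1)], of "g \<otimes> x \<otimes> inv g" x]
  by (simp add: cmt_def)

text \<open>The statement on p-th powers accompanies the order because it later turns commutators
  into p-th roots of unity.\<close>

lemma chief_factor_prime_power:
  assumes ch: "chief_factor G N L" and sol: "solvable G" and fin: "finite (carrier G)"
  obtains p r where "Factorial_Ring.prime p" "r \<ge> 1" "card L = p ^ r * card N"
    "\<And>x. x \<in> L \<Longrightarrow> x [^] p \<in> N"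
proof -
  let ?Q = "(G\<lparr>carrier := L\<rparr>) Mod N"
  interpret Q: group_module G ?Q "conj_on_cosets G" by (rule quotient_group_module[OF assms])
  have N: "N \<lhd> G" and L: "L \<lhd> G" and NL: "N \<subseteq> L" using ch by (auto simp: chief_factor_def)
  have Ns: "subgroup N G" and Ls: "subgroup L G" using N L normal_imp_subgroup by auto
  interpret NL: normal N "G\<lparr>carrier := L\<rparr>" using normal_restrict_supergroup[OF Ls N NL] .
  obtain p r where pr: "Factorial_Ring.prime p" "r \<ge> 1" "card (carrier ?Q) = p ^ r"
    "\<And>v. v \<in> carrier ?Q \<Longrightarrow> v [^]\<^bsub>?Q\<^esub> p = \<one>\<^bsub>?Q\<^esub>"
    using Q.irreducible_on_prime_power[OF quotient_group_module(2)[OF assms]] by metis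
  have "x [^] p \<in> N" if x: "x \<in> L" for x
  proof -
    have "(N #> x) [^]\<^bsub>?Q\<^esub> p = N #> (x [^] p)"
      using NL.FactGroup_pow[of x p] x by (simp flip: nat_pow_consistent)
    moreover have "N #> x \<in> carrier ?Q" using x by (auto simp: carrier_FactGroup)
    ultimately have "N #> (x [^] p) = N" using pr(4) by simp
    then show ?thesis using coset_join1[OF _ _ Ns] x subgroup.mem_carrier[OF Ls] nat_pow_closed by blast
  qed
  then show thesis using that pr(1-3) quotient_group_module(3)[OF assms] by metis
qed

end

text \<open>The elements of \<open>V\<close> have type \<open>'g set\<close> because chief factors of \<open>G\<close> consist of cosets; with this choice the
  induction on \<open>N\<close> stays within one type.\<close>
definition linear_bound_upto :: "('g, 'm) monoid_scheme itself \<Rightarrow> nat \<Rightarrow> bool" where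
  "linear_bound_upto T N \<longleftrightarrow> (\<forall>(G :: ('g, 'm) monoid_scheme) (V :: 'g set monoid) act p r.
     group_module G V act \<longrightarrow> solvable G \<longrightarrow> irreducible_on (carrier G) V act (carrier V) \<longrightarrow>
     Factorial_Ring.prime p \<longrightarrow> card (carrier V) = p ^ r \<longrightarrow> p ^ r \<le> N \<longrightarrow>
     (\<exists>j. length_bound p r j \<and> (\<forall>g\<in>(derived G ^^ j) (carrier G). \<forall>v\<in>carrier V. act g v = v)))"

section \<open>Derived length modulo a subgroup of bounded index\<close>

context group
begin

lemma chief_factor_bound:
  assumes IH: "linear_bound_upto TYPE(('a, 'b) monoid_scheme) M" and fin: "finite (carrier G)" and sol: "solvable G"
    and ch: "chief_factor G N L" and p: "Factorial_Ring.prime p" "card L = p ^ r * card N" "p ^ r \<le> M"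
  shows "\<exists>j. length_bound p r j \<and> (derived G ^^ j) (carrier G) \<subseteq> cent_mod N L"
proof -
  let ?Q = "(G\<lparr>carrier := L\<rparr>) Mod N"
  note Q = quotient_group_module[OF ch sol fin]
  have N: "N \<lhd> G" and L: "L \<lhd> G" using ch by (auto simp: chief_factor_def)
  have Ns: "subgroup N G" using normal_imp_subgroup[OF N] .
  have "card N > 0" using finite_subset[OF subgroup.subset[OF Ns] fin] subgroup.one_closed[OF Ns] card_gt_0_iff by blast
  then have "card (carrier ?Q) = p ^ r" using Q(3) p(2) by simp
  then obtain j where j: "length_bound p r j" "\<And>g v. g \<in> (derived G ^^ j) (carrier G) \<Longrightarrow> v \<in> carrier ?Q \<Longrightarrow> conj_on_cosets G g v = v"
    using IH[unfolded linear_bound_upto_def, rule_format, OF Q(1) sol Q(2) p(1) _ p(3)] by blast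
  have "(derived G ^^ j) (carrier G) \<subseteq> cent_mod N L"
  proof
    fix g assume g: "g \<in> (derived G ^^ j) (carrier G)"
    then have gc: "g \<in> carrier G" using exp_of_derived_subset[OF subgroup_self] by blast
    have "cmt G g x \<in> N" if x: "x \<in> L" for x
    proof (rule conj_on_cosets_trivial_imp[OF N gc])
      show "x \<in> carrier G" using x normal_mem_carrier[OF L] by blast
      show "conj_on_cosets G g (N #> x) = N #> x" using j(2)[OF g, of "N #> x"] x by (auto simp: carrier_FactGroup)
    qed
    then show "g \<in> cent_mod N L" using gc by (simp add: cent_mod_def)
  qed
  then show ?thesis using j(1) by blast
qed

lemma normal_product_absorb:
  assumes N: "N \<lhd> G" and M: "subgroup M G" and K: "subgroup K G" "N <#> M = carrier G"
    and cM: "\<And>g x. g \<in> M \<Longrightarrow> x \<in> K \<Longrightarrow> g \<otimes> x \<otimes> inv g \<in> K"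
    and cN: "\<And>g x. g \<in> N \<Longrightarrow> x \<in> K \<Longrightarrow> g \<otimes> x \<otimes> inv g \<in> K"
  shows "K \<lhd> G"
proof (rule normalI_conj[OF K(1)])
  fix g x assume g: "g \<in> carrier G" and x: "x \<in> K"
  then have "g \<in> N <#> M" using K(2) by simp
  then obtain n m where nm: "n \<in> N" "m \<in> M" "g = n \<otimes> m" unfolding set_mult_def by blast
  have c: "n \<in> carrier G" "m \<in> carrier G" "x \<in> carrier G"
    using nm x subgroup.mem_carrier[OF M] normal_mem_carrier[OF N] subgroup.mem_carrier[OF K(1)] by auto
  have "g \<otimes> x \<otimes> inv g = n \<otimes> (m \<otimes> x \<otimes> inv m) \<otimes> inv n" using c nm by (simp add: m_assoc inv_mult_group)
  then show "g \<otimes> x \<otimes> inv g \<in> K" using cN[OF nm(1) cM[OF nm(2) x]] by simp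
qed

end

text \<open>N0 is the core of M, so G/N0 acts primitively on the cosets of M. A chief factor L/N0 is
  complemented by M/N0 and self-centralizing, which gives k = |L/N0| = p ^ r. After j steps the
  derived series lies in the centralizer L of L/N0, after one more in N0; the unit held in reserve
  by \<open>length_bound\<close> pays for that step.\<close>

lemma maximal_subgroup_bound:
  fixes G :: "('g, 'm) monoid_scheme" (structure)
  assumes IH: "linear_bound_upto TYPE(('g, 'm) monoid_scheme) N"
    and G: "group G" and fin: "finite (carrier G)" and sol: "solvable G"
    and M: "subgroup M G" and k: "card (carrier G) = k * card M" "k \<le> N"
    and mx: "M \<noteq> carrier G" "\<And>H. subgroup H G \<Longrightarrow> M \<subseteq> H \<Longrightarrow> H = M \<or> H = carrier G"
  shows "\<exists>i. 2 ^ i \<le> k\<^sup>2 \<and> (derived G ^^ i) (carrier G) \<subseteq> M"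
proof -
  interpret group G by (rule G)
  have finM: "finite M" using finite_subset[OF subgroup.subset[OF M] fin] .
  let ?P = "\<lambda>K. K \<lhd> G \<and> K \<subseteq> M"
  have "?P {\<one>}" using one_is_normal subgroup.one_closed[OF M] by simp
  moreover have "\<And>K. ?P K \<Longrightarrow> K \<subseteq> M" by simp
  ultimately obtain N0 where N0_N0m: "?P N0 \<and> (\<forall>K. ?P K \<longrightarrow> N0 \<subseteq> K \<longrightarrow> K = N0)"
    by (rule maximal_subset[of M ?P, OF finM, THEN exE])
  note N0 = N0_N0m[THEN conjunct1] and N0m = N0_N0m[THEN conjunct2, rule_format]
  have N0max: "K = N0" if "K \<lhd> G" "K \<subseteq> M" "N0 \<subseteq> K" for K using that N0m by simp
  have N0s: "subgroup N0 G" using N0 normal_imp_subgroup by blast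
  have "N0 \<subset> carrier G" using N0 mx(1) subgroup.subset[OF M] by blast
  then obtain L where ch: "chief_factor G N0 L" using chief_factor_exists[OF _ normal_self _ fin] N0 by blast
  have L: "L \<lhd> G" and NL: "N0 \<subset> L" using ch by (auto simp: chief_factor_def)
  have Ls: "subgroup L G" using normal_imp_subgroup[OF L] .
  have "\<not> L \<subseteq> M" using N0max[OF L] NL by blast
  moreover have LM: "subgroup (L <#> M) G" "L \<subseteq> L <#> M" "M \<subseteq> L <#> M" using subgroup_set_mult[OF L M] by auto
  ultimately have LMG: "L <#> M = carrier G" using mx(2)[OF LM(1,3)] by blast
  have ab: "cmt G x y \<in> N0" if "x \<in> L" "y \<in> L" for x y
    using chief_factor_abelian[OF ch sol] cmt_mem_derived[OF that] by blast
  have N0': "N0 \<lhd> G" "N0 \<subseteq> M" using N0 by auto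
  have Mc: "x \<in> carrier G" if "x \<in> M" for x using subgroup.mem_carrier[OF M that] .
  have Lc: "x \<in> carrier G" if "x \<in> L" for x using subgroup.mem_carrier[OF Ls that] .
  \<comment> \<open>K \<inter> M is normalized by M because K is normal, and by L because its
    commutators with L lie in N0; as G = L M it is normal in G and cannot exceed the core. This is
    applied to L and to the centralizer of L/N0.\<close>
  have absorb: "K \<inter> M = N0" if K: "K \<lhd> G" "N0 \<subseteq> K" "\<And>l x. l \<in> L \<Longrightarrow> x \<in> K \<inter> M \<Longrightarrow> cmt G l x \<in> N0" for K
  proof (rule N0max)
    have Ks: "subgroup K G" using normal_imp_subgroup[OF K(1)] .
    have KM: "subgroup (K \<inter> M) G" using subgroups_Inter_pair[OF Ks M] .
    show "K \<inter> M \<lhd> G"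
    proof (rule normal_product_absorb[OF L M KM LMG])
      show "g \<otimes> x \<otimes> inv g \<in> K \<inter> M" if "g \<in> M" "x \<in> K \<inter> M" for g x
        using that normal_conj[OF K(1) Mc] M by (simp add: subgroup.m_closed subgroup.m_inv_closed)
      show "g \<otimes> x \<otimes> inv g \<in> K \<inter> M" if gx: "g \<in> L" "x \<in> K \<inter> M" for g x
      proof -
        have "cmt G g x \<in> K \<inter> M" using K(2,3) N0'(2) gx by blast
        then have "cmt G g x \<otimes> x \<in> K \<inter> M" using subgroup.m_closed[OF KM] gx by blast
        then show ?thesis using conj_eq_cmt_mult[of g x] Lc Mc gx by simp
      qed
    qed
  qed (use K N0' in auto)
  have LMN: "L \<inter> M = N0" using absorb[OF L] NL ab by blast
  let ?C = "cent_mod N0 L"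
  have C: "?C \<lhd> G" using normal_cent_mod[OF N0'(1) L] .
  have Cs: "subgroup ?C G" using normal_imp_subgroup[OF C] .
  have N0C: "N0 \<subseteq> ?C" using normal_subset_cent_mod[OF N0'(1) subgroup.subset[OF Ls]] .
  have LC: "L \<subseteq> ?C" using ab Lc by (auto simp: cent_mod_def)
  have "L \<subseteq> cent_mod N0 ?C"
    using cent_mod_sym[OF N0'(1) subgroup.subset[OF Cs] subgroup.subset[OF Ls]] by blast
  then have CM: "?C \<inter> M = N0" using absorb[OF C N0C] by (auto simp: cent_mod_def)
  \<comment> \<open>Dedekind's modular law: in c = l m the factor m lies in C \<inter> M =
    N0.\<close>
  have CL: "?C \<subseteq> L"
  proof
    fix c assume c: "c \<in> ?C"
    then have "c \<in> L <#> M" using LMG subgroup.mem_carrier[OF Cs] by simp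
    then obtain l m where lm: "l \<in> L" "m \<in> M" "c = l \<otimes> m" unfolding set_mult_def by blast
    then have "m = inv l \<otimes> c" using Lc Mc by simp
    moreover have "l \<in> ?C" using LC lm by blast
    ultimately have "m \<in> ?C" using c subgroup.m_closed[OF Cs subgroup.m_inv_closed[OF Cs]] by simp
    then have "m \<in> N0" using CM lm by blast
    then show "c \<in> L" using NL lm Ls by (simp add: subgroup.m_closed subset_iff psubset_eq)
  qed
  obtain p r where pr: "Factorial_Ring.prime p" "r \<ge> 1" "card L = p ^ r * card N0"
    using chief_factor_prime_power[OF ch sol fin] by metis
  \<comment> \<open>The second isomorphism theorem gives |M/N0| = |G/L|, whence the index of M
    equals |L/N0|.\<close>
  have "card (carrier ((G\<lparr>carrier := M\<rparr>) Mod (L \<inter> M))) = card (carrier ((G\<lparr>carrier := L <#> M\<rparr>) Mod L))"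
    using second_isomorphism_grp.normal_intersection_quotient_isom[of L G M] L M
    by (intro iso_same_card) (auto simp: second_isomorphism_grp_def second_isomorphism_grp_axioms_def is_iso_def)
  moreover have "card (carrier ((G\<lparr>carrier := M\<rparr>) Mod (L \<inter> M))) * card N0 = card M"
    unfolding LMN using card_quotient[OF M N0s N0'(2)] .
  moreover have "card (carrier ((G\<lparr>carrier := L <#> M\<rparr>) Mod L)) * card L = card (carrier G)"
    unfolding LMG using card_quotient[OF subgroup_self Ls subgroup.subset[OF Ls]] .
  ultimately obtain t where t: "t * card N0 = card M" "t * card L = k * card M" using k(1) by metis
  have "card M > 0" "card N0 > 0"
    using finite_subset[OF N0'(2) finM] finM subgroup.one_closed[OF M] subgroup.one_closed[OF N0s] card_gt_0_iff by blast+
  then have "t > 0" using t(1) by (cases t) auto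
  have "t * (p ^ r * card N0) = t * (k * card N0)" using t pr(3) by (metis mult.left_commute)
  then have kp: "k = p ^ r" using \<open>t > 0\<close> \<open>card N0 > 0\<close> by simp
  obtain j where j: "length_bound p r j" "(derived G ^^ j) (carrier G) \<subseteq> ?C"
    using chief_factor_bound[OF IH fin sol ch pr(1,3)] k(2) kp by blast
  have "derived G ((derived G ^^ j) (carrier G)) \<subseteq> derived G L" using mono_derived j(2) CL by blast
  then have "(derived G ^^ Suc j) (carrier G) \<subseteq> M" using chief_factor_abelian[OF ch sol] N0'(2) by auto
  moreover have "2 ^ Suc j \<le> (2::nat) ^ (j + (if p = 2 then 2 else 1))" by (intro power_increasing) auto
  then have "2 ^ Suc j \<le> k\<^sup>2"
    using j(1) unfolding length_bound_def kp by (simp add: power_mult power_mult_distrib mult.commute flip: power_mult)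
  ultimately show ?thesis by blast
qed

text \<open>Along M < L < G indices multiply and lengths add, matching the form
  \<open>2 ^ i \<le> k\<^sup>2\<close>, so only maximal subgroups remain. The induction ranges over
  all groups because the lower half of the chain is an instance for L.\<close>

theorem subgroup_index_bound:
  fixes G :: "('g, 'm) monoid_scheme"
  assumes IH: "linear_bound_upto TYPE(('g, 'm) monoid_scheme) N"
    and "group G" "finite (carrier G)" "solvable G" "subgroup M G" "card (carrier G) = k * card M" "k \<le> N"
  shows "\<exists>i. 2 ^ i \<le> k\<^sup>2 \<and> (derived G ^^ i) (carrier G) \<subseteq> M"
  using assms(2-)
proof (induction k arbitrary: G M rule: less_induct)
  case (less k)
  interpret group G by (rule less.prems)
  note M = less.prems(4) and fin = less.prems(2)
  have pos: "card H > 0" if "subgroup H G" for H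
    using finite_subset[OF subgroup.subset[OF that] fin] subgroup.one_closed[OF that] card_gt_0_iff by blast
  have k0: "k > 0" using less.prems(5) pos[OF subgroup_self] by (cases k) auto
  consider "M = carrier G" | "M \<noteq> carrier G" "\<forall>H. subgroup H G \<and> M \<subseteq> H \<longrightarrow> H = M \<or> H = carrier G"
    | L where "subgroup L G" "M \<subset> L" "L \<subset> carrier G"
    using subgroup.subset by blast
  then show ?case
  proof cases
    case 1
    then show ?thesis using k0 by (intro exI[of _ 0]) auto
  next
    case 2
    then show ?thesis using maximal_subgroup_bound[OF IH less.prems(1-6)] by blast
  next
    case (3 L)
    note L = 3(1)
    let ?L = "G\<lparr>carrier := L\<rparr>"
    interpret L: group ?L using subgroup_imp_group[OF L] .
    have MinL: "subgroup M ?L" using subgroup_incl[OF M L] 3(2) by blast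
    have finL: "finite L" using finite_subset[OF subgroup.subset[OF L] fin] .
    obtain a where a: "card (carrier G) = a * card L" using lagrange[OF L] by (metis order_def)
    obtain b where b: "card L = b * card M" using L.lagrange[OF MinL] by (auto simp: order_def dest: sym)
    have k: "k = a * b" using less.prems(5) a b pos[OF M] by simp
    have "card M < card L" "card L < card (carrier G)" using psubset_card_mono finL fin 3 by auto
    then have "a > 1" "b > 1" using a b pos[OF M] pos[OF L] by (auto intro: Suc_lessI gr0I)
    then have ab: "a < k" "b < k" using k by auto
    obtain i where i: "2 ^ i \<le> a\<^sup>2" "(derived G ^^ i) (carrier G) \<subseteq> L"
      using less.IH[OF ab(1) less.prems(1-3) L a] ab less.prems(6) by auto
    obtain j where j: "2 ^ j \<le> b\<^sup>2" "(derived ?L ^^ j) L \<subseteq> M"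
      using less.IH[OF ab(2) L.is_group _ solvable_restrict[OF L less.prems(3)] MinL] finL b ab less.prems(6) by auto
    have "(derived G ^^ (i + j)) (carrier G) \<subseteq> (derived G ^^ j) L"
      unfolding exp_of_derived_add using mono_exp_of_derived[OF i(2)] .
    also have "\<dots> \<subseteq> M" using j(2) exp_of_derived_consistent[OF L] by simp
    finally have "(derived G ^^ (i + j)) (carrier G) \<subseteq> M" .
    moreover have "2 ^ (i + j) \<le> k\<^sup>2"
      unfolding k power_add power_mult_distrib using i(1) j(1) by (rule mult_mono) auto
    ultimately show ?thesis by blast
  qed
qed

section \<open>The endomorphism ring of a module\<close>

text \<open>Extensional functions, so that endomorphisms agreeing on the carrier are equal and the
  ring over a finite group is finite.\<close>

definition End :: "('v, 'n) monoid_scheme \<Rightarrow> ('v \<Rightarrow> 'v) ring" where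
  "End V = \<lparr>carrier = hom V V \<inter> extensional (carrier V), monoid.mult = compose (carrier V),
     one = (\<lambda>v\<in>carrier V. v), ring.zero = (\<lambda>v\<in>carrier V. \<one>\<^bsub>V\<^esub>),
     ring.add = (\<lambda>f g. \<lambda>v\<in>carrier V. f v \<otimes>\<^bsub>V\<^esub> g v)\<rparr>"

context comm_group
begin

lemma End_closed: "f \<in> carrier (End G) \<Longrightarrow> v \<in> carrier G \<Longrightarrow> f v \<in> carrier G"
  by (auto simp: End_def hom_def)

lemma End_hom: "f \<in> carrier (End G) \<Longrightarrow> f \<in> hom G G"
  by (simp add: End_def)

lemma End_apply:
  assumes "v \<in> carrier G"
  shows "(f \<otimes>\<^bsub>End G\<^esub> g) v = f (g v)" "(f \<oplus>\<^bsub>End G\<^esub> g) v = f v \<otimes> g v"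
    "\<one>\<^bsub>End G\<^esub> v = v" "\<zero>\<^bsub>End G\<^esub> v = \<one>"
  using assms by (simp_all add: End_def compose_eq)

lemma End_eqI:
  assumes "f \<in> carrier (End G)" "g \<in> carrier (End G)" "\<And>v. v \<in> carrier G \<Longrightarrow> f v = g v"
  shows "f = g"
  using assms by (auto simp: End_def intro: extensionalityI)

lemma End_add_apply: "f \<in> carrier (End G) \<Longrightarrow> v \<in> carrier G \<Longrightarrow> w \<in> carrier G \<Longrightarrow> f (v \<otimes> w) = f v \<otimes> f w"
  by (simp add: End_def hom_def)

lemma End_one_apply [simp]: "f \<in> carrier (End G) \<Longrightarrow> f \<one> = \<one>"
  using hom_one[OF End_hom] is_group by blast

lemma End_inv_apply: "f \<in> carrier (End G) \<Longrightarrow> v \<in> carrier G \<Longrightarrow> f (inv v) = inv f v"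
  using group_hom.hom_inv[of G G f] End_hom by (simp add: group_hom_def group_hom_axioms_def is_group)

lemma End_mem:
  "f \<in> hom G G \<Longrightarrow> restrict f (carrier G) \<in> carrier (End G)"
  by (auto simp: End_def hom_def)

lemma End_ring: "ring (End G)"
proof (rule ringI)
  have cl: "f \<in> carrier (End G) \<Longrightarrow> g \<in> carrier (End G) \<Longrightarrow> f \<oplus>\<^bsub>End G\<^esub> g \<in> carrier (End G)" for f g
    by (auto simp: End_def hom_def m_ac Pi_iff)
  have clm: "f \<in> carrier (End G) \<Longrightarrow> g \<in> carrier (End G) \<Longrightarrow> f \<otimes>\<^bsub>End G\<^esub> g \<in> carrier (End G)" for f g
    by (auto simp: End_def hom_def compose_eq Pi_iff compose_def)
  have cl0: "\<zero>\<^bsub>End G\<^esub> \<in> carrier (End G)" and cl1: "\<one>\<^bsub>End G\<^esub> \<in> carrier (End G)"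
    by (auto simp: End_def hom_def)
  show "abelian_group (End G)"
  proof (rule abelian_groupI)
    fix f assume f: "f \<in> carrier (End G)"
    have i: "(\<lambda>v\<in>carrier G. inv f v) \<in> carrier (End G)"
      using f by (auto simp: End_def hom_def Pi_iff inv_mult)
    moreover have "(\<lambda>v\<in>carrier G. inv f v) \<oplus>\<^bsub>End G\<^esub> f = \<zero>\<^bsub>End G\<^esub>"
      by (rule End_eqI) (use i f cl cl0 in \<open>auto simp: End_apply End_closed\<close>)
    ultimately show "\<exists>y\<in>carrier (End G). y \<oplus>\<^bsub>End G\<^esub> f = \<zero>\<^bsub>End G\<^esub>" by blast
  qed (auto intro!: End_eqI simp: cl cl0 End_apply End_closed m_ac)
  show "monoid (End G)"
    by (rule monoidI) (auto intro!: End_eqI simp: clm cl1 End_apply End_closed)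
  show "(x \<oplus>\<^bsub>End G\<^esub> y) \<otimes>\<^bsub>End G\<^esub> z = x \<otimes>\<^bsub>End G\<^esub> z \<oplus>\<^bsub>End G\<^esub> y \<otimes>\<^bsub>End G\<^esub> z"
    if "x \<in> carrier (End G)" "y \<in> carrier (End G)" "z \<in> carrier (End G)" for x y z
    using that by (auto intro!: End_eqI simp: cl clm End_apply End_closed)
  show "z \<otimes>\<^bsub>End G\<^esub> (x \<oplus>\<^bsub>End G\<^esub> y) = z \<otimes>\<^bsub>End G\<^esub> x \<oplus>\<^bsub>End G\<^esub> z \<otimes>\<^bsub>End G\<^esub> y"
    if "x \<in> carrier (End G)" "y \<in> carrier (End G)" "z \<in> carrier (End G)" for x y z
    using that by (auto intro!: End_eqI simp: cl clm End_apply End_closed End_add_apply)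
qed

lemma End_finite: "finite (carrier G) \<Longrightarrow> finite (carrier (End G))"
  by (rule finite_subset[of _ "carrier G \<rightarrow>\<^sub>E carrier G"])
    (auto simp: End_def hom_def extensional_def intro!: finite_PiE PiE_I)

end

lemma (in comm_group) End_neg_apply:
  assumes "f \<in> carrier (End G)" "v \<in> carrier G"
  shows "(\<ominus>\<^bsub>End G\<^esub> f) v = inv f v"
proof -
  interpret R: ring "End G" by (rule End_ring)
  have "(\<ominus>\<^bsub>End G\<^esub> f \<oplus>\<^bsub>End G\<^esub> f) v = \<one>" using assms by (simp add: R.l_neg End_apply)
  then have "(\<ominus>\<^bsub>End G\<^esub> f) v \<otimes> f v = \<one>" using assms by (simp add: End_apply)
  then show ?thesis using assms End_closed R.a_inv_closed by (metis inv_equality)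
qed

section \<open>Generated subrings: commutation and conjugation\<close>

context ring
begin

lemma generate_ring_commutes:
  assumes H: "H \<subseteq> carrier R" and f: "f \<in> carrier R" and c: "\<And>h. h \<in> H \<Longrightarrow> f \<otimes> h = h \<otimes> f"
    and k: "k \<in> generate_ring R H"
  shows "f \<otimes> k = k \<otimes> f"
  using k
proof (induction rule: generate_ring.induct)
  case (a_inv h)
  then show ?case using f generate_ring_in_carrier[OF H] by (simp add: r_minus l_minus)
next
  case (eng_add h1 h2)
  then show ?case using f generate_ring_in_carrier[OF H] by (simp add: r_distr l_distr)
next
  case (eng_mult h1 h2)
  note cl = generate_ring_in_carrier[OF H eng_mult(1)] generate_ring_in_carrier[OF H eng_mult(2)]
  have "f \<otimes> (h1 \<otimes> h2) = (f \<otimes> h1) \<otimes> h2" using f cl by (simp add: m_assoc)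
  also have "\<dots> = h1 \<otimes> (f \<otimes> h2)" using f cl eng_mult by (simp add: m_assoc)
  finally show ?case using f cl eng_mult by (simp add: m_assoc)
qed (use f c in auto)

lemma generate_ring_commutative:
  assumes H: "H \<subseteq> carrier R" and c: "\<And>h h'. h \<in> H \<Longrightarrow> h' \<in> H \<Longrightarrow> h \<otimes> h' = h' \<otimes> h"
    and k: "k \<in> generate_ring R H" "k' \<in> generate_ring R H"
  shows "k \<otimes> k' = k' \<otimes> k"
proof (rule generate_ring_commutes[OF H _ _ k(2)])
  show "k \<in> carrier R" using k generate_ring_in_carrier[OF H] by blast
  show "k \<otimes> h = h \<otimes> k" if h: "h \<in> H" for h
    using generate_ring_commutes[OF H _ c[OF h] k(1)] h H by auto
qed

lemma generate_ring_conj: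
  assumes H: "H \<subseteq> carrier R" and u: "u \<in> carrier R" "w \<in> carrier R" "w \<otimes> u = \<one>" "u \<otimes> w = \<one>"
    and c: "\<And>h. h \<in> H \<Longrightarrow> u \<otimes> h \<otimes> w \<in> H" and k: "k \<in> generate_ring R H"
  shows "u \<otimes> k \<otimes> w \<in> generate_ring R H"
  using k
proof (induction rule: generate_ring.induct)
  case one
  then show ?case using u by (simp add: generate_ring.one)
next
  case (incl h)
  then show ?case by (intro generate_ring.incl c)
next
  case (a_inv h)
  have "\<ominus> (u \<otimes> h \<otimes> w) = u \<otimes> (\<ominus> h) \<otimes> w"
    using u generate_ring_in_carrier[OF H a_inv(1)] by (simp add: r_minus l_minus)
  then show ?case using generate_ring.a_inv[OF a_inv.IH] by simp
next
  case (eng_add h1 h2)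
  have "u \<otimes> h1 \<otimes> w \<oplus> u \<otimes> h2 \<otimes> w = u \<otimes> (h1 \<oplus> h2) \<otimes> w"
    using u generate_ring_in_carrier[OF H] eng_add(1,2) by (simp add: r_distr l_distr)
  then show ?case using generate_ring.eng_add[OF eng_add.IH] by simp
next
  case (eng_mult h1 h2)
  note cl = generate_ring_in_carrier[OF H eng_mult(1)] generate_ring_in_carrier[OF H eng_mult(2)]
  have "u \<otimes> (h1 \<otimes> h2) \<otimes> w = u \<otimes> h1 \<otimes> (w \<otimes> u) \<otimes> h2 \<otimes> w" using u cl by (simp add: m_assoc)
  also have "\<dots> = (u \<otimes> h1 \<otimes> w) \<otimes> (u \<otimes> h2 \<otimes> w)" using u(1,2) cl by (simp add: m_assoc)
  finally show ?case using generate_ring.eng_mult[OF eng_mult.IH] by simp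
qed

end

section \<open>The representation and its enveloping rings\<close>

context group_module
begin

abbreviation \<rho> :: "'g \<Rightarrow> 'v \<Rightarrow> 'v" where
  "\<rho> g \<equiv> restrict (act g) (carrier V)"

sublocale R: ring "End V"
  by (rule V.End_ring)

abbreviation rmult (infixl "\<bullet>" 70) where "f \<bullet> g \<equiv> f \<otimes>\<^bsub>End V\<^esub> g"

lemma rho_closed [simp]: "g \<in> carrier G \<Longrightarrow> \<rho> g \<in> carrier (End V)"
  using V.End_mem[OF act_hom] .

lemma rho_mult: "g \<in> carrier G \<Longrightarrow> h \<in> carrier G \<Longrightarrow> \<rho> (g \<otimes> h) = \<rho> g \<bullet> \<rho> h"
  by (rule V.End_eqI) (simp_all add: V.End_apply act_mult)

lemma rho_one: "\<rho> \<one> = \<one>\<^bsub>End V\<^esub>"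
  by (rule V.End_eqI) (simp_all add: V.End_apply act_one)

lemma rho_inv: "g \<in> carrier G \<Longrightarrow> \<rho> (inv g) \<bullet> \<rho> g = \<one>\<^bsub>End V\<^esub>"
  "g \<in> carrier G \<Longrightarrow> \<rho> g \<bullet> \<rho> (inv g) = \<one>\<^bsub>End V\<^esub>"
  using rho_mult[of "inv g" g] rho_mult[of g "inv g"] rho_one by auto

text \<open>Conjugation in the endomorphism ring. When the enveloping ring of a normal subgroup is a
  field, G acts on it through these maps by field automorphisms.\<close>

definition \<sigma> :: "'g \<Rightarrow> ('v \<Rightarrow> 'v) \<Rightarrow> 'v \<Rightarrow> 'v" where
  "\<sigma> g f = \<rho> g \<bullet> f \<bullet> \<rho> (inv g)"

lemma sigma_closed [simp]: "g \<in> carrier G \<Longrightarrow> f \<in> carrier (End V) \<Longrightarrow> \<sigma> g f \<in> carrier (End V)"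
  by (simp add: \<sigma>_def del: restrict_apply)

lemma sigma_apply: "g \<in> carrier G \<Longrightarrow> f \<in> carrier (End V) \<Longrightarrow> v \<in> carrier V \<Longrightarrow> \<sigma> g f v = act g (f (act (inv g) v))"
  by (simp add: \<sigma>_def V.End_apply V.End_closed)

lemma sigma_zero: "g \<in> carrier G \<Longrightarrow> \<sigma> g \<zero>\<^bsub>End V\<^esub> = \<zero>\<^bsub>End V\<^esub>"
  by (simp add: \<sigma>_def)

lemma sigma_one: "g \<in> carrier G \<Longrightarrow> \<sigma> g \<one>\<^bsub>End V\<^esub> = \<one>\<^bsub>End V\<^esub>"
  using rho_inv by (simp add: \<sigma>_def)

lemma sigma_id: "f \<in> carrier (End V) \<Longrightarrow> \<sigma> \<one> f = f"
  using rho_one by (simp add: \<sigma>_def)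

lemma sigma_mult:
  assumes "g \<in> carrier G" "k \<in> carrier (End V)" "l \<in> carrier (End V)"
  shows "\<sigma> g (k \<bullet> l) = \<sigma> g k \<bullet> \<sigma> g l"
proof -
  have "\<sigma> g k \<bullet> \<sigma> g l = \<rho> g \<bullet> k \<bullet> (\<rho> (inv g) \<bullet> \<rho> g) \<bullet> l \<bullet> \<rho> (inv g)"
    using assms by (simp only: \<sigma>_def R.m_assoc R.m_closed rho_closed inv_closed)
  then show ?thesis using assms rho_inv by (simp add: \<sigma>_def R.m_assoc)
qed

lemma sigma_pow:
  fixes n :: nat
  assumes "g \<in> carrier G" "k \<in> carrier (End V)"
  shows "\<sigma> g (k [^]\<^bsub>End V\<^esub> n) = (\<sigma> g k) [^]\<^bsub>End V\<^esub> n"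
  by (induction n) (use assms sigma_one sigma_mult in auto)

lemma sigma_comp:
  "g \<in> carrier G \<Longrightarrow> h \<in> carrier G \<Longrightarrow> k \<in> carrier (End V) \<Longrightarrow> \<sigma> (g \<otimes> h) k = \<sigma> g (\<sigma> h k)"
  by (simp add: \<sigma>_def inv_mult_group R.m_assoc rho_mult del: restrict_apply)

lemma sigma_cancel:
  assumes "g \<in> carrier G" "k \<in> carrier (End V)"
  shows "\<sigma> g (\<sigma> (inv g) k) = k" "\<sigma> (inv g) (\<sigma> g k) = k"
  using sigma_comp[of g "inv g" k] sigma_comp[of "inv g" g k] sigma_id assms by simp_all

definition env :: "'g set \<Rightarrow> ('v \<Rightarrow> 'v) set" where
  "env A = generate_ring (End V) (\<rho> ` A)"

text \<open>Commutation is asked of the operators and not of the group elements, since the action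
  need not be faithful.\<close>

definition commuting :: "'g set \<Rightarrow> bool" where
  "commuting A \<longleftrightarrow> (\<forall>a\<in>A. \<forall>b\<in>A. \<rho> a \<bullet> \<rho> b = \<rho> b \<bullet> \<rho> a)"

lemma env_facts:
  assumes A: "A \<lhd> G" and c: "commuting A"
  shows "subcring (env A) (End V)" "\<rho> ` A \<subseteq> env A"
    "\<And>g k. g \<in> carrier G \<Longrightarrow> k \<in> env A \<Longrightarrow> \<sigma> g k \<in> env A"
    "\<And>f k. f \<in> carrier (End V) \<Longrightarrow> (\<And>a. a \<in> A \<Longrightarrow> f \<bullet> \<rho> a = \<rho> a \<bullet> f) \<Longrightarrow> k \<in> env A \<Longrightarrow>
      f \<bullet> k = k \<bullet> f"
proof -
  have Ac: "a \<in> carrier G" if "a \<in> A" for a using normal_mem_carrier[OF A that] .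
  have H: "\<rho> ` A \<subseteq> carrier (End V)" using Ac rho_closed by blast
  show "subcring (env A) (End V)"
    unfolding env_def
  proof (rule R.subcringI[OF R.generate_ring_is_subring[OF H]])
    show "h1 \<bullet> h2 = h2 \<bullet> h1"
      if "h1 \<in> generate_ring (End V) (\<rho> ` A)" "h2 \<in> generate_ring (End V) (\<rho> ` A)" for h1 h2
      using c by (intro R.generate_ring_commutative[OF H _ that]) (auto simp: commuting_def)
  qed
  show "\<rho> ` A \<subseteq> env A" unfolding env_def by (auto intro: generate_ring.incl)
  show "\<sigma> g k \<in> env A" if g: "g \<in> carrier G" and k: "k \<in> env A" for g k
    unfolding env_def \<sigma>_def
  proof (rule R.generate_ring_conj[OF H _ _ _ _ _ k[unfolded env_def]])
    fix h assume "h \<in> \<rho> ` A"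
    then obtain a where a: "a \<in> A" "h = \<rho> a" by blast
    have "\<rho> g \<bullet> \<rho> a \<bullet> \<rho> (inv g) = \<rho> (g \<otimes> a \<otimes> inv g)"
      using g Ac[OF a(1)] by (simp only: rho_mult inv_closed m_closed)
    then show "\<rho> g \<bullet> h \<bullet> \<rho> (inv g) \<in> \<rho> ` A"
      using normal_conj[OF A g a(1)] a(2) by simp
  qed (use g rho_inv in auto)
  show "f \<bullet> k = k \<bullet> f"
    if "f \<in> carrier (End V)" "\<And>a. a \<in> A \<Longrightarrow> f \<bullet> \<rho> a = \<rho> a \<bullet> f" "k \<in> env A" for f k
    using that(3) unfolding env_def
    by (rule R.generate_ring_commutes[OF H that(1), rotated]) (use that(2) in auto)
qed

end

section \<open>The imprimitive case\<close>

text \<open>W is a simple K-submodule, P its annihilator, a maximal ideal of the commutative ring K,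
  and U the submodule killed by P. On U the ring acts through the field K/P, so elements outside P
  act invertibly.\<close>

lemma (in comm_group) isotypic_component:
  assumes fin: "finite (carrier G)" and nt: "carrier G \<noteq> {\<one>}" and K: "subcring K (End G)"
  obtains P U where "P \<subseteq> K" "subgroup U G" "U \<noteq> {\<one>}" "U = {v \<in> carrier G. \<forall>f\<in>P. f v = \<one>}"
    "\<And>f u. f \<in> K \<Longrightarrow> u \<in> U \<Longrightarrow> f u \<in> U" "\<And>f. f \<in> K \<Longrightarrow> f \<notin> P \<Longrightarrow> \<exists>g\<in>K. \<forall>u\<in>U. g (f u) = u"
proof -
  let ?E = "End G"
  have Kr: "subring K ?E" and Kcom: "\<And>f g. f \<in> K \<Longrightarrow> g \<in> K \<Longrightarrow> f \<otimes>\<^bsub>?E\<^esub> g = g \<otimes>\<^bsub>?E\<^esub> f"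
    using K unfolding subcring_def subcring_axioms_def by auto
  have KE: "f \<in> carrier ?E" if "f \<in> K" for f using subringE(1)[OF Kr] that by blast
  have Kc: "f v \<in> carrier G" if "f \<in> K" "v \<in> carrier G" for f v using End_closed KE that by blast
  have Kcomv: "f (g v) = g (f v)" if "f \<in> K" "g \<in> K" "v \<in> carrier G" for f g v
    using Kcom[OF that(1,2)] End_apply(1)[OF that(3)] by metis
  have K1: "f \<one> = \<one>" if "f \<in> K" for f using KE[OF that] by simp
  have Kadd: "f (v \<otimes> w) = f v \<otimes> f w" if "f \<in> K" "v \<in> carrier G" "w \<in> carrier G" for f v w
    using End_add_apply KE that by blast
  have Kinv: "f (inv v) = inv f v" if "f \<in> K" "v \<in> carrier G" for f v
    using End_inv_apply KE that by blast
  have ker: "subgroup {w \<in> W. f w = \<one>} G" if W: "subgroup W G" and f: "f \<in> K" for W f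
  proof (rule subgroupI)
    have Wc: "w \<in> carrier G" if "w \<in> W" for w using subgroup.mem_carrier[OF W that] .
    show "{w \<in> W. f w = \<one>} \<subseteq> carrier G" using Wc by blast
    show "{w \<in> W. f w = \<one>} \<noteq> {}" using subgroup.one_closed[OF W] K1[OF f] by blast
    show "inv a \<in> {w \<in> W. f w = \<one>}" if "a \<in> {w \<in> W. f w = \<one>}" for a
      using that Wc Kinv[OF f] subgroup.m_inv_closed[OF W] by auto
    show "a \<otimes> b \<in> {w \<in> W. f w = \<one>}" if "a \<in> {w \<in> W. f w = \<one>}" "b \<in> {w \<in> W. f w = \<one>}" for a b
      using that Wc Kadd[OF f] subgroup.m_closed[OF W] by auto
  qed
  let ?P = "\<lambda>W. subgroup W G \<and> (\<forall>f\<in>K. \<forall>w\<in>W. f w \<in> W) \<and> W \<noteq> {\<one>}"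
  have "?P (carrier G)" using nt Kc subgroup_self by simp
  moreover have "\<And>W. ?P W \<Longrightarrow> W \<subseteq> carrier G" by (simp add: subgroup.subset)
  ultimately obtain W where W0: "?P W \<and> (\<forall>W'. ?P W' \<longrightarrow> W' \<subseteq> W \<longrightarrow> W' = W)"
    by (rule minimal_subset[of "carrier G" ?P, OF fin, THEN exE])
  have Wsub: "subgroup W G" and W1: "W \<noteq> {\<one>}" and WK: "\<And>f w. f \<in> K \<Longrightarrow> w \<in> W \<Longrightarrow> f w \<in> W"
    using W0 by simp_all
  have Wmin: "W' = W" if "?P W'" "W' \<subseteq> W" for W' using W0 that by simp
  have Wc: "w \<in> carrier G" if "w \<in> W" for w using subgroup.mem_carrier[OF Wsub that] .
  \<comment> \<open>Schur's lemma: K is commutative, so the kernel of f on W is again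
    K-invariant.\<close>
  have W_inj: "w = \<one>" if f: "f \<in> K" "w' \<in> W" "f w' \<noteq> \<one>" and w: "w \<in> W" "f w = \<one>" for f w w'
  proof (rule ccontr)
    assume "w \<noteq> \<one>"
    let ?W = "{w \<in> W. f w = \<one>}"
    have "\<forall>g\<in>K. \<forall>w\<in>?W. g w \<in> ?W" using WK Kcomv[OF f(1)] K1 Wc by auto
    moreover have "?W \<noteq> {\<one>}" using w \<open>w \<noteq> \<one>\<close> by blast
    ultimately have "?W = W" using ker[OF Wsub f(1)] by (intro Wmin) auto
    then show False using f by blast
  qed
  define P where "P = {f \<in> K. \<forall>w\<in>W. f w = \<one>}"
  define U where "U = {v \<in> carrier G. \<forall>f\<in>P. f v = \<one>}"
  have PK: "f \<in> K" if "f \<in> P" for f using that by (simp add: P_def)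
  have WU: "W \<subseteq> U" using Wc by (auto simp: U_def P_def)
  have Uc: "u \<in> carrier G" if "u \<in> U" for u using that by (simp add: U_def)
  have U0: "f u = \<one>" if "f \<in> P" "u \<in> U" for f u using that by (simp add: U_def)
  have UI: "u \<in> U" if "u \<in> carrier G" "\<And>f. f \<in> P \<Longrightarrow> f u = \<one>" for u using that by (simp add: U_def)
  have Usub: "subgroup U G"
  proof (rule subgroupI)
    show "U \<subseteq> carrier G" using Uc by blast
    show "U \<noteq> {}" using WU subgroup.one_closed[OF Wsub] by blast
    show "inv a \<in> U" if a: "a \<in> U" for a
      by (rule UI) (simp_all add: Uc[OF a] Kinv[OF PK Uc[OF a]] U0[OF _ a])
    show "a \<otimes> b \<in> U" if a: "a \<in> U" and b: "b \<in> U" for a b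
      by (rule UI) (simp_all add: Uc a b Kadd[OF PK Uc[OF a] Uc[OF b]] U0[OF _ a] U0[OF _ b])
  qed
  have UK: "f u \<in> U" if f: "f \<in> K" and u: "u \<in> U" for f u
    by (rule UI) (simp_all add: Kc[OF f Uc[OF u]] Kcomv[OF PK f Uc[OF u]] U0[OF _ u] K1[OF f])
  have U_unit: "\<exists>g\<in>K. \<forall>u\<in>U. g (f u) = u" if f: "f \<in> K" "f \<notin> P" for f
  proof -
    obtain w' where w': "w' \<in> W" "f w' \<noteq> \<one>" using f by (auto simp: P_def)
    have inj: "w = x" if "w \<in> W" "x \<in> W" "f w = f x" for w x
    proof -
      have "f (w \<otimes> inv x) = \<one>" using that Wc f(1) Kadd[of f w "inv x"] Kinv[of f x] Kc by simp
      then have "w \<otimes> inv x = \<one>"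
        using W_inj[OF f(1) w'] that Wsub by (simp add: subgroup.m_closed subgroup.m_inv_closed)
      then show ?thesis using that Wc inv_equality[of w "inv x"] by simp
    qed
    \<comment> \<open>Multiplication by f is injective on the finite set of restrictions of K to W,
      hence surjective; a preimage of the identity inverts f on W.\<close>
    let ?S = "(\<lambda>g. restrict g W) ` K"
    let ?m = "\<lambda>s. \<lambda>w\<in>W. f (s w)"
    have "finite ?S" using finite_subset[OF subringE(1)[OF Kr] End_finite[OF fin]] by blast
    moreover have "?m ` ?S \<subseteq> ?S"
    proof
      fix s assume "s \<in> ?m ` ?S"
      then obtain g where g: "g \<in> K" "s = ?m (restrict g W)" by blast
      have "f \<otimes>\<^bsub>?E\<^esub> g \<in> K" using subringE(6)[OF Kr] f g by blast
      moreover have "s = restrict (f \<otimes>\<^bsub>?E\<^esub> g) W" using g Wc by (auto simp: End_apply)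
      ultimately show "s \<in> ?S" by blast
    qed
    moreover have "inj_on ?m ?S"
    proof (rule inj_onI)
      fix s t assume "s \<in> ?S" "t \<in> ?S" and eq: "?m s = ?m t"
      then obtain g h where gh: "g \<in> K" "h \<in> K" "s = restrict g W" "t = restrict h W" by blast
      have "g w = h w" if "w \<in> W" for w
        using fun_cong[OF eq, of w] that gh inj[OF WK[OF gh(1)] WK[OF gh(2)]] by simp
      then show "s = t" using gh by auto
    qed
    ultimately have "?m ` ?S = ?S" by (rule endo_inj_surj)
    moreover have one: "\<one>\<^bsub>?E\<^esub> \<in> K" using subringE(3)[OF Kr] .
    ultimately have "restrict \<one>\<^bsub>?E\<^esub> W \<in> ?m ` ?S" by blast
    then obtain g where g: "g \<in> K" "restrict \<one>\<^bsub>?E\<^esub> W = ?m (restrict g W)" by blast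
    have fg: "f (g w) = w" if "w \<in> W" for w
      using fun_cong[OF g(2), of w] that Wc by (simp add: End_apply)
    \<comment> \<open>g f - 1 vanishes on W, so it lies in P and vanishes on U: the inverse found on
      W works on all of U.\<close>
    let ?h = "(g \<otimes>\<^bsub>?E\<^esub> f) \<oplus>\<^bsub>?E\<^esub> (\<ominus>\<^bsub>?E\<^esub> \<one>\<^bsub>?E\<^esub>)"
    have gfK: "g \<otimes>\<^bsub>?E\<^esub> f \<in> K" using subringE(6)[OF Kr] f g by blast
    have hK: "?h \<in> K" using subringE(7)[OF Kr gfK subringE(5)[OF Kr one]] .
    have h: "?h v = g (f v) \<otimes> inv v" if v: "v \<in> carrier G" for v
      using v KE[OF one] by (simp add: End_apply End_neg_apply)
    have "?h \<in> P" unfolding P_def using hK h fg Wc Kcomv[OF g(1) f(1)] by auto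
    then have "g (f u) \<otimes> inv u = \<one>" if "u \<in> U" for u using U0[OF _ that] h[OF Uc[OF that]] by simp
    then have "g (f u) = u" if "u \<in> U" for u
      using that inv_equality[of "g (f u)" "inv u"] Uc Kc f(1) g(1) by simp
    then show ?thesis using g(1) by blast
  qed
  have "U \<noteq> {\<one>}" using WU W1 subgroup.one_closed[OF Wsub] by blast
  then show thesis using that[of P U] PK Usub UK U_unit U_def by blast
qed

text \<open>A component filling the whole group leaves only zero in its annihilator P, so all
  nonzero elements of K are invertible. Hence a K that is not a field yields a proper component, and
  irreducibility then a second block.\<close>

lemma (in comm_group) subfield_if_isotypic:
  assumes nt: "carrier G \<noteq> {\<one>}" and K: "subcring K (End G)"
    and P: "P \<subseteq> K" "carrier G = {v \<in> carrier G. \<forall>f\<in>P. f v = \<one>}"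
    and unit: "\<And>f. f \<in> K \<Longrightarrow> f \<notin> P \<Longrightarrow> \<exists>g\<in>K. \<forall>u\<in>carrier G. g (f u) = u"
  shows "subfield K (End G)"
proof -
  let ?E = "End G"
  interpret R: ring ?E by (rule End_ring)
  have Kr: "subring K ?E" and Kcom: "\<And>f g. f \<in> K \<Longrightarrow> g \<in> K \<Longrightarrow> f \<otimes>\<^bsub>?E\<^esub> g = g \<otimes>\<^bsub>?E\<^esub> f"
    using K unfolding subcring_def subcring_axioms_def by auto
  have KE: "f \<in> carrier ?E" if "f \<in> K" for f using subringE(1)[OF Kr] that by blast
  have P0: "f = \<zero>\<^bsub>?E\<^esub>" if f: "f \<in> P" for f
  proof (rule End_eqI)
    show "f \<in> carrier ?E" using f P(1) KE by blast
    fix v assume v: "v \<in> carrier G"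
    then have "f v = \<one>" using P(2) f by blast
    then show "f v = \<zero>\<^bsub>?E\<^esub> v" using v by (simp add: End_apply)
  qed simp
  have one0: "\<one>\<^bsub>?E\<^esub> \<noteq> \<zero>\<^bsub>?E\<^esub>"
  proof
    assume eq: "\<one>\<^bsub>?E\<^esub> = \<zero>\<^bsub>?E\<^esub>"
    have "v = \<one>" if "v \<in> carrier G" for v using fun_cong[OF eq, of v] that by (simp add: End_apply)
    then show False using nt by blast
  qed
  show ?thesis
  proof (rule R.subfieldI[OF K], intro equalityI subsetI)
    fix f assume "f \<in> Units (?E\<lparr>carrier := K\<rparr>)"
    then obtain g where g: "f \<in> K" "g \<in> K" "g \<otimes>\<^bsub>?E\<^esub> f = \<one>\<^bsub>?E\<^esub>" by (auto simp: Units_def)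
    then have "f \<noteq> \<zero>\<^bsub>?E\<^esub>" using one0 KE R.r_null by metis
    then show "f \<in> K - {\<zero>\<^bsub>?E\<^esub>}" using g by blast
  next
    fix f assume f: "f \<in> K - {\<zero>\<^bsub>?E\<^esub>}"
    then obtain g where g: "g \<in> K" "\<And>u. u \<in> carrier G \<Longrightarrow> g (f u) = u" using unit P0 by blast
    have "g \<otimes>\<^bsub>?E\<^esub> f = \<one>\<^bsub>?E\<^esub>"
    proof (rule End_eqI)
      show "g \<otimes>\<^bsub>?E\<^esub> f \<in> carrier ?E" using KE f g by simp
    qed (use g in \<open>auto simp: End_apply\<close>)
    moreover have "f \<otimes>\<^bsub>?E\<^esub> g = g \<otimes>\<^bsub>?E\<^esub> f" using Kcom f g by blast
    ultimately show "f \<in> Units (?E\<lparr>carrier := K\<rparr>)" using f g by (auto simp: Units_def)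
  qed
qed

context group_module
begin

text \<open>The blocks are the translates of an isotypic component U of the enveloping ring; their
  annihilators are pairwise different, which makes them independent. Y is an irreducible subgroup
  inside U for the stabilizer M; that it may be smaller than U only helps the estimate.\<close>

lemma imprimitive_decomposition:
  assumes irreducible_on: "irreducible_on (carrier G) V act (carrier V)" and A: "A \<lhd> G" and c: "commuting A"
    and nf: "\<not> subfield (env A) (End V)"
  obtains M Y k where "subgroup M G" "card (carrier G) = k * card M" "k \<ge> 2"
    "irreducible_on M V act Y" "card Y ^ k \<le> card (carrier V)"
proof -
  let ?E = "End V" and ?K = "env A"
  note K = env_facts[OF A c]
  have Kr: "subring ?K ?E" using K(1) by (simp add: subcring_def)
  have KE: "f \<in> carrier ?E" if "f \<in> ?K" for f using subringE(1)[OF Kr] that by blast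
  have Kc: "f v \<in> carrier V" if "f \<in> ?K" "v \<in> carrier V" for f v using V.End_closed KE that by blast
  have nt: "carrier V \<noteq> {\<one>\<^bsub>V\<^esub>}" using irreducible_on by (simp add: irreducible_on_def)
  obtain P U where PK: "P \<subseteq> ?K" and Usub: "subgroup U V" and U1: "U \<noteq> {\<one>\<^bsub>V\<^esub>}"
    and U: "U = {v \<in> carrier V. \<forall>f\<in>P. f v = \<one>\<^bsub>V\<^esub>}" and UK: "\<And>f u. f \<in> ?K \<Longrightarrow> u \<in> U \<Longrightarrow> f u \<in> U"
    and U_unit: "\<And>f. f \<in> ?K \<Longrightarrow> f \<notin> P \<Longrightarrow> \<exists>g\<in>?K. \<forall>u\<in>U. g (f u) = u"
    using V.isotypic_component[OF finV nt K(1)] by blast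
  have Uc: "u \<in> carrier V" if "u \<in> U" for u using subgroup.mem_carrier[OF Usub that] .
  define T where "T = (\<lambda>g. act g ` U) ` carrier G"
  define M where "M = {g \<in> carrier G. act g ` U = U}"
  have img_mult: "act (g \<otimes> h) ` U = act g ` act h ` U" if "g \<in> carrier G" "h \<in> carrier G" for g h
    unfolding image_image using that act_mult Uc by (intro image_cong) auto
  have img_one: "act \<one> ` U = U" using act_one Uc by force
  have img_inv: "act (inv g) ` act g ` U = U" if "g \<in> carrier G" for g
    using img_mult[of "inv g" g] img_one that by simp
  have M: "subgroup M G"
  proof (rule subgroupI)
    show "M \<subseteq> carrier G" by (auto simp: M_def)
    show "M \<noteq> {}" using img_one by (auto simp: M_def)
    show "inv g \<in> M" if "g \<in> M" for g using that img_inv[of g] by (simp add: M_def)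
    show "g \<otimes> h \<in> M" if "g \<in> M" "h \<in> M" for g h using that img_mult[of g h] by (simp add: M_def)
  qed
  have finT: "finite T" unfolding T_def using finG by blast
  define k where "k = card T"
  have cardG: "card (carrier G) = k * card M"
  proof -
    \<comment> \<open>Orbit-stabilizer count: the elements carrying U to a given block form a left
      coset of M.\<close>
    have fib: "card {g \<in> carrier G. act g ` U = Q} = card M" if QT: "Q \<in> T" for Q
    proof -
      obtain h where h: "h \<in> carrier G" "Q = act h ` U" using QT by (auto simp: T_def)
      have "bij_betw (\<lambda>g. h \<otimes> g) M {g \<in> carrier G. act g ` U = Q}"
      proof (rule bij_betw_byWitness[where f' = "\<lambda>g. inv h \<otimes> g"])
        show "\<forall>a\<in>M. inv h \<otimes> (h \<otimes> a) = a" using h by (simp add: M_def)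
        show "\<forall>a\<in>{g \<in> carrier G. act g ` U = Q}. h \<otimes> (inv h \<otimes> a) = a" using h by simp
        show "(\<otimes>) h ` M \<subseteq> {g \<in> carrier G. act g ` U = Q}" 
        proof
          fix x assume "x \<in> (\<otimes>) h ` M"
          then obtain g where g: "g \<in> carrier G" "act g ` U = U" "x = h \<otimes> g" by (auto simp: M_def)
          then show "x \<in> {g \<in> carrier G. act g ` U = Q}" using h img_mult[of h g] by simp
        qed
        show "(\<otimes>) (inv h) ` {g \<in> carrier G. act g ` U = Q} \<subseteq> M"
        proof
          fix x assume "x \<in> (\<otimes>) (inv h) ` {g \<in> carrier G. act g ` U = Q}"
          then obtain g where g: "g \<in> carrier G" "act g ` U = Q" "x = inv h \<otimes> g" by blast
          have "act x ` U = act (inv h) ` act h ` U" using img_mult[of "inv h" g] g h by simp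
          then show "x \<in> M" using img_inv g h by (simp add: M_def)
        qed
      qed
      then show ?thesis by (metis bij_betw_same_card)
    qed
    have "card (carrier G) = (\<Sum>Q\<in>T. \<Sum>x\<in>{g \<in> carrier G. act g ` U = Q}. 1)"
      using sum.image_gen[OF finG, of "\<lambda>_. 1::nat" "\<lambda>g. act g ` U"] by (simp add: T_def)
    also have "\<dots> = (\<Sum>Q\<in>T. card M)" using fib by (intro sum.cong) auto
    finally show ?thesis by (simp add: k_def)
  qed

  have PE: "f \<in> carrier ?E" if "f \<in> P" for f using PK KE that by blast
  have PcK: "\<sigma> g ` P \<subseteq> ?K" if "g \<in> carrier G" for g using K(3)[OF that] PK by blast
  have cardPc: "card (\<sigma> g ` P) = card P" if g: "g \<in> carrier G" for g
    using sigma_cancel(2)[OF g] PE by (intro Finite_Set.card_image inj_on_inverseI[of _ "\<sigma> (inv g)"]) simp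
  have finP: "finite (\<sigma> g ` P)" if "g \<in> carrier G" for g
    using finite_subset[OF PcK[OF that] finite_subset[OF subringE(1)[OF Kr] V.End_finite[OF finV]]] .
  have act_one_iff: "act g v = \<one>\<^bsub>V\<^esub> \<longleftrightarrow> v = \<one>\<^bsub>V\<^esub>" if "g \<in> carrier G" "v \<in> carrier V" for g v
    using inj_onD[OF act_inj[OF that(1)], of v "\<one>\<^bsub>V\<^esub>"] that by auto
  have annPc: "v \<in> act g ` U \<longleftrightarrow> v \<in> carrier V \<and> (\<forall>f\<in>\<sigma> g ` P. f v = \<one>\<^bsub>V\<^esub>)" if g: "g \<in> carrier G" for g v
  proof -
    have "v \<in> act g ` U \<longleftrightarrow> v \<in> carrier V \<and> act (inv g) v \<in> U"
      using g Uc act_cancel by (metis (no_types, lifting) act_closed imageE imageI)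
    also have "\<dots> \<longleftrightarrow> v \<in> carrier V \<and> (\<forall>f\<in>P. f (act (inv g) v) = \<one>\<^bsub>V\<^esub>)"
      unfolding U using g by auto
    also have "\<dots> \<longleftrightarrow> v \<in> carrier V \<and> (\<forall>f\<in>P. \<sigma> g f v = \<one>\<^bsub>V\<^esub>)"
    proof (intro conj_cong refl ball_cong)
      fix f assume v: "v \<in> carrier V" and f: "f \<in> P"
      have "f (act (inv g) v) \<in> carrier V" using Kc PK f v g by auto
      then show "(f (act (inv g) v) = \<one>\<^bsub>V\<^esub>) = (\<sigma> g f v = \<one>\<^bsub>V\<^esub>)"
        unfolding sigma_apply[OF g PE[OF f] v] using act_one_iff[OF g] by blast
    qed
    finally show ?thesis by simp
  qed
  have sep: "separated V T (\<lambda>Q. Q)"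
    unfolding separated_def
  proof (intro conjI ballI impI)
    show "finite T" by (rule finT)
    show "subgroup Q V" if "Q \<in> T" for Q using that subgroup_image Usub by (auto simp: T_def)
    fix Q Z assume QZ: "Q \<in> T" "Z \<in> T" "Q \<noteq> Z"
    obtain g h where g: "g \<in> carrier G" "Q = act g ` U" and h: "h \<in> carrier G" "Z = act h ` U"
      using QZ by (auto simp: T_def)
    \<comment> \<open>All annihilators have the size of P, so an inclusion would be an equality and
      would identify the two blocks. This secures a separating f for the ordered pair, as
      \<open>separated\<close> demands.\<close>
    have "\<not> \<sigma> g ` P \<subseteq> \<sigma> h ` P"
    proof
      assume "\<sigma> g ` P \<subseteq> \<sigma> h ` P"
      then have "\<sigma> g ` P = \<sigma> h ` P" using card_subset_eq[OF finP[OF h(1)]] cardPc g h by metis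
      then have "v \<in> Q \<longleftrightarrow> v \<in> Z" for v unfolding g(2) h(2) annPc[OF g(1)] annPc[OF h(1)] by simp
      then show False using QZ(3) by blast
    qed
    then obtain f where f: "f \<in> \<sigma> g ` P" "f \<notin> \<sigma> h ` P" by blast
    have fK: "f \<in> ?K" using PcK[OF g(1)] f by blast
    have conj: "\<sigma> (inv t) f \<in> ?K" "f (act t u) = act t (\<sigma> (inv t) f u)"
      if t: "t \<in> carrier G" and u: "u \<in> U" for t u
    proof -
      show 1: "\<sigma> (inv t) f \<in> ?K" using K(3) fK t by blast
      have "f (act t u) = \<sigma> t (\<sigma> (inv t) f) (act t u)" using sigma_cancel(1)[OF t KE[OF fK]] by simp
      also have "\<dots> = act t (\<sigma> (inv t) f u)" using sigma_apply[OF t KE[OF 1]] t Uc[OF u] by simp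
      finally show "f (act t u) = act t (\<sigma> (inv t) f u)" .
    qed
    \<comment> \<open>Pulled back to U, f lies outside P and acts invertibly there, so f has trivial
      kernel on the block Z.\<close>
    define f' where "f' = \<sigma> (inv h) f"
    have f'K: "f' \<in> ?K" unfolding f'_def using K(3) fK h by blast
    have "f = \<sigma> h f'" unfolding f'_def using sigma_cancel(1)[OF h(1) KE[OF fK]] by simp
    then have "f' \<notin> P" using f(2) by blast
    then obtain e where e: "e \<in> ?K" "\<And>u. u \<in> U \<Longrightarrow> e (f' u) = u" using U_unit[OF f'K] by blast
    show "\<exists>\<theta>\<in>hom V V. (\<forall>l\<in>T. \<theta> ` l \<subseteq> l) \<and> (\<forall>x\<in>Q. \<theta> x = \<one>\<^bsub>V\<^esub>) \<and> (\<forall>x\<in>Z. \<theta> x = \<one>\<^bsub>V\<^esub> \<longrightarrow> x = \<one>\<^bsub>V\<^esub>)"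
    proof (intro bexI[of _ f] conjI ballI impI)
      show "f \<in> hom V V" using V.End_hom[OF KE[OF fK]] .
      show "f x = \<one>\<^bsub>V\<^esub>" if "x \<in> Q" for x using that annPc[OF g(1)] f(1) g(2) by blast
      show "x = \<one>\<^bsub>V\<^esub>" if x: "x \<in> Z" "f x = \<one>\<^bsub>V\<^esub>" for x
      proof -
        obtain u where u: "u \<in> U" "x = act h u" using x(1) h(2) by blast
        have "act h (f' u) = \<one>\<^bsub>V\<^esub>" using x(2) conj(2)[OF h(1) u(1)] u(2) by (simp only: f'_def)
        then have "f' u = \<one>\<^bsub>V\<^esub>" using act_one_iff[OF h(1) Kc[OF f'K Uc[OF u(1)]]] by blast
        then have "u = \<one>\<^bsub>V\<^esub>" using e(2)[OF u(1)] KE[OF e(1)] by simp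
        then show ?thesis using u h by simp
      qed
      show "f ` l \<subseteq> l" if lT: "l \<in> T" for l
      proof -
        obtain t where t: "t \<in> carrier G" "l = act t ` U" using lT by (auto simp: T_def)
        have "f (act t u) \<in> act t ` U" if "u \<in> U" for u
          unfolding conj(2)[OF t(1) that] using UK[OF conj(1)[OF t(1) that] that] by blast
        then show ?thesis using t(2) by blast
      qed
    qed
  qed
  have "(\<Prod>Q\<in>T. card Q) \<le> card (carrier V)" using V.separated_card[OF sep finV] .
  moreover have "(\<Prod>Q\<in>T. card Q) = (\<Prod>Q\<in>T. card U)"
  proof (rule prod.cong[OF refl])
    fix Q assume "Q \<in> T"
    then obtain g where g: "g \<in> carrier G" "Q = act g ` U" by (auto simp: T_def)
    show "card Q = card U" unfolding g(2) by (rule card_image[OF g(1) Usub])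
  qed
  ultimately have cU: "card U ^ k \<le> card (carrier V)" by (simp add: k_def)
  have UT: "U \<in> T" unfolding T_def using img_one by (metis image_eqI one_closed)
  \<comment> \<open>With a single translate U would be invariant, hence all of V, and the enveloping
    ring would be a field.\<close>
  have "k \<noteq> 1"
  proof
    assume "k = 1"
    then have "T = {U}" using UT card_1_singletonE unfolding k_def by (metis singletonD)
    moreover have "act g ` U \<in> T" if "g \<in> carrier G" for g using that unfolding T_def by (rule imageI)
    ultimately have "act g ` U = U" if "g \<in> carrier G" for g using that by blast
    then have "invariant_subgroup (carrier G) V act U" using Usub unfolding invariant_subgroup_def by blast
    then have UV: "carrier V = U" using irreducible_on U1 subgroup.subset[OF Usub] unfolding irreducible_on_def by blast
    have "subfield ?K ?E"
      by (rule V.subfield_if_isotypic[OF nt K(1) PK]) (use U U_unit UV in simp_all)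
    then show False using nf by simp
  qed
  moreover have "k \<noteq> 0" using UT finT by (auto simp: k_def)
  ultimately have k2: "k \<ge> 2" by simp
  have "invariant_subgroup M V act U" using Usub by (auto simp: invariant_subgroup_def M_def)
  then obtain Y where Y: "irreducible_on M V act Y" "Y \<subseteq> U" using irreducible_on_exists U1 by blast
  have "card Y \<le> card U" using card_mono[OF _ Y(2)] finite_subset[OF subgroup.subset[OF Usub] finV] by blast
  then have "card Y ^ k \<le> card U ^ k" by (rule power_mono) simp
  then show thesis using that[OF M cardG k2 Y(1)] cU by linarith
qed

end

section \<open>The primitive case\<close>

lemma (in comm_group) End_inverse_exists:
  assumes "subfield K (End G)" "f \<in> K" "f \<noteq> \<zero>\<^bsub>End G\<^esub>"
  obtains g where "g \<in> K" "g \<otimes>\<^bsub>End G\<^esub> f = \<one>\<^bsub>End G\<^esub>"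
proof -
  interpret R: ring "End G" by (rule End_ring)
  have "f \<in> K - {\<zero>\<^bsub>End G\<^esub>}" using assms by blast
  then show thesis using R.subfield_m_inv[OF assms(1), of f] that by blast
qed

text \<open>C is the ring of K-linear maps, and such a map is determined by its values on a basis.
  The predicate P describes a subspace W of order |K| ^ s with a set B of at most s vectors
  determining these maps on W; a vector v outside W would adjoin a summand K v, so a maximal W is
  everything.\<close>

lemma (in comm_group) subfield_dimension:
  assumes fin: "finite (carrier G)" and K: "subfield K (End G)"
  defines "C \<equiv> {f \<in> carrier (End G). \<forall>k\<in>K. f \<otimes>\<^bsub>End G\<^esub> k = k \<otimes>\<^bsub>End G\<^esub> f}"
  obtains s where "card (carrier G) = card K ^ s" "card C \<le> card (carrier G) ^ s"
proof -
  let ?E = "End G"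
  interpret R: ring ?E by (rule End_ring)
  have Kr: "subring K ?E" using subfieldE(1)[OF K] .
  have KE: "k \<in> carrier ?E" if "k \<in> K" for k using subringE(1)[OF Kr] that by blast
  have finE: "finite (carrier ?E)" using End_finite[OF fin] .
  have finK: "finite K" using finite_subset[OF subringE(1)[OF Kr] finE] .
  have Kc: "k v \<in> carrier G" if "k \<in> K" "v \<in> carrier G" for k v using End_closed[OF KE[OF that(1)] that(2)] .
  define P where "P W s B \<longleftrightarrow> subgroup W G \<and> (\<forall>k\<in>K. \<forall>w\<in>W. k w \<in> W) \<and> card W = card K ^ s \<and>
     B \<subseteq> carrier G \<and> card B \<le> s \<and> (\<forall>f\<in>C. \<forall>g\<in>C. (\<forall>b\<in>B. f b = g b) \<longrightarrow> (\<forall>w\<in>W. f w = g w))" for W s B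
  have CE: "f \<in> carrier ?E" if "f \<in> C" for f using that by (simp add: C_def)
  have Ccom: "f (k v) = k (f v)" if "f \<in> C" "k \<in> K" "v \<in> carrier G" for f k v
  proof -
    have "f \<otimes>\<^bsub>?E\<^esub> k = k \<otimes>\<^bsub>?E\<^esub> f" using that by (simp add: C_def)
    then show ?thesis using that(3) End_apply(1) by metis
  qed
  have P1: "P {\<one>} 0 {}"
    unfolding P_def using KE CE by (auto simp: normal_imp_subgroup[OF one_is_normal])
  let ?Q = "\<lambda>W. \<exists>s B. P W s B"
  have "?Q {\<one>}" using P1 by blast
  moreover have "\<And>W. ?Q W \<Longrightarrow> W \<subseteq> carrier G" by (auto simp: P_def dest: subgroup.subset)
  ultimately obtain W where W_Wm: "?Q W \<and> (\<forall>W'. ?Q W' \<longrightarrow> W \<subseteq> W' \<longrightarrow> W' = W)"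
    by (rule maximal_subset[of "carrier G" ?Q, OF fin, THEN exE])
  note W = W_Wm[THEN conjunct1] and Wm = W_Wm[THEN conjunct2, rule_format]
  obtain s B where PW: "P W s B" using W by blast
  have Ws: "subgroup W G" and WK: "\<And>k w. k \<in> K \<Longrightarrow> w \<in> W \<Longrightarrow> k w \<in> W" and cW: "card W = card K ^ s"
    and B: "B \<subseteq> carrier G" "card B \<le> s"
    and Bd: "\<And>f g w. f \<in> C \<Longrightarrow> g \<in> C \<Longrightarrow> (\<And>b. b \<in> B \<Longrightarrow> f b = g b) \<Longrightarrow> w \<in> W \<Longrightarrow> f w = g w"
    using PW unfolding P_def by blast+
  have Wc: "w \<in> carrier G" if "w \<in> W" for w using subgroup.mem_carrier[OF Ws that] .
  have finW: "finite W" using finite_subset[OF subgroup.subset[OF Ws] fin] .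
  have "\<one>\<^bsub>?E\<^esub> \<in> K" "\<zero>\<^bsub>?E\<^esub> \<in> K" "\<one>\<^bsub>?E\<^esub> \<noteq> \<zero>\<^bsub>?E\<^esub>"
    using subringE(2,3)[OF Kr] subfieldE(6)[OF K] by auto
  then have "card {\<one>\<^bsub>?E\<^esub>, \<zero>\<^bsub>?E\<^esub>} \<le> card K" by (intro card_mono finK) auto
  then have K2: "card K \<ge> 2" using \<open>\<one>\<^bsub>?E\<^esub> \<noteq> \<zero>\<^bsub>?E\<^esub>\<close> by simp
  have WG: "W = carrier G"
  proof (rule ccontr)
    assume "W \<noteq> carrier G"
    then obtain v where v: "v \<in> carrier G" "v \<notin> W" using subgroup.subset[OF Ws] by blast
    let ?f = "\<lambda>(w, k). w \<otimes> k v"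
    define W' where "W' = ?f ` (W \<times> K)"
    \<comment> \<open>Two representations of one vector would differ in the coefficient of v;
      inverting that difference in K would place v in W.\<close>
    have inj: "inj_on ?f (W \<times> K)"
    proof (rule inj_onI, clarify)
      fix w k w' k' assume h: "w \<in> W" "k \<in> K" "w' \<in> W" "k' \<in> K" and eq: "w \<otimes> k v = w' \<otimes> k' v"
      let ?d = "k \<oplus>\<^bsub>?E\<^esub> (\<ominus>\<^bsub>?E\<^esub> k')"
      have dK: "?d \<in> K" using subringE(7)[OF Kr h(2) subringE(5)[OF Kr h(4)]] .
      have c: "w \<in> carrier G" "w' \<in> carrier G" "k v \<in> carrier G" "k' v \<in> carrier G" using h Wc Kc v by auto
      have "?d v = k v \<otimes> inv (k' v)" using v h KE by (simp add: End_apply End_neg_apply)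
      also have "\<dots> = inv w \<otimes> (w \<otimes> k v) \<otimes> inv (k' v)" using c by simp
      also have "\<dots> = inv w \<otimes> w'" unfolding eq using c by (simp add: m_assoc)
      finally have dv: "?d v = inv w \<otimes> w'" .
      have dW: "?d v \<in> W" unfolding dv using h Ws by (simp add: subgroup.m_closed subgroup.m_inv_closed)
      have d0: "?d = \<zero>\<^bsub>?E\<^esub>"
      proof (rule ccontr)
        assume "?d \<noteq> \<zero>\<^bsub>?E\<^esub>"
        then obtain g where g: "g \<in> K" "g \<otimes>\<^bsub>?E\<^esub> ?d = \<one>\<^bsub>?E\<^esub>" using End_inverse_exists[OF K dK] by blast
        have "v = (g \<otimes>\<^bsub>?E\<^esub> ?d) v" unfolding g(2) using v by (simp add: End_apply)
        also have "\<dots> = g (?d v)" using v by (simp add: End_apply(1))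
        finally have "v \<in> W" using WK[OF g(1) dW] by simp
        then show False using v by blast
      qed
      then have "k = k'" using KE h R.minus_equality[of "k" "\<ominus>\<^bsub>?E\<^esub> k'"] by simp
      then show "w = w' \<and> k = k'" using eq c by simp
    qed
    have "P W' (Suc s) (insert v B)"
      unfolding P_def
    proof (intro conjI ballI impI)
      show "subgroup W' G"
      proof (rule subgroupI)
        show "W' \<subseteq> carrier G" unfolding W'_def using Wc Kc v by auto
        show "W' \<noteq> {}" unfolding W'_def using subgroup.one_closed[OF Ws] subringE(2)[OF Kr] by blast
        fix a assume "a \<in> W'"
        then obtain w k where a: "w \<in> W" "k \<in> K" "a = w \<otimes> k v" by (auto simp: W'_def)
        have "inv a = ?f (inv w, \<ominus>\<^bsub>?E\<^esub> k)" using a Wc Kc v KE by (simp add: End_neg_apply inv_mult)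
        moreover have "(inv w, \<ominus>\<^bsub>?E\<^esub> k) \<in> W \<times> K" using a subgroup.m_inv_closed[OF Ws] subringE(5)[OF Kr] by blast
        ultimately show "inv a \<in> W'" unfolding W'_def by blast
        fix b assume "b \<in> W'"
        then obtain w' k' where b: "w' \<in> W" "k' \<in> K" "b = w' \<otimes> k' v" by (auto simp: W'_def)
        have "a \<otimes> b = ?f (w \<otimes> w', k \<oplus>\<^bsub>?E\<^esub> k')" using a b Wc Kc v by (simp add: End_apply m_ac)
        moreover have "(w \<otimes> w', k \<oplus>\<^bsub>?E\<^esub> k') \<in> W \<times> K" using a b subgroup.m_closed[OF Ws] subringE(7)[OF Kr] by blast
        ultimately show "a \<otimes> b \<in> W'" unfolding W'_def by blast
      qed
      show "k a \<in> W'" if k: "k \<in> K" and aW: "a \<in> W'" for k a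
      proof -
        obtain w k' where a: "w \<in> W" "k' \<in> K" "a = w \<otimes> k' v" using aW by (auto simp: W'_def)
        have "k a = ?f (k w, k \<otimes>\<^bsub>?E\<^esub> k')" using a k Wc Kc v KE by (simp add: End_apply End_add_apply)
        moreover have "(k w, k \<otimes>\<^bsub>?E\<^esub> k') \<in> W \<times> K" using a k WK subringE(6)[OF Kr] by blast
        ultimately show ?thesis unfolding W'_def by blast
      qed
      have "card W' = card W * card K" unfolding W'_def using card_image[OF inj] by (simp add: card_cartesian_product)
      then show "card W' = card K ^ Suc s" using cW by simp
      show "insert v B \<subseteq> carrier G" using v B by blast
      show "card (insert v B) \<le> Suc s" using B card_insert_le_m1[of "Suc s" B v] by simp
      fix f g a assume fg: "f \<in> C" "g \<in> C" "\<forall>b\<in>insert v B. f b = g b" and aW: "a \<in> W'"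
      obtain w k where a: "w \<in> W" "k \<in> K" "a = w \<otimes> k v" using aW by (auto simp: W'_def)
      have fw: "f w = g w" using Bd[OF fg(1,2) _ a(1)] fg(3) by blast
      have e: "h a = h w \<otimes> k (h v)" if h: "h \<in> C" for h
        using a Wc Kc v CE[OF h] Ccom[OF h a(2) v(1)] by (simp add: End_add_apply)
      show "f a = g a" using e[OF fg(1)] e[OF fg(2)] fw fg(3) by simp
    qed
    moreover have "W \<subseteq> W'"
    proof
      fix w assume w: "w \<in> W"
      have "?f (w, \<zero>\<^bsub>?E\<^esub>) = w" using Wc[OF w] v by (simp add: End_apply)
      then show "w \<in> W'" using w subringE(2)[OF Kr] unfolding W'_def by (metis SigmaI imageI)
    qed
    ultimately have "W' = W" using Wm by blast
    moreover have "card W' = card W * card K" unfolding W'_def using card_image[OF inj] by (simp add: card_cartesian_product)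
    moreover have "card W > 0" using finW subgroup.one_closed[OF Ws] card_gt_0_iff by blast
    ultimately show False using K2 by simp
  qed
  have finC: "finite C" unfolding C_def using finE by simp
  have "inj_on (\<lambda>f. restrict f B) C"
  proof (rule inj_onI)
    fix f g assume fg: "f \<in> C" "g \<in> C" "restrict f B = restrict g B"
    then have "f b = g b" if "b \<in> B" for b using that by (metis restrict_apply')
    then show "f = g" using Bd[OF fg(1,2)] WG CE fg by (intro End_eqI) auto
  qed
  moreover have "(\<lambda>f. restrict f B) ` C \<subseteq> B \<rightarrow>\<^sub>E carrier G" using CE End_closed B by (auto simp: PiE_iff)
  moreover have finB: "finite B" using finite_subset[OF B(1) fin] .
  ultimately have "card C \<le> card (B \<rightarrow>\<^sub>E carrier G)" using fin by (intro card_inj_on_le finite_PiE) auto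
  also have "\<dots> = card (carrier G) ^ card B" using finB by (simp add: card_funcsetE)
  also have "\<dots> \<le> card (carrier G) ^ s"
    using B(2) fin by (intro power_increasing) (auto simp: Suc_le_eq card_gt_0_iff)
  finally show thesis using that cW WG by simp
qed

lemma (in ring) subfield_gen:
  assumes K: "subfield K R" and fin: "finite K"
  obtains u where "u \<in> K" "\<And>k. k \<in> K \<Longrightarrow> k \<noteq> \<zero> \<Longrightarrow> \<exists>n::nat. k = u [^] n"
proof -
  interpret F: field "R\<lparr>carrier := K\<rparr>" using subfield_iff(2)[OF K] .
  have "finite (carrier (R\<lparr>carrier := K\<rparr>))" using fin by simp
  from F.finite_field_mult_group_has_gen[OF this] obtain u
    where u: "u \<in> K - {\<zero>}" "K - {\<zero>} = {u [^]\<^bsub>R\<lparr>carrier := K\<rparr>\<^esub> i | i::nat. i \<in> UNIV}"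
    by (auto simp: Multiplicative_Group.mult_of_simps)
  have "\<exists>n::nat. k = u [^] n" if "k \<in> K" "k \<noteq> \<zero>" for k
  proof -
    have "k \<in> K - {\<zero>}" using that by blast
    then show ?thesis unfolding u(2) using nat_pow_consistent[of u _ K] by auto
  qed
  then show thesis using that u(1) by blast
qed

lemma (in ring) prime_dvd_card_subfield:
  assumes K: "subfield K R" and fin: "finite K" and q: "Factorial_Ring.prime q"
    and c: "c \<in> K" "c \<noteq> \<one>" "c [^] (q::nat) = \<one>"
  shows "q dvd card K - 1"
proof -
  interpret F: field "R\<lparr>carrier := K\<rparr>" using subfield_iff(2)[OF K] .
  let ?M = "Multiplicative_Group.mult_of (R\<lparr>carrier := K\<rparr>)"
  interpret M: group ?M by (rule F.field_mult_group)
  have KR: "K \<subseteq> carrier R" using subfieldE(3)[OF K] .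
  have "\<one> \<noteq> \<zero>" using subfieldE(6)[OF K] .
  moreover have "\<zero> [^] q = \<zero>" using q by (simp add: nat_pow_zero prime_gt_0_nat)
  ultimately have c0: "c \<noteq> \<zero>" using c(3) by auto
  have cM: "c \<in> carrier ?M" using c(1) c0 by (simp add: Multiplicative_Group.mult_of_simps)
  have "c [^]\<^bsub>?M\<^esub> q = \<one>\<^bsub>?M\<^esub>"
    using c(3) nat_pow_consistent[of c q K] by (simp add: Multiplicative_Group.mult_of_simps)
  then have "M.ord c dvd q" using M.pow_eq_id[OF cM] by simp
  moreover have "M.ord c \<noteq> 1" using M.ord_eq_1[OF cM] c(2) by (simp add: Multiplicative_Group.mult_of_simps)
  ultimately have "M.ord c = q" using q prime_nat_iff by blast
  moreover have "M.ord c dvd order ?M"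
    using M.ord_dvd_group_order[OF cM] .
  moreover have "order ?M = card K - 1"
    using F.order_mult_of fin by (simp add: order_def)
  ultimately show ?thesis by simp
qed

context group_module
begin

definition Ker :: "'g set" where "Ker = {g \<in> carrier G. \<rho> g = \<one>\<^bsub>End V\<^esub>}"

lemma Ker_normal: "Ker \<lhd> G"
proof (rule normalI_conj)
  show "subgroup Ker G"
  proof (rule subgroupI)
    show "Ker \<subseteq> carrier G" by (auto simp: Ker_def)
    show "Ker \<noteq> {}" using rho_one by (auto simp: Ker_def)
    show "inv g \<in> Ker" if "g \<in> Ker" for g
    proof -
      have g: "g \<in> carrier G" "\<rho> g = \<one>\<^bsub>End V\<^esub>" using that by (simp_all add: Ker_def)
      have "\<rho> (inv g) = \<rho> (inv g) \<bullet> \<rho> g" unfolding g(2) using g(1) by simp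
      also have "\<dots> = \<one>\<^bsub>End V\<^esub>" by (rule rho_inv(1)[OF g(1)])
      finally show ?thesis using g by (simp add: Ker_def)
    qed
    show "g \<otimes> h \<in> Ker" if "g \<in> Ker" "h \<in> Ker" for g h
      using that rho_mult[of g h] by (simp add: Ker_def)
  qed
  show "g \<otimes> x \<otimes> inv g \<in> Ker" if g: "g \<in> carrier G" and x: "x \<in> Ker" for g x
  proof -
    have xc: "x \<in> carrier G" "\<rho> x = \<one>\<^bsub>End V\<^esub>" using x by (simp_all add: Ker_def)
    have "\<rho> (g \<otimes> x \<otimes> inv g) = \<rho> g \<bullet> \<rho> x \<bullet> \<rho> (inv g)" using g xc(1) by (simp only: rho_mult m_closed inv_closed)
    also have "\<dots> = \<one>\<^bsub>End V\<^esub>" unfolding xc(2) using g rho_inv by simp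
    finally show ?thesis using g xc by (simp add: Ker_def)
  qed
qed

lemma rho_cancel:
  assumes "h \<in> carrier G" "f \<in> carrier (End V)" "f \<bullet> \<rho> h = \<rho> h"
  shows "f = \<one>\<^bsub>End V\<^esub>"
proof -
  have "f = f \<bullet> (\<rho> h \<bullet> \<rho> (inv h))" by (simp only: rho_inv(2)[OF assms(1)] R.r_one[OF assms(2)])
  also have "\<dots> = (f \<bullet> \<rho> h) \<bullet> \<rho> (inv h)" using assms(1,2) by (simp only: R.m_assoc rho_closed inv_closed)
  also have "\<dots> = \<one>\<^bsub>End V\<^esub>" unfolding assms(3) by (rule rho_inv(2)[OF assms(1)])
  finally show ?thesis .
qed

lemma rho_commute_iff:
  assumes "g \<in> carrier G" "h \<in> carrier G"
  shows "\<rho> g \<bullet> \<rho> h = \<rho> h \<bullet> \<rho> g \<longleftrightarrow> cmt G g h \<in> Ker"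
proof -
  have e: "\<rho> g \<bullet> \<rho> h = \<rho> (cmt G g h) \<bullet> \<rho> (h \<otimes> g)"
    using mult_eq_cmt_mult[OF assms] assms by (simp only: rho_mult[symmetric] m_closed cmt_closed)
  show ?thesis
  proof
    assume "\<rho> g \<bullet> \<rho> h = \<rho> h \<bullet> \<rho> g"
    then have "\<rho> (cmt G g h) \<bullet> \<rho> (h \<otimes> g) = \<rho> (h \<otimes> g)" using e assms by (simp only: rho_mult)
    then have "\<rho> (cmt G g h) = \<one>\<^bsub>End V\<^esub>" using assms by (intro rho_cancel[of "h \<otimes> g"]) auto
    then show "cmt G g h \<in> Ker" using assms by (simp add: Ker_def)
  next
    assume "cmt G g h \<in> Ker"
    then have "\<rho> (cmt G g h) = \<one>\<^bsub>End V\<^esub>" unfolding Ker_def by blast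
    then have "\<rho> g \<bullet> \<rho> h = \<rho> (h \<otimes> g)" unfolding e using assms by simp
    then show "\<rho> g \<bullet> \<rho> h = \<rho> h \<bullet> \<rho> g" using assms by (simp only: rho_mult)
  qed
qed

lemma commuting_iff: "A \<subseteq> carrier G \<Longrightarrow> commuting A \<longleftrightarrow> A \<subseteq> cent_mod Ker A"
  using rho_commute_iff unfolding commuting_def cent_mod_def by blast

lemma derived_centralizes:
  assumes A: "A \<lhd> G" and c: "commuting A" and K: "subfield (env A) (End V)"
  shows "derived G (carrier G) \<subseteq> cent_mod Ker A"
proof -
  let ?E = "End V"
  note env = env_facts[OF A c]
  have Ac: "A \<subseteq> carrier G" using normal_subset[OF A] .
  have KE: "k \<in> carrier ?E" if "k \<in> env A" for k using subfieldE(3)[OF K] that by blast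
  have finK: "finite (env A)" using finite_subset[OF subfieldE(3)[OF K] V.End_finite[OF finV]] .
  obtain u where u: "u \<in> env A" "\<And>k. k \<in> env A \<Longrightarrow> k \<noteq> \<zero>\<^bsub>?E\<^esub> \<Longrightarrow> \<exists>n::nat. k = u [^]\<^bsub>?E\<^esub> n"
    using R.subfield_gen[OF K finK] by blast
  note sK = env(3) and sE = KE[OF env(3)]
  have exp: "\<exists>n::nat. \<sigma> g u = u [^]\<^bsub>?E\<^esub> n" if "g \<in> carrier G" "u \<noteq> \<zero>\<^bsub>?E\<^esub>" for g
  proof (rule u(2)[OF sK[OF that(1) u(1)]])
    show "\<sigma> g u \<noteq> \<zero>\<^bsub>?E\<^esub>"
    proof
      assume "\<sigma> g u = \<zero>\<^bsub>?E\<^esub>"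
      then have "\<sigma> (inv g) (\<sigma> g u) = \<zero>\<^bsub>?E\<^esub>" using sigma_zero that by simp
      then show False using sigma_comp[of "inv g" g u] sigma_id[of u] that KE[OF u(1)] by simp
    qed
  qed
  \<comment> \<open>Conjugations send u to powers of u, and power maps commute. The zero case is
    separate since \<open>subfield_gen\<close> does not record u \<noteq> 0.\<close>
  have comm_u: "\<sigma> g (\<sigma> h u) = \<sigma> h (\<sigma> g u)" if gh: "g \<in> carrier G" "h \<in> carrier G" for g h
  proof (cases "u = \<zero>\<^bsub>?E\<^esub>")
    case True
    then show ?thesis using sigma_zero gh by simp
  next
    case False
    obtain m n where mn: "\<sigma> g u = u [^]\<^bsub>?E\<^esub> (m::nat)" "\<sigma> h u = u [^]\<^bsub>?E\<^esub> (n::nat)" using exp False gh by metis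
    have "\<sigma> g (\<sigma> h u) = u [^]\<^bsub>?E\<^esub> (m * n)" using mn sigma_pow[OF gh(1) KE[OF u(1)]] KE[OF u(1)] by (simp add: R.nat_pow_pow)
    moreover have "\<sigma> h (\<sigma> g u) = u [^]\<^bsub>?E\<^esub> (n * m)" using mn sigma_pow[OF gh(2) KE[OF u(1)]] KE[OF u(1)] by (simp add: R.nat_pow_pow)
    ultimately show ?thesis by (simp add: mult.commute)
  qed
  have comm: "\<sigma> g (\<sigma> h k) = \<sigma> h (\<sigma> g k)" if gh: "g \<in> carrier G" "h \<in> carrier G" and k: "k \<in> env A" for g h k
  proof (cases "k = \<zero>\<^bsub>?E\<^esub>")
    case True
    then show ?thesis using sigma_zero gh by simp
  next
    case False
    then obtain n where n: "k = u [^]\<^bsub>?E\<^esub> (n::nat)" using u(2) k by blast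
    have "\<sigma> g (\<sigma> h k) = (\<sigma> g (\<sigma> h u)) [^]\<^bsub>?E\<^esub> n" "\<sigma> h (\<sigma> g k) = (\<sigma> h (\<sigma> g u)) [^]\<^bsub>?E\<^esub> n"
      unfolding n using sigma_pow gh KE sK u(1) by simp_all
    then show ?thesis using comm_u[OF gh] by simp
  qed
  show ?thesis
  proof (rule derived_subsetI[OF subgroup_cent_mod[OF Ker_normal Ac]])
    fix g h assume gh: "g \<in> carrier G" "h \<in> carrier G"
    have "cmt G (cmt G g h) a \<in> Ker" if a: "a \<in> A" for a
    proof -
      have ac: "a \<in> carrier G" using a Ac by blast
      \<comment> \<open>Chosen so that h g carries it to \<open>\<rho> a\<close>. As g h and h g act
        alike and g h = [g,h] h g, the commutator fixes \<open>\<rho> a\<close>.\<close>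
      let ?k = "\<sigma> (inv (h \<otimes> g)) (\<rho> a)"
      have aK: "\<rho> a \<in> env A" using env(2) a by blast
      have kK: "?k \<in> env A" using sK aK gh by simp
      have "\<sigma> (h \<otimes> g) ?k = \<rho> a" using sigma_comp[of "h \<otimes> g" "inv (h \<otimes> g)"] sigma_id gh ac by simp
      moreover have "\<sigma> (g \<otimes> h) ?k = \<sigma> (h \<otimes> g) ?k" using sigma_comp gh comm[OF gh kK] KE[OF kK] by simp
      moreover have "\<sigma> (g \<otimes> h) ?k = \<sigma> (cmt G g h) (\<sigma> (h \<otimes> g) ?k)"
        using sigma_comp[of "cmt G g h" "h \<otimes> g" ?k] mult_eq_cmt_mult[OF gh] gh KE[OF kK] by simp
      ultimately have e: "\<sigma> (cmt G g h) (\<rho> a) = \<rho> a" by simp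
      have cc: "cmt G g h \<in> carrier G" using gh by simp
      have "\<rho> (cmt G g h) \<bullet> \<rho> a = \<rho> (cmt G g h) \<bullet> \<rho> a \<bullet> (\<rho> (inv (cmt G g h)) \<bullet> \<rho> (cmt G g h))"
        using rho_inv(1)[OF cc] cc ac by simp
      also have "\<dots> = \<sigma> (cmt G g h) (\<rho> a) \<bullet> \<rho> (cmt G g h)"
        using cc ac by (simp only: \<sigma>_def R.m_assoc R.m_closed rho_closed inv_closed)
      finally have "\<rho> (cmt G g h) \<bullet> \<rho> a = \<rho> a \<bullet> \<rho> (cmt G g h)" using e by simp
      then show ?thesis using rho_commute_iff[OF cc ac] by blast
    qed
    then show "cmt G g h \<in> cent_mod Ker A" using gh by (simp add: cent_mod_def)
  qed
qed

end

section \<open>A substitute for the three subgroups lemma\<close>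

context group
begin

text \<open>Conjugation by g h takes x to [h,x] [g,x] x, since g commutes with [h,x]; the last
  hypothesis makes this symmetric in g and h.\<close>

lemma conj_swap:
  assumes c: "g \<in> carrier G" "h \<in> carrier G" "x \<in> carrier G"
    and "g \<otimes> cmt G h x = cmt G h x \<otimes> g" "h \<otimes> cmt G g x = cmt G g x \<otimes> h"
    and "cmt G h x \<otimes> cmt G g x = cmt G g x \<otimes> cmt G h x"
  shows "(g \<otimes> h) \<otimes> x \<otimes> inv (g \<otimes> h) = (h \<otimes> g) \<otimes> x \<otimes> inv (h \<otimes> g)"
proof -
  have *: "(a \<otimes> b) \<otimes> x \<otimes> inv (a \<otimes> b) = cmt G b x \<otimes> (cmt G a x \<otimes> x)"
    if ab: "a \<in> carrier G" "b \<in> carrier G" and cm: "a \<otimes> cmt G b x = cmt G b x \<otimes> a" for a b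
  proof -
    have "(a \<otimes> b) \<otimes> x \<otimes> inv (a \<otimes> b) = a \<otimes> (b \<otimes> x \<otimes> inv b) \<otimes> inv a"
      using ab c(3) by (simp add: inv_mult_group m_assoc)
    also have "\<dots> = (a \<otimes> cmt G b x) \<otimes> x \<otimes> inv a"
      unfolding conj_eq_cmt_mult[OF ab(2) c(3)] using ab c(3) by (simp add: m_assoc)
    also have "\<dots> = cmt G b x \<otimes> (a \<otimes> x \<otimes> inv a)" unfolding cm using ab c(3) by (simp add: m_assoc)
    also have "\<dots> = cmt G b x \<otimes> (cmt G a x \<otimes> x)" using conj_eq_cmt_mult[OF ab(1) c(3)] by simp
    finally show ?thesis .
  qed
  have "cmt G h x \<otimes> (cmt G g x \<otimes> x) = cmt G g x \<otimes> (cmt G h x \<otimes> x)"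
    using c assms(6) by (simp flip: m_assoc)
  then show ?thesis using *[OF c(1,2) assms(4)] *[OF c(2,1) assms(5)] by simp
qed

lemma rcoset_commute_iff:
  assumes N: "N \<lhd> G" and c: "x \<in> carrier G" "y \<in> carrier G"
  shows "N #> (x \<otimes> y) = N #> (y \<otimes> x) \<longleftrightarrow> cmt G x y \<in> N"
  using c rcoset_eq_iff[OF normal_imp_subgroup[OF N], of "x \<otimes> y" "y \<otimes> x"]
  by (simp add: cmt_def inv_mult_group m_assoc)

text \<open>Modulo N, conjugations by g h and h g agree on L, and g h = [g,h] h g. The form for
  single elements fits both uses: the passage from A and L/A to L, and the doubling steps along a
  chief series.\<close>

lemma cmt_mem_cent_mod:
  assumes N: "N \<lhd> G" and L: "L \<lhd> G" and gh: "g \<in> carrier G" "h \<in> carrier G"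
    and cm: "\<And>x. x \<in> L \<Longrightarrow> cmt G g (cmt G h x) \<in> N" "\<And>x. x \<in> L \<Longrightarrow> cmt G h (cmt G g x) \<in> N"
      "\<And>x. x \<in> L \<Longrightarrow> cmt G (cmt G h x) (cmt G g x) \<in> N"
  shows "cmt G g h \<in> cent_mod N L"
proof -
  let ?Q = "G Mod N" and ?p = "\<lambda>x. N #> x"
  interpret N: normal N G by (rule N)
  interpret Q: group ?Q by (rule N.factorgroup_is_group)
  interpret p: group_hom G ?Q ?p
    by (simp add: group_hom_def group_hom_axioms_def is_group Q.is_group N.r_coset_hom_Mod)
  have Lc: "x \<in> carrier G" if "x \<in> L" for x using normal_mem_carrier[OF L that] .
  have pc: "?p (cmt G x y) = cmt ?Q (?p x) (?p y)" if "x \<in> carrier G" "y \<in> carrier G" for x y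
    unfolding cmt_def using that by (simp only: p.hom_mult p.hom_inv m_closed inv_closed)
  have comm: "?p x \<otimes>\<^bsub>?Q\<^esub> ?p y = ?p y \<otimes>\<^bsub>?Q\<^esub> ?p x" if "x \<in> carrier G" "y \<in> carrier G" "cmt G x y \<in> N" for x y
    using rcoset_commute_iff[OF N that(1,2)] that(3) p.hom_mult[OF that(1,2)] p.hom_mult[OF that(2,1)] by metis
  have swap: "?p ((g \<otimes> h) \<otimes> x \<otimes> inv (g \<otimes> h)) = ?p ((h \<otimes> g) \<otimes> x \<otimes> inv (h \<otimes> g))" if x: "x \<in> L" for x
  proof -
    have xc: "x \<in> carrier G" using Lc x .
    have cc: "cmt G h x \<in> carrier G" "cmt G g x \<in> carrier G" using gh xc by auto
    have "(?p g \<otimes>\<^bsub>?Q\<^esub> ?p h) \<otimes>\<^bsub>?Q\<^esub> ?p x \<otimes>\<^bsub>?Q\<^esub> inv\<^bsub>?Q\<^esub> (?p g \<otimes>\<^bsub>?Q\<^esub> ?p h)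
      = (?p h \<otimes>\<^bsub>?Q\<^esub> ?p g) \<otimes>\<^bsub>?Q\<^esub> ?p x \<otimes>\<^bsub>?Q\<^esub> inv\<^bsub>?Q\<^esub> (?p h \<otimes>\<^bsub>?Q\<^esub> ?p g)"
    proof (rule Q.conj_swap)
      show "?p g \<in> carrier ?Q" "?p h \<in> carrier ?Q" "?p x \<in> carrier ?Q" using gh xc p.hom_closed by blast+
      show "?p g \<otimes>\<^bsub>?Q\<^esub> cmt ?Q (?p h) (?p x) = cmt ?Q (?p h) (?p x) \<otimes>\<^bsub>?Q\<^esub> ?p g"
        using comm[OF gh(1) cc(1) cm(1)[OF x]] unfolding pc[OF gh(2) xc] .
      show "?p h \<otimes>\<^bsub>?Q\<^esub> cmt ?Q (?p g) (?p x) = cmt ?Q (?p g) (?p x) \<otimes>\<^bsub>?Q\<^esub> ?p h"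
        using comm[OF gh(2) cc(2) cm(2)[OF x]] unfolding pc[OF gh(1) xc] .
      show "cmt ?Q (?p h) (?p x) \<otimes>\<^bsub>?Q\<^esub> cmt ?Q (?p g) (?p x) = cmt ?Q (?p g) (?p x) \<otimes>\<^bsub>?Q\<^esub> cmt ?Q (?p h) (?p x)"
        using comm[OF cc cm(3)[OF x]] unfolding pc[OF gh(1) xc] pc[OF gh(2) xc] .
    qed
    then show ?thesis using gh xc by (simp only: p.hom_mult p.hom_inv m_closed inv_closed)
  qed
  let ?c = "cmt G g h" and ?w = "h \<otimes> g"
  have "cmt G ?c x \<in> N" if x: "x \<in> L" for x
  proof -
    have xc: "x \<in> carrier G" using Lc x .
    let ?y = "inv ?w \<otimes> x \<otimes> inv (inv ?w)"
    have y: "?y \<in> L" using normal_conj[OF L _ x, of "inv ?w"] gh by blast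
    have "?c \<otimes> x \<otimes> inv ?c = (g \<otimes> h) \<otimes> ?y \<otimes> inv (g \<otimes> h)"
      using gh xc by (simp add: cmt_def inv_mult_group m_assoc)
    moreover have "?w \<otimes> ?y \<otimes> inv ?w = x" using gh xc by (simp add: inv_mult_group m_assoc)
    ultimately have "?p (?c \<otimes> x \<otimes> inv ?c) = ?p x" using swap[OF y] by simp
    then show ?thesis
      using rcoset_eq_iff[OF normal_imp_subgroup[OF N], of "?c \<otimes> x \<otimes> inv ?c" x] gh xc by (simp add: cmt_def)
  qed
  then show ?thesis using gh by (simp add: cent_mod_def)
qed

end

section \<open>A maximal normal subgroup acting through a field\<close>

locale primitive_group_module = group_module +
  fixes A :: "'a set"
  assumes solv: "solvable G" and A: "A \<lhd> G" and cA: "commuting A"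
    and K: "subfield (env A) (End V)"
    and maxA: "\<And>B. B \<lhd> G \<Longrightarrow> commuting B \<Longrightarrow> A \<subseteq> B \<Longrightarrow> B = A"
begin

lemma A_carrier: "a \<in> A \<Longrightarrow> a \<in> carrier G"
  using normal_mem_carrier[OF A] .

lemma A_commute: "A \<subseteq> cent_mod Ker A"
  using commuting_iff[of A] cA A_carrier by blast

lemma env_closed: "k \<in> env A \<Longrightarrow> k \<in> carrier (End V)"
  using subfieldE(3)[OF K] by blast

lemma env_cent_commute:
  assumes "g \<in> cent_mod Ker A" "k \<in> env A"
  shows "\<rho> g \<bullet> k = k \<bullet> \<rho> g"
proof (rule env_facts(4)[OF A cA _ _ assms(2)])
  have g: "g \<in> carrier G" using assms(1) by (simp add: cent_mod_def)
  then show "\<rho> g \<in> carrier (End V)" by simp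
  show "\<rho> g \<bullet> \<rho> a = \<rho> a \<bullet> \<rho> g" if "a \<in> A" for a
    using rho_commute_iff[OF g A_carrier[OF that]] assms(1) that by (simp add: cent_mod_def)
qed

text \<open>The product of A and B again acts through an abelian group, so the maximality of A
  applies to it.\<close>

lemma normal_sub_A:
  assumes "B \<lhd> G" "commuting B" "B \<subseteq> cent_mod Ker A"
  shows "B \<subseteq> A"
proof -
  have Bc: "B \<subseteq> carrier G" and Ac: "A \<subseteq> carrier G"
    using normal_subset[OF assms(1)] A_carrier by auto
  let ?P = "A <#> B"
  have P: "?P \<lhd> G" "A \<subseteq> ?P" "B \<subseteq> ?P"
    using normal_set_mult[OF A assms(1)] subgroup_set_mult[OF A normal_imp_subgroup[OF assms(1)]] by auto
  have Pc: "?P \<subseteq> carrier G" using normal_subset[OF P(1)] .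
  note sub = subgroup_cent_mod[OF Ker_normal]
  have AB: "A \<subseteq> cent_mod Ker B" using cent_mod_sym[OF Ker_normal Bc Ac assms(3)] .
  have "B \<subseteq> cent_mod Ker B" using commuting_iff[OF Bc] assms(2) by blast
  then have "?P \<subseteq> cent_mod Ker B" using set_mult_subset[OF sub[OF Bc]] AB by blast
  then have 1: "B \<subseteq> cent_mod Ker ?P" using cent_mod_sym[OF Ker_normal Pc Bc] by blast
  have "?P \<subseteq> cent_mod Ker A" using set_mult_subset[OF sub[OF Ac] A_commute assms(3)] .
  then have "A \<subseteq> cent_mod Ker ?P" using cent_mod_sym[OF Ker_normal Pc Ac] by blast
  then have "?P \<subseteq> cent_mod Ker ?P" using set_mult_subset[OF sub[OF Pc]] 1 by blast
  then have "?P = A" using maxA[OF P(1) _ P(2)] commuting_iff[OF Pc] by blast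
  then show ?thesis using P(3) by simp
qed

lemma derived_sub_C: "derived G (carrier G) \<subseteq> cent_mod Ker A"
  using derived_centralizes[OF A cA K] .

context
  fixes L :: "'a set"
  assumes ch: "chief_factor G A L" and LC: "L \<subseteq> cent_mod Ker A"
begin

lemma L_normal: "L \<lhd> G" and A_sub_L: "A \<subset> L"
  using ch by (auto simp: chief_factor_def)

lemma L_sub: "subgroup L G" using normal_imp_subgroup[OF L_normal] .

lemma L_carrier: "x \<in> L \<Longrightarrow> x \<in> carrier G"
  using subgroup.mem_carrier[OF L_sub] .

lemma L_not_commuting: "\<not> commuting L"
  using maxA[OF L_normal] A_sub_L by blast

lemma cmt_L: "x \<in> L \<Longrightarrow> y \<in> L \<Longrightarrow> cmt G x y \<in> A"
  using chief_factor_abelian[OF ch solv] cmt_mem_derived by blast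

text \<open>The center of L modulo \<open>Ker\<close> is normal in G and acts through an abelian
  group, so \<open>normal_sub_A\<close> confines it to A. This is what makes the commutator pairing
  on L/A nondegenerate.\<close>

lemma center_L: "L \<inter> cent_mod Ker L = A"
proof
  have Z: "L \<inter> cent_mod Ker L \<lhd> G"
    using normal_subgroup_intersect[OF L_normal normal_cent_mod[OF Ker_normal L_normal]] .
  have Zc: "L \<inter> cent_mod Ker L \<subseteq> carrier G" using subgroup.subset[OF L_sub] by blast
  have "L \<inter> cent_mod Ker L \<subseteq> cent_mod Ker (L \<inter> cent_mod Ker L)" by (auto simp: cent_mod_def)
  then have "commuting (L \<inter> cent_mod Ker L)" using commuting_iff[OF Zc] by blast
  then show "L \<inter> cent_mod Ker L \<subseteq> A" using normal_sub_A[OF Z] LC by blast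
  have "A \<subseteq> cent_mod Ker L"
    using cent_mod_sym[OF Ker_normal subgroup.subset[OF L_sub] _ LC] A_carrier by blast
  then show "A \<subseteq> L \<inter> cent_mod Ker L" using A_sub_L by blast
qed

text \<open>Commutators of L act as scalars from \<open>env A\<close>, which commute with L. If
  [x,y] and [x,z] acted alike for every x, then y z^-1 would commute with L modulo
  \<open>Ker\<close> and lie in A by \<open>center_L\<close>.\<close>

lemma cmt_separates:
  assumes "y \<in> L" "z \<in> L" "y \<otimes> inv z \<notin> A"
  shows "\<exists>x\<in>L. \<rho> (cmt G x y) \<noteq> \<rho> (cmt G x z)"
proof (rule ccontr)
  assume "\<not> ?thesis"
  then have eq: "\<rho> (cmt G x y) = \<rho> (cmt G x z)" if "x \<in> L" for x using that by blast
  have c: "y \<in> carrier G" "z \<in> carrier G" using assms L_carrier by auto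
  have yz: "y \<otimes> inv z \<in> L" using assms L_sub by (simp add: subgroup.m_closed subgroup.m_inv_closed)
  have "cmt G (y \<otimes> inv z) x \<in> Ker" if x: "x \<in> L" for x
  proof -
    have xc: "x \<in> carrier G" using x L_carrier by blast
    let ?c = "\<rho> (cmt G x z)"
    have cE: "?c \<in> env A" using env_facts(2)[OF A cA] cmt_L[OF x assms(2)] by blast
    have e: "\<rho> x \<bullet> \<rho> t = \<rho> (cmt G x t) \<bullet> \<rho> t \<bullet> \<rho> x" if "t \<in> L" for t
      using arg_cong[OF mult_eq_cmt_mult[OF xc L_carrier[OF that]], of \<rho>] xc L_carrier[OF that]
      by (simp only: rho_mult R.m_assoc rho_closed m_closed cmt_closed)
    have y: "\<rho> x \<bullet> \<rho> y = ?c \<bullet> \<rho> y \<bullet> \<rho> x" using e[OF assms(1)] eq[OF x] by simp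
    have z: "\<rho> x \<bullet> \<rho> z = ?c \<bullet> \<rho> z \<bullet> \<rho> x" using e[OF assms(2)] .
    have zi: "inv z \<in> L" using subgroup.m_inv_closed[OF L_sub assms(2)] .
    have ccom: "?c \<bullet> \<rho> t = \<rho> t \<bullet> ?c" if "t \<in> L" for t using env_cent_commute[OF _ cE] LC that by (simp add: subset_iff)
    let ?d = "\<rho> (y \<otimes> inv z)"
    have dE: "?d \<in> carrier (End V)" "\<rho> x \<in> carrier (End V)" "\<rho> y \<in> carrier (End V)" "\<rho> z \<in> carrier (End V)" "?c \<in> carrier (End V)"
      "\<rho> (inv z) \<in> carrier (End V)"
      using c xc env_closed[OF cE] by auto
    have dz: "?d \<bullet> \<rho> z = \<rho> y" using c by (simp only: rho_mult[symmetric] m_closed inv_closed) (simp add: m_assoc)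
    have "(\<rho> x \<bullet> ?d) \<bullet> \<rho> z = ?c \<bullet> \<rho> y \<bullet> \<rho> x" using y dz dE by (simp only: R.m_assoc)
    also have "\<dots> = ?d \<bullet> (?c \<bullet> \<rho> z) \<bullet> \<rho> x"
      unfolding dz[symmetric] using dE ccom[OF yz] by (simp only: R.m_assoc[symmetric] R.m_closed)
    also have "\<dots> = ?d \<bullet> (\<rho> x \<bullet> \<rho> z)" using z dE by (simp only: R.m_assoc R.m_closed)
    finally have *: "(\<rho> x \<bullet> ?d) \<bullet> \<rho> z = (?d \<bullet> \<rho> x) \<bullet> \<rho> z" using dE by (simp only: R.m_assoc)
    have "\<rho> x \<bullet> ?d = ((\<rho> x \<bullet> ?d) \<bullet> \<rho> z) \<bullet> \<rho> (inv z)"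
      using dE rho_inv(2)[OF c(2)] by (simp only: R.m_assoc R.m_closed R.r_one)
    also have "\<dots> = ?d \<bullet> \<rho> x" unfolding * using dE rho_inv(2)[OF c(2)] by (simp only: R.m_assoc R.m_closed R.r_one)
    finally show ?thesis using rho_commute_iff[of "y \<otimes> inv z" x] c xc by simp
  qed
  then have "y \<otimes> inv z \<in> L \<inter> cent_mod Ker L" using yz L_carrier by (simp add: cent_mod_def)
  then show False using center_L assms(3) by blast
qed

text \<open>For noncommuting x, y in L the commutator acts as a scalar c \<noteq> 1, and conjugation
  by x multiplies \<open>\<rho> y\<close> by c. Since y ^ q lies in A, its operator commutes with
  that of x, so c ^ q = 1.\<close>

lemma prime_dvd_env:
  assumes q: "Factorial_Ring.prime q" and pow: "\<And>x. x \<in> L \<Longrightarrow> x [^] q \<in> A"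
  shows "q dvd card (env A) - 1"
proof -
  have finK: "finite (env A)" using finite_subset[OF subfieldE(3)[OF K] V.End_finite[OF finV]] .
  obtain x y where xy: "x \<in> L" "y \<in> L" "\<rho> x \<bullet> \<rho> y \<noteq> \<rho> y \<bullet> \<rho> x"
    using L_not_commuting unfolding commuting_def by blast
  have c: "x \<in> carrier G" "y \<in> carrier G" using xy L_carrier by auto
  let ?c = "\<rho> (cmt G x y)"
  have cK: "?c \<in> env A" using env_facts(2)[OF A cA] cmt_L[OF xy(1,2)] by blast
  have E: "?c \<in> carrier (End V)" "\<rho> x \<in> carrier (End V)" "\<rho> y \<in> carrier (End V)" "\<rho> (inv x) \<in> carrier (End V)"
    using c by auto
  have "cmt G x y \<notin> Ker" using xy(3) rho_commute_iff[OF c] by blast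
  then have c1: "?c \<noteq> \<one>\<^bsub>End V\<^esub>" using c by (simp add: Ker_def)
  have rp: "\<rho> (g [^] n) = \<rho> g [^]\<^bsub>End V\<^esub> n" if "g \<in> carrier G" for g and n :: nat
  proof (induction n)
    case 0
    then show ?case using rho_one by simp
  next
    case (Suc n)
    have "\<rho> (g [^] Suc n) = \<rho> (g [^] n) \<bullet> \<rho> g" using that by (simp only: nat_pow_Suc rho_mult nat_pow_closed)
    then show ?case by (simp only: Suc.IH nat_pow_Suc R.nat_pow_Suc)
  qed
  have conj: "\<rho> x \<bullet> \<rho> y \<bullet> \<rho> (inv x) = ?c \<bullet> \<rho> y"
    using conj_eq_cmt_mult[OF c] c by (simp only: rho_mult[symmetric] m_closed inv_closed cmt_closed)
  have conjp: "\<rho> x \<bullet> (\<rho> y [^]\<^bsub>End V\<^esub> n) \<bullet> \<rho> (inv x) = (?c \<bullet> \<rho> y) [^]\<^bsub>End V\<^esub> n" for n :: nat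
  proof (induction n)
    case 0
    then show ?case using E rho_inv(2)[OF c(1)] by (simp del: restrict_apply)
  next
    case (Suc n)
    have "\<rho> x \<bullet> (\<rho> y [^]\<^bsub>End V\<^esub> Suc n) \<bullet> \<rho> (inv x)
      = \<rho> x \<bullet> (\<rho> y [^]\<^bsub>End V\<^esub> n) \<bullet> (\<rho> (inv x) \<bullet> \<rho> x) \<bullet> \<rho> y \<bullet> \<rho> (inv x)"
      unfolding rho_inv(1)[OF c(1)] using E by (simp add: R.m_assoc del: restrict_apply)
    also have "\<dots> = (\<rho> x \<bullet> (\<rho> y [^]\<^bsub>End V\<^esub> n) \<bullet> \<rho> (inv x)) \<bullet> (\<rho> x \<bullet> \<rho> y \<bullet> \<rho> (inv x))"
      using E by (simp only: R.m_assoc R.m_closed R.nat_pow_closed)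
    finally show ?case unfolding Suc conj by (simp del: restrict_apply)
  qed
  have ccom: "?c \<bullet> \<rho> y = \<rho> y \<bullet> ?c" using env_cent_commute[OF _ cK] LC xy(2) by (simp add: subset_iff)
  have yq: "y [^] q \<in> A" using pow xy(2) by blast
  have yqc: "y [^] q \<in> carrier G" using c by simp
  have yE: "\<rho> (y [^] q) \<in> carrier (End V)" using yqc by simp
  have "\<rho> x \<bullet> \<rho> (y [^] q) = \<rho> (y [^] q) \<bullet> \<rho> x"
    using env_cent_commute[of x "\<rho> (y [^] q)"] LC xy(1) yq env_facts(2)[OF A cA] by blast
  then have "\<rho> x \<bullet> \<rho> (y [^] q) \<bullet> \<rho> (inv x) = \<rho> (y [^] q)"
    using E yE rho_inv(2)[OF c(1)] by (simp add: R.m_assoc del: restrict_apply)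
  then have "?c [^]\<^bsub>End V\<^esub> q \<bullet> \<rho> (y [^] q) = \<rho> (y [^] q)"
    using conjp[of q] R.pow_mult_distrib[OF ccom E(1,3)] rp[OF c(2), of q] by metis
  then have "?c [^]\<^bsub>End V\<^esub> q = \<one>\<^bsub>End V\<^esub>" using rho_cancel[OF yqc] E(1) by simp
  then show ?thesis using R.prime_dvd_card_subfield[OF K finK q cK c1] by blast
qed

text \<open>The term j + 1 acts trivially on L/A and on A, and commutators of such elements act
  trivially on L. The index is j + 1 rather than j because A is centralized only from the first
  derived subgroup on.\<close>

lemma derived_cent_L:
  assumes "(derived G ^^ j) (carrier G) \<subseteq> cent_mod A L"
  shows "(derived G ^^ (j + 2)) (carrier G) \<subseteq> cent_mod Ker L"
proof -
  let ?D = "(derived G ^^ (j + 1)) (carrier G)"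
  have D1: "?D \<subseteq> cent_mod A L" using exp_of_derived_antimono[of j "j + 1"] assms by simp
  have D2: "?D \<subseteq> cent_mod Ker A" using exp_of_derived_antimono[of 1 "j + 1"] derived_sub_C by simp
  have "derived G ?D \<subseteq> cent_mod Ker L"
  proof (rule derived_subsetI[OF subgroup_cent_mod[OF Ker_normal subgroup.subset[OF L_sub]]])
    fix g h assume gh: "g \<in> ?D" "h \<in> ?D"
    have gA: "cmt G g x \<in> A" "cmt G h x \<in> A" if "x \<in> L" for x using gh D1 that by (auto simp: cent_mod_def)
    have gK: "cmt G g a \<in> Ker" "cmt G h a \<in> Ker" if "a \<in> A" for a using gh D2 that by (auto simp: cent_mod_def)
    have aK: "cmt G a b \<in> Ker" if "a \<in> A" "b \<in> A" for a b using A_commute that by (auto simp: cent_mod_def)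
    show "cmt G g h \<in> cent_mod Ker L"
      by (rule cmt_mem_cent_mod[OF Ker_normal L_normal]) (use gh D1 gA gK aK in \<open>auto simp: cent_mod_def\<close>)
  qed
  then show ?thesis by simp
qed

end

end

text \<open>Gives q ^ u <= s^2 < 3 ^ s <= |K| ^ s = |V|, so that the induction hypothesis covers the
  chief factor.\<close>

lemma square_less_three_power: "s\<^sup>2 < (3::nat) ^ s"
proof (induction s)
  case (Suc n)
  show ?case
  proof (cases "n \<le> 1")
    case True
    then have "n = 0 \<or> n = 1" by auto
    then show ?thesis by (auto simp: power2_eq_square)
  next
    case False
    then have "2 * n \<le> n * n" by simp
    moreover have "(Suc n)\<^sup>2 = n * n + 2 * n + 1" by (simp add: power2_eq_square)
    ultimately have "(Suc n)\<^sup>2 \<le> 3 * n\<^sup>2" using False by (simp only: power2_eq_square)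
    then show ?thesis using Suc by simp
  qed
qed simp

lemma (in group_module) rho_right_cancel:
  assumes h: "h \<in> carrier G" and fE: "f \<in> carrier (End V)" "f' \<in> carrier (End V)" and eq: "f \<bullet> \<rho> h = f' \<bullet> \<rho> h"
  shows "f = f'"
proof -
  have "f = (f \<bullet> \<rho> h) \<bullet> \<rho> (inv h)"
    using fE h by (simp only: R.m_assoc rho_closed inv_closed rho_inv(2) R.r_one)
  also have "\<dots> = f'"
    unfolding eq using fE h by (simp only: R.m_assoc rho_closed inv_closed rho_inv(2) R.r_one)
  finally show ?thesis .
qed

context primitive_group_module
begin

text \<open>The lines K \<open>\<rho> (t Q)\<close> are common eigenspaces of the conjugations by L,
  with commutators as eigenvalues. By \<open>cmt_separates\<close> different cosets have different
  eigenvalues for some x, so the lines are independent in the commutant of K.\<close>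

lemma env_power_card:
  assumes ch: "chief_factor G A L" and LC: "L \<subseteq> cent_mod Ker A"
  shows "card (env A) ^ card (carrier ((G\<lparr>carrier := L\<rparr>) Mod A)) \<le>
    card {f \<in> carrier (End V). \<forall>k\<in>env A. f \<bullet> k = k \<bullet> f}"
proof -
  let ?E = "End V"
  note Lc = L_carrier[OF ch LC]
  define CK where "CK = {f \<in> carrier ?E. \<forall>k\<in>env A. f \<bullet> k = k \<bullet> f}"
  define I where "I = carrier ((G\<lparr>carrier := L\<rparr>) Mod A)"
  have I: "I = (\<lambda>x. A #> x) ` L" by (simp add: I_def carrier_FactGroup)
  have "\<forall>Q\<in>I. \<exists>x. x \<in> L \<and> A #> x = Q" unfolding I by blast
  then obtain t where t: "\<And>Q. Q \<in> I \<Longrightarrow> t Q \<in> L" "\<And>Q. Q \<in> I \<Longrightarrow> A #> t Q = Q" by metis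
  have tc: "t Q \<in> carrier G" if "Q \<in> I" for Q using t(1)[OF that] Lc by blast
  have Kr: "subring (env A) ?E" using subfieldE(1)[OF K] .
  have Kcom: "k \<bullet> l = l \<bullet> k" if "k \<in> env A" "l \<in> env A" for k l using subfieldE(4)[OF K that] .
  have rhoL: "\<rho> x \<bullet> k = k \<bullet> \<rho> x" if "x \<in> L" "k \<in> env A" for x k using env_cent_commute that LC by blast
  \<comment> \<open>The counting lemma is applied to the additive group of the commutant, not to
    V.\<close>
  let ?W = "(add_monoid ?E)\<lparr>carrier := CK\<rparr>"
  have CE: "f \<in> carrier ?E" if "f \<in> CK" for f using that by (simp add: CK_def)
  have CKsub: "subgroup CK (add_monoid ?E)"
  proof (rule group.subgroupI[OF R.a_group])
    show "CK \<subseteq> carrier (add_monoid ?E)" using CE by auto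
    have "\<zero>\<^bsub>?E\<^esub> \<in> CK" using env_closed by (simp add: CK_def)
    then show "CK \<noteq> {}" by blast
    show "inv\<^bsub>add_monoid ?E\<^esub> f \<in> CK" if "f \<in> CK" for f
      using that env_closed unfolding a_inv_def[symmetric] by (simp add: CK_def R.l_minus R.r_minus)
    show "f \<otimes>\<^bsub>add_monoid ?E\<^esub> g \<in> CK" if "f \<in> CK" "g \<in> CK" for f g
      using that env_closed by (simp add: CK_def R.l_distr R.r_distr)
  qed
  interpret W: comm_group ?W
    using group.subgroup_imp_group[OF R.a_group CKsub] CE by (intro group.group_comm_groupI) (auto simp: R.a_comm)
  define U where "U Q = (\<lambda>k. k \<bullet> \<rho> (t Q)) ` env A" for Q
  have KCK: "k \<bullet> \<rho> x \<in> CK" if k: "k \<in> env A" and x: "x \<in> L" for k x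
  proof -
    have E: "k \<in> carrier ?E" "\<rho> x \<in> carrier ?E" using env_closed[OF k] Lc[OF x] by auto
    have "k \<bullet> \<rho> x \<bullet> l = l \<bullet> (k \<bullet> \<rho> x)" if l: "l \<in> env A" for l
    proof -
      have lE: "l \<in> carrier ?E" using env_closed[OF l] .
      have "k \<bullet> \<rho> x \<bullet> l = k \<bullet> (l \<bullet> \<rho> x)" using E lE rhoL[OF x l] by (simp only: R.m_assoc)
      also have "\<dots> = (l \<bullet> k) \<bullet> \<rho> x" using E lE Kcom[OF k l] by (simp only: R.m_assoc[symmetric])
      finally show ?thesis using E lE by (simp only: R.m_assoc)
    qed
    then show ?thesis using E by (simp add: CK_def)
  qed
  have Usub: "subgroup (U Q) ?W" if Q: "Q \<in> I" for Q
  proof -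
    have E: "\<rho> (t Q) \<in> carrier ?E" using tc[OF Q] by simp
    have "subgroup (U Q) (add_monoid ?E)"
    proof (rule group.subgroupI[OF R.a_group])
      show "U Q \<subseteq> carrier (add_monoid ?E)" using E env_closed by (auto simp: U_def simp del: restrict_apply)
      show "U Q \<noteq> {}" using subringE(2)[OF Kr] by (auto simp: U_def)
      fix f assume "f \<in> U Q"
      then obtain k where k: "k \<in> env A" "f = k \<bullet> \<rho> (t Q)" by (auto simp: U_def)
      have "inv\<^bsub>add_monoid ?E\<^esub> f = (\<ominus>\<^bsub>?E\<^esub> k) \<bullet> \<rho> (t Q)"
        unfolding a_inv_def[symmetric] k(2) using env_closed[OF k(1)] E by (simp only: R.l_minus)
      then show "inv\<^bsub>add_monoid ?E\<^esub> f \<in> U Q" using subringE(5)[OF Kr k(1)] unfolding U_def by blast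
      fix g assume "g \<in> U Q"
      then obtain l where l: "l \<in> env A" "g = l \<bullet> \<rho> (t Q)" by (auto simp: U_def)
      have "f \<otimes>\<^bsub>add_monoid ?E\<^esub> g = (k \<oplus>\<^bsub>?E\<^esub> l) \<bullet> \<rho> (t Q)"
        unfolding k(2) l(2) using env_closed[OF k(1)] env_closed[OF l(1)] E by (simp add: R.l_distr del: restrict_apply)
      then show "f \<otimes>\<^bsub>add_monoid ?E\<^esub> g \<in> U Q" using subringE(7)[OF Kr k(1) l(1)] unfolding U_def by blast
    qed
    moreover have "U Q \<subseteq> CK" unfolding U_def using KCK t(1)[OF Q] by blast
    ultimately show ?thesis using group.subgroup_incl[OF R.a_group] CKsub by blast
  qed
  have finL: "finite L" using finite_subset[OF subgroup.subset[OF L_sub[OF ch LC]] finG] .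
  have sep: "separated ?W I U"
    unfolding separated_def
  proof (intro conjI ballI impI)
    show "finite I" unfolding I using finL by blast
    show "subgroup (U Q) ?W" if "Q \<in> I" for Q using Usub[OF that] .
    fix Q Z assume QZ: "Q \<in> I" "Z \<in> I" "Q \<noteq> Z"
    have "A #> t Z \<noteq> A #> t Q" using t(2)[OF QZ(1)] t(2)[OF QZ(2)] QZ(3) by simp
    then have "t Z \<otimes> inv t Q \<notin> A"
      using rcoset_eq_iff[OF normal_imp_subgroup[OF A] tc[OF QZ(2)] tc[OF QZ(1)]] by blast
    then obtain x where x: "x \<in> L" "\<rho> (cmt G x (t Z)) \<noteq> \<rho> (cmt G x (t Q))"
      using cmt_separates[OF ch LC t(1)[OF QZ(2)] t(1)[OF QZ(1)]] by blast
    have xc: "x \<in> carrier G" using Lc[OF x(1)] .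
    have xi: "inv x \<in> L" using subgroup.m_inv_closed[OF L_sub[OF ch LC] x(1)] .
    define c where "c y = \<rho> (cmt G x y)" for y
    have cK: "c y \<in> env A" if "y \<in> L" for y
      unfolding c_def using env_facts(2)[OF A cA] cmt_L[OF ch LC x(1) that] by blast
    define c0 where "c0 = c (t Q)"
    have c0K: "c0 \<in> env A" unfolding c0_def using cK t(1)[OF QZ(1)] by blast
    \<comment> \<open>L centralizes K, so conjugation by x is K-linear on the commutant.\<close>
    have sk: "\<sigma> x k = k" if k: "k \<in> env A" for k
      unfolding \<sigma>_def rhoL[OF x(1) k] using env_closed[OF k] xc
      by (simp only: R.m_assoc rho_closed inv_closed rho_inv(2) R.r_one)
    \<comment> \<open>Conjugation minus its eigenvalue on U Q: this kills U Q and multiplies U Z by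
      a nonzero element of the field.\<close>
    define \<theta> where "\<theta> f = \<sigma> x f \<oplus>\<^bsub>?E\<^esub> (\<ominus>\<^bsub>?E\<^esub> (c0 \<bullet> f))" for f
    have xE: "\<rho> x \<in> carrier ?E" "\<rho> (inv x) \<in> carrier ?E" "c0 \<in> carrier ?E" using xc env_closed[OF c0K] by auto
    have th_closed: "\<theta> f \<in> CK" if f: "f \<in> CK" for f
    proof -
      have fk: "f \<bullet> k = k \<bullet> f" if "k \<in> env A" for k using f that by (auto simp: CK_def)
      have fE: "f \<in> carrier ?E" using CE[OF f] .
      have "\<sigma> x f \<bullet> k = k \<bullet> \<sigma> x f" if k: "k \<in> env A" for k
        using sigma_mult[OF xc fE env_closed[OF k]] sigma_mult[OF xc env_closed[OF k] fE] sk[OF k] fk[OF k] by simp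
      then have 1: "\<sigma> x f \<in> CK" using xc fE by (simp add: CK_def)
      have "(c0 \<bullet> f) \<bullet> k = k \<bullet> (c0 \<bullet> f)" if k: "k \<in> env A" for k
      proof -
        have kE: "k \<in> carrier ?E" using env_closed[OF k] .
        have "(c0 \<bullet> f) \<bullet> k = (c0 \<bullet> k) \<bullet> f" using xE fE kE fk[OF k] by (simp only: R.m_assoc)
        also have "\<dots> = k \<bullet> (c0 \<bullet> f)" unfolding Kcom[OF c0K k] using xE fE kE by (simp only: R.m_assoc)
        finally show ?thesis .
      qed
      then have "c0 \<bullet> f \<in> CK" using xE fE by (simp add: CK_def)
      then have "\<ominus>\<^bsub>?E\<^esub> (c0 \<bullet> f) \<in> CK" using subgroup.m_inv_closed[OF CKsub] unfolding a_inv_def by blast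
      then show ?thesis unfolding \<theta>_def using subgroup.m_closed[OF CKsub 1] by simp
    qed
    have th_U: "\<theta> (k \<bullet> \<rho> y) = (k \<bullet> (c y \<oplus>\<^bsub>?E\<^esub> (\<ominus>\<^bsub>?E\<^esub> c0))) \<bullet> \<rho> y" if k: "k \<in> env A" and y: "y \<in> L" for k y
    proof -
      have yc: "y \<in> carrier G" using Lc[OF y] .
      have E: "k \<in> carrier ?E" "\<rho> y \<in> carrier ?E" "c y \<in> carrier ?E" using env_closed[OF k] yc env_closed[OF cK[OF y]] by auto
      have "\<sigma> x (\<rho> y) = c y \<bullet> \<rho> y"
        unfolding c_def \<sigma>_def using conj_eq_cmt_mult[OF xc yc] xc yc
        by (simp only: rho_mult[symmetric] m_closed inv_closed cmt_closed)
      then have 1: "\<sigma> x (k \<bullet> \<rho> y) = (k \<bullet> c y) \<bullet> \<rho> y"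
        using sigma_mult[OF xc E(1,2)] sk[OF k] E by (simp only: R.m_assoc)
      have "c0 \<bullet> (k \<bullet> \<rho> y) = (c0 \<bullet> k) \<bullet> \<rho> y" using E xE by (simp only: R.m_assoc)
      then have 2: "c0 \<bullet> (k \<bullet> \<rho> y) = (k \<bullet> c0) \<bullet> \<rho> y" unfolding Kcom[OF c0K k] .
      show ?thesis unfolding \<theta>_def 1 2
        using E xE by (simp only: R.l_distr R.r_distr R.l_minus R.r_minus R.m_closed R.a_inv_closed R.a_closed)
    qed
    have dK: "c y \<oplus>\<^bsub>?E\<^esub> (\<ominus>\<^bsub>?E\<^esub> c0) \<in> env A" if "y \<in> L" for y
      using subringE(7)[OF Kr cK[OF that] subringE(5)[OF Kr c0K]] .
    show "\<exists>\<theta>\<in>hom ?W ?W. (\<forall>l\<in>I. \<theta> ` U l \<subseteq> U l) \<and> (\<forall>x\<in>U Q. \<theta> x = \<one>\<^bsub>?W\<^esub>) \<and>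
        (\<forall>x\<in>U Z. \<theta> x = \<one>\<^bsub>?W\<^esub> \<longrightarrow> x = \<one>\<^bsub>?W\<^esub>)"
    proof (intro bexI[of _ \<theta>] conjI ballI impI)
      show "\<theta> \<in> hom ?W ?W"
      proof (rule homI)
        show "\<theta> f \<in> carrier ?W" if "f \<in> carrier ?W" for f using th_closed that by simp
        fix f g assume "f \<in> carrier ?W" "g \<in> carrier ?W"
        then have fg: "f \<in> carrier ?E" "g \<in> carrier ?E" using CE by auto
        have "\<theta> (f \<oplus>\<^bsub>?E\<^esub> g) = (\<sigma> x f \<oplus>\<^bsub>?E\<^esub> \<sigma> x g) \<oplus>\<^bsub>?E\<^esub> (\<ominus>\<^bsub>?E\<^esub> (c0 \<bullet> f) \<oplus>\<^bsub>?E\<^esub> \<ominus>\<^bsub>?E\<^esub> (c0 \<bullet> g))"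
          unfolding \<theta>_def \<sigma>_def using fg xE by (simp only: R.l_distr R.r_distr R.m_closed R.minus_add)
        also have "\<dots> = \<theta> f \<oplus>\<^bsub>?E\<^esub> \<theta> g"
          unfolding \<theta>_def using fg xE sigma_closed[OF xc]
          by (simp only: R.a_ac R.m_closed R.a_inv_closed R.a_closed)
        finally show "\<theta> (f \<otimes>\<^bsub>?W\<^esub> g) = \<theta> f \<otimes>\<^bsub>?W\<^esub> \<theta> g" by simp
      qed
      show "\<theta> ` U l \<subseteq> U l" if l: "l \<in> I" for l
      proof
        fix f assume "f \<in> \<theta> ` U l"
        then obtain k where k: "k \<in> env A" "f = \<theta> (k \<bullet> \<rho> (t l))" by (auto simp: U_def)
        have "f = (k \<bullet> (c (t l) \<oplus>\<^bsub>?E\<^esub> (\<ominus>\<^bsub>?E\<^esub> c0))) \<bullet> \<rho> (t l)" unfolding k(2) by (rule th_U[OF k(1) t(1)[OF l]])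
        moreover have "k \<bullet> (c (t l) \<oplus>\<^bsub>?E\<^esub> (\<ominus>\<^bsub>?E\<^esub> c0)) \<in> env A"
          using subringE(6)[OF Kr k(1) dK[OF t(1)[OF l]]] .
        ultimately show "f \<in> U l" unfolding U_def by blast
      qed
      show "\<theta> f = \<one>\<^bsub>?W\<^esub>" if f: "f \<in> U Q" for f
      proof -
        obtain k where k: "k \<in> env A" "f = k \<bullet> \<rho> (t Q)" using f by (auto simp: U_def)
        have "\<theta> f = (k \<bullet> (c0 \<oplus>\<^bsub>?E\<^esub> (\<ominus>\<^bsub>?E\<^esub> c0))) \<bullet> \<rho> (t Q)"
          unfolding k(2) c0_def[symmetric] using th_U[OF k(1) t(1)[OF QZ(1)]] by (simp only: c0_def)
        then show ?thesis using env_closed[OF k(1)] xE tc[OF QZ(1)] by (simp add: R.r_neg del: restrict_apply)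
      qed
      show "f = \<one>\<^bsub>?W\<^esub>" if f: "f \<in> U Z" and f0: "\<theta> f = \<one>\<^bsub>?W\<^esub>" for f
      proof -
        obtain k where k: "k \<in> env A" "f = k \<bullet> \<rho> (t Z)" using f by (auto simp: U_def)
        let ?d = "c (t Z) \<oplus>\<^bsub>?E\<^esub> (\<ominus>\<^bsub>?E\<^esub> c0)"
        have E: "k \<in> carrier ?E" "?d \<in> carrier ?E" "c (t Z) \<in> carrier ?E"
          using env_closed[OF k(1)] env_closed[OF dK[OF t(1)[OF QZ(2)]]] env_closed[OF cK[OF t(1)[OF QZ(2)]]] by auto
        have "(k \<bullet> ?d) \<bullet> \<rho> (t Z) = \<zero>\<^bsub>?E\<^esub>" using f0 th_U[OF k(1) t(1)[OF QZ(2)]] k(2) by simp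
        then have "(k \<bullet> ?d) \<bullet> \<rho> (t Z) = \<zero>\<^bsub>?E\<^esub> \<bullet> \<rho> (t Z)" using tc[OF QZ(2)] by (simp del: restrict_apply)
        then have "k \<bullet> ?d = \<zero>\<^bsub>?E\<^esub>" using rho_right_cancel[OF tc[OF QZ(2)]] E by simp
        then have "k = \<zero>\<^bsub>?E\<^esub> \<or> ?d = \<zero>\<^bsub>?E\<^esub>" using subfieldE(5)[OF K k(1) dK[OF t(1)[OF QZ(2)]]] by blast
        moreover have "?d \<noteq> \<zero>\<^bsub>?E\<^esub>"
        proof
          assume "?d = \<zero>\<^bsub>?E\<^esub>"
          then have "c (t Z) = c0" using E(3) xE(3) R.minus_equality[of "c (t Z)" "\<ominus>\<^bsub>?E\<^esub> c0"] by simp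
          then show False using x(2) by (simp add: c_def c0_def)
        qed
        ultimately have "k = \<zero>\<^bsub>?E\<^esub>" by blast
        then show ?thesis using k(2) tc[OF QZ(2)] by (simp del: restrict_apply)
      qed
    qed
  qed
  have finCK: "finite CK" using finite_subset[of CK "carrier ?E"] CE V.End_finite[OF finV] by blast
  have "(\<Prod>Q\<in>I. card (U Q)) \<le> card (carrier ?W)" using W.separated_card[OF sep] finCK by simp
  moreover have "(\<Prod>Q\<in>I. card (U Q)) = (\<Prod>Q\<in>I. card (env A))"
  proof (rule prod.cong[OF refl])
    fix Q assume Q: "Q \<in> I"
    have "inj_on (\<lambda>k. k \<bullet> \<rho> (t Q)) (env A)"
      using rho_right_cancel[OF tc[OF Q]] env_closed by (intro inj_onI) blast
    then show "card (U Q) = card (env A)" unfolding U_def by (rule Finite_Set.card_image)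
  qed
  ultimately show ?thesis by (simp add: I_def CK_def)
qed

end

section \<open>Derived length of solvable linear groups\<close>

context primitive_group_module
begin

lemma chief_factor_over_A:
  assumes IH: "linear_bound_upto TYPE(('a, 'b) monoid_scheme) (p ^ r - 1)"
    and p: "Factorial_Ring.prime p" "card (carrier V) = p ^ r" "r \<ge> 1"
    and ch: "chief_factor G A L" and LC: "L \<subseteq> cent_mod Ker A"
  shows "\<exists>j. length_bound p r (3 + j) \<and> (derived G ^^ (j + 2)) (carrier G) \<subseteq> cent_mod Ker L"
proof -
  let ?K = "env A" and ?Q = "carrier ((G\<lparr>carrier := L\<rparr>) Mod A)"
  have finK: "finite ?K" using finite_subset[OF subfieldE(3)[OF K] V.End_finite[OF finV]] .
  have As: "subgroup A G" using normal_imp_subgroup[OF A] .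
  obtain q u where q: "Factorial_Ring.prime q" "u \<ge> 1" "card L = q ^ u * card A" "\<And>x. x \<in> L \<Longrightarrow> x [^] q \<in> A"
    using chief_factor_prime_power[OF ch solv finG] by metis
  obtain s where s: "card (carrier V) = card ?K ^ s"
    "card {f \<in> carrier (End V). \<forall>k\<in>?K. f \<bullet> k = k \<bullet> f} \<le> card (carrier V) ^ s"
    by (rule V.subfield_dimension[OF finV K])
  have qd: "q dvd card ?K - 1" using prime_dvd_env[OF ch LC q(1,4)] .
  have "\<zero>\<^bsub>End V\<^esub> \<in> ?K" "\<one>\<^bsub>End V\<^esub> \<in> ?K" "\<one>\<^bsub>End V\<^esub> \<noteq> \<zero>\<^bsub>End V\<^esub>"
    using subringE(2,3)[OF subfieldE(1)[OF K]] subfieldE(6)[OF K] by auto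
  then have "card {\<zero>\<^bsub>End V\<^esub>, \<one>\<^bsub>End V\<^esub>} \<le> card ?K" by (intro card_mono finK) auto
  then have K2: "card ?K \<ge> 2" using \<open>\<one>\<^bsub>End V\<^esub> \<noteq> \<zero>\<^bsub>End V\<^esub>\<close> by simp
  \<comment> \<open>Excludes the field with two elements; |K| >= 3 is the base in the comparison of
    s^2 with |V|.\<close>
  have "q \<le> card ?K - 1" using qd K2 by (intro dvd_imp_le) auto
  then have K3: "card ?K \<ge> 3" using prime_ge_2_nat[OF q(1)] by linarith
  have "card A > 0"
    using finite_subset[OF subgroup.subset[OF As] finG] subgroup.one_closed[OF As] card_gt_0_iff by blast
  then have cQ: "card ?Q = q ^ u" using quotient_group_module(3)[OF ch solv finG] q(3) by simp
  \<comment> \<open>The commutant has order at most |V| ^ s = |K| ^ (s^2), so comparing exponents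
    bounds |L/A|.\<close>
  have "card ?K ^ (q ^ u) \<le> (card ?K ^ s) ^ s" using env_power_card[OF ch LC] s unfolding cQ by simp
  then have "card ?K ^ (q ^ u) \<le> card ?K ^ s\<^sup>2" by (simp add: power2_eq_square flip: power_mult)
  then have qs: "q ^ u \<le> s\<^sup>2" using K2 by (simp add: power_le_imp_le_exp)
  have p2: "p \<ge> 2" using prime_ge_2_nat[OF p(1)] .
  have "p ^ r > 1" using one_less_power[of p r] p2 p(3) by linarith
  have "s \<noteq> 0"
  proof
    assume "s = 0"
    then have "card (carrier V) = 1" using s(1) by simp
    then show False using p(2) \<open>p ^ r > 1\<close> by linarith
  qed
  have "card ?K dvd p ^ r" using \<open>s \<noteq> 0\<close> s(1) p(2) by (metis dvd_power neq0_conv)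
  then obtain e where e: "card ?K = p ^ e" using divides_primepow_nat[OF p(1)] by blast
  have "e \<noteq> 0" using e K2 by (intro notI) simp
  have "p ^ r = p ^ (e * s)" using s(1) p(2) e by (simp add: power_mult)
  then have r: "r = e * s" using p2 by simp
  have "s\<^sup>2 < 3 ^ s" by (rule square_less_three_power)
  also have "\<dots> \<le> p ^ r" unfolding p(2)[symmetric] s(1) using K3 by (intro power_mono) auto
  finally have "q ^ u \<le> p ^ r - 1" using qs by linarith
  then obtain j where j: "length_bound q u j" "(derived G ^^ j) (carrier G) \<subseteq> cent_mod A L"
    using chief_factor_bound[OF IH finG solv ch q(1,3)] by blast
  have "length_bound p (e * s) (3 + j)"
    using length_bound_extraspecial[OF j(1) qs p(1) q(1) _ _ q(2)] qd e \<open>e \<noteq> 0\<close> by simp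
  then show ?thesis using derived_cent_L[OF ch LC j(2)] r by blast
qed

text \<open>The chief factors L/A inside C_G(A) have different ranks; the greatest admissible
  exponent J serves them all, so D = G^(J-1) centralizes every such L. If D were not inside A, a
  chief factor L below A D would commute with itself, against the maximality of A. Hence D lies in
  A, and one more step ends in \<open>Ker\<close>.\<close>

theorem primitive_bound:
  assumes IH: "linear_bound_upto TYPE(('a, 'b) monoid_scheme) (p ^ r - 1)"
    and p: "Factorial_Ring.prime p" "card (carrier V) = p ^ r" "r \<ge> 1" "p ^ r \<noteq> 2"
  shows "\<exists>j. length_bound p r j \<and> (derived G ^^ j) (carrier G) \<subseteq> Ker"
proof -
  define J where "J = (GREATEST j. length_bound p r j)"
  have b2: "length_bound p r 2" using length_bound_two[OF prime_ge_2_nat[OF p(1)] p(3,4)] .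
  have J: "length_bound p r J" unfolding J_def by (rule GreatestI_nat[where P = "length_bound p r", OF b2]) (rule length_bound_imp_le)
  have Jm: "j \<le> J" if "length_bound p r j" for j unfolding J_def by (rule Greatest_le_nat[where P = "length_bound p r", OF that]) (rule length_bound_imp_le)
  have J2: "J \<ge> 2" using Jm[OF b2] .
  define D where "D = (derived G ^^ (J - 1)) (carrier G)"
  have Dn: "D \<lhd> G" unfolding D_def by (rule exp_of_derived_normal)
  have Dc: "D \<subseteq> carrier G" and Ac: "A \<subseteq> carrier G"
    using normal_subset[OF Dn] normal_subset[OF A] by auto
  have "D \<subseteq> (derived G ^^ 1) (carrier G)" unfolding D_def using J2 by (intro exp_of_derived_antimono) simp
  then have DC: "D \<subseteq> cent_mod Ker A" using derived_sub_C by simp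
  have DL: "D \<subseteq> cent_mod Ker L" if L: "chief_factor G A L" "L \<subseteq> cent_mod Ker A" for L
  proof -
    obtain j where j: "length_bound p r (3 + j)" "(derived G ^^ (j + 2)) (carrier G) \<subseteq> cent_mod Ker L"
      using chief_factor_over_A[OF IH p(1-3) L] by blast
    have "j + 2 \<le> J - 1" using Jm[OF j(1)] by linarith
    then show ?thesis unfolding D_def using exp_of_derived_antimono j(2) by blast
  qed
  have "D \<subseteq> A"
  proof (rule ccontr)
    assume nDA: "\<not> D \<subseteq> A"
    let ?P = "A <#> D"
    have P: "?P \<lhd> G" "A \<subseteq> ?P" "D \<subseteq> ?P"
      using normal_set_mult[OF A Dn] subgroup_set_mult[OF A normal_imp_subgroup[OF Dn]] by auto
    then have "A \<subset> ?P" using nDA by blast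
    then obtain L where L: "chief_factor G A L" "L \<subseteq> ?P" using chief_factor_exists[OF A P(1) _ finG] by blast
    have "?P \<subseteq> cent_mod Ker A"
      using set_mult_subset[OF subgroup_cent_mod[OF Ker_normal Ac] A_commute DC] .
    then have LC: "L \<subseteq> cent_mod Ker A" using L(2) by blast
    have Lc: "L \<subseteq> carrier G" using subgroup.subset[OF L_sub[OF L(1) LC]] .
    have "A \<subseteq> cent_mod Ker L" using cent_mod_sym[OF Ker_normal Lc Ac LC] .
    then have "?P \<subseteq> cent_mod Ker L"
      using set_mult_subset[OF subgroup_cent_mod[OF Ker_normal Lc]] DL[OF L(1) LC] by blast
    then have "commuting L" using commuting_iff[OF Lc] L(2) by blast
    then show False using L_not_commuting[OF L(1) LC] by blast
  qed
  then have "derived G D \<subseteq> Ker"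
    using A_commute by (intro derived_subsetI[OF normal_imp_subgroup[OF Ker_normal]]) (auto simp: cent_mod_def)
  moreover have "derived G D = (derived G ^^ J) (carrier G)"
    using J2 unfolding D_def by (cases J) auto
  ultimately show ?thesis using J by auto
qed

end

text \<open>Settles the order 2, which \<open>length_bound_two\<close> excludes.\<close>

lemma (in group_module) trivial_of_card_two:
  assumes "card (carrier V) = 2" "g \<in> carrier G" "v \<in> carrier V"
  shows "act g v = v"
proof (cases "v = \<one>\<^bsub>V\<^esub>")
  case False
  then have "carrier V = {\<one>\<^bsub>V\<^esub>, v}"
    using assms(1,3) V.one_closed finV by (intro card_seteq[symmetric]) auto
  moreover have "act g v \<noteq> \<one>\<^bsub>V\<^esub>"
    using act_inj[OF assms(2)] assms(2,3) False by (metis V.one_closed act_unit inj_onD)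
  ultimately show ?thesis using act_closed[OF assms(2,3)] by blast
qed (use assms in simp)

lemma linear_bound_upto_mono: "linear_bound_upto T N \<Longrightarrow> M \<le> N \<Longrightarrow> linear_bound_upto T M"
  unfolding linear_bound_upto_def by (meson le_trans)

text \<open>After i steps the derived series lies in the block stabilizer M, after j more it fixes Y
  pointwise. The vectors fixed by a term of the derived series form an invariant subgroup, so
  irreducibility extends this from Y to V.\<close>

lemma (in group_module) imprimitive_bound:
  fixes k N :: nat
  assumes IH: "linear_bound_upto TYPE(('g, 'm) monoid_scheme) N" and solv: "solvable G"
    and IHY: "\<And>M Y s. subgroup M G \<Longrightarrow> irreducible_on M V act Y \<Longrightarrow> card Y = p ^ s \<Longrightarrow> p ^ s \<le> N \<Longrightarrow>
       \<exists>j. length_bound p s j \<and> (\<forall>g\<in>(derived G ^^ j) M. \<forall>v\<in>Y. act g v = v)"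
    and irrV: "irreducible_on (carrier G) V act (carrier V)"
    and p: "Factorial_Ring.prime p" "card (carrier V) = p ^ r" "p ^ r = Suc N"
    and M: "subgroup M G" "card (carrier G) = k * card M" "k \<ge> 2"
    and Y: "irreducible_on M V act Y" "card Y ^ k \<le> card (carrier V)"
  shows "\<exists>j. length_bound p r j \<and> (\<forall>g\<in>(derived G ^^ j) (carrier G). \<forall>v\<in>carrier V. act g v = v)"
proof -
  have p2: "p \<ge> 2" using prime_ge_2_nat[OF p(1)] .
  have Ys: "subgroup Y V" and Y1: "Y \<noteq> {\<one>\<^bsub>V\<^esub>}" using Y(1) by (auto simp: irreducible_on_def invariant_subgroup_def)
  have "card Y dvd p ^ r" using V.lagrange[OF Ys] p(2) by (metis dvd_triv_right order_def)
  then obtain s where s: "card Y = p ^ s" using divides_primepow_nat[OF p(1)] by blast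
  have "s \<noteq> 0"
  proof
    assume "s = 0"
    then obtain y where "Y = {y}" using s card_1_singletonE by auto
    then show False using Y1 subgroup.one_closed[OF Ys] by auto
  qed
  have "p ^ (k * s) \<le> p ^ r" using Y(2) unfolding s p(2) by (simp add: mult.commute flip: power_mult)
  then have ks: "k * s \<le> r" using p2 by (simp add: power_le_imp_le_exp)
  have "2 * s \<le> k * s" using M(3) by simp
  then have "s < r" using ks \<open>s \<noteq> 0\<close> by linarith
  then have "p ^ s < p ^ r" using p2 by (intro power_strict_increasing) auto
  then obtain j where j: "length_bound p s j" "\<And>g v. g \<in> (derived G ^^ j) M \<Longrightarrow> v \<in> Y \<Longrightarrow> act g v = v"
    using IHY[OF M(1) Y(1) s] p(3) by auto
  \<comment> \<open>The index bound is available up to N only; here k <= r < p ^ r = N + 1.\<close>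
  have "k \<le> k * s" using \<open>s \<noteq> 0\<close> by simp
  also have "\<dots> < 2 ^ r" using ks less_exp[of r] by linarith
  also have "\<dots> \<le> p ^ r" using p2 by (intro power_mono) auto
  finally have "k \<le> N" using p(3) by simp
  then obtain i where i: "2 ^ i \<le> k\<^sup>2" "(derived G ^^ i) (carrier G) \<subseteq> M"
    using subgroup_index_bound[OF IH is_group finG solv M(1,2)] by blast
  let ?D = "(derived G ^^ (i + j)) (carrier G)"
  let ?F = "{v \<in> carrier V. \<forall>d\<in>?D. act d v = v}"
  have "?D \<subseteq> (derived G ^^ j) M" unfolding exp_of_derived_add using mono_exp_of_derived[OF i(2)] .
  then have "Y \<subseteq> ?F" using j(2) subgroup.mem_carrier[OF Ys] by blast
  then have "?F \<noteq> {\<one>\<^bsub>V\<^esub>}" using Y1 subgroup.one_closed[OF Ys] by blast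
  moreover have "invariant_subgroup (carrier G) V act ?F" by (rule fix_invariant_subgroup[OF exp_of_derived_normal])
  moreover have "?F \<subseteq> carrier V" by blast
  ultimately have "?F = carrier V" using irrV unfolding irreducible_on_def by meson
  then have "\<forall>g\<in>?D. \<forall>v\<in>carrier V. act g v = v" by blast
  moreover have "length_bound p r (i + j)"
    using length_bound_mult[OF i(1) j(1) ks] M(3) \<open>s \<noteq> 0\<close> p2 by simp
  ultimately show ?thesis by blast
qed

theorem linear_bound: "linear_bound_upto TYPE(('g, 'm) monoid_scheme) N"
proof (induction N)
  case 0
  show ?case unfolding linear_bound_upto_def
    using prime_gt_0_nat by (metis le_zero_eq not_gr_zero power_not_zero)
next
  case (Suc N)
  show ?case
    unfolding linear_bound_upto_def
  proof (intro allI impI)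
    fix G :: "('g, 'm) monoid_scheme" and V :: "'g set monoid" and act p r
    assume gm: "group_module G V act" and solv: "solvable G" and irrV: "irreducible_on (carrier G) V act (carrier V)"
      and p: "Factorial_Ring.prime p" "card (carrier V) = p ^ r" and le: "p ^ r \<le> Suc N"
    interpret group_module G V act by (rule gm)
    show "\<exists>j. length_bound p r j \<and> (\<forall>g\<in>(derived G ^^ j) (carrier G). \<forall>v\<in>carrier V. act g v = v)"
    proof (cases "p ^ r = Suc N")
      case False
      then show ?thesis using Suc gm solv irrV p le unfolding linear_bound_upto_def by (metis le_SucE)
    next
      case eq: True
      \<comment> \<open>A subgroup acting on an invariant subgroup of V arises by changing carriers
        alone, so the types stay and the induction hypothesis applies.\<close>
      have IH': "\<exists>j. length_bound p s j \<and> (\<forall>g\<in>(derived G ^^ j) M. \<forall>v\<in>Y. act g v = v)"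
        if MY: "subgroup M G" "irreducible_on M V act Y" "card Y = p ^ s" "p ^ s \<le> N" for M Y s
      proof -
        have "invariant_subgroup M V act Y" using MY(2) by (simp add: irreducible_on_def)
        note gm' = group_module_restrict[OF MY(1) this]
        have "\<exists>j. length_bound p s j \<and> (\<forall>g\<in>(derived (G\<lparr>carrier := M\<rparr>) ^^ j) (carrier (G\<lparr>carrier := M\<rparr>)).
            \<forall>v\<in>carrier (V\<lparr>carrier := Y\<rparr>). act g v = v)"
          by (rule Suc[unfolded linear_bound_upto_def, rule_format, OF gm' solvable_restrict[OF MY(1) solv] irreducible_on_restrict[OF MY(2)] p(1) _ MY(4)])
            (simp add: MY(3))
        then show ?thesis using exp_of_derived_consistent[OF MY(1)] by simp
      qed
      have r1: "r \<ge> 1"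
      proof (rule ccontr)
        assume "\<not> r \<ge> 1"
        then have "r = 0" by simp
        then have "card (carrier V) = 1" using p(2) by simp
        then obtain v where "carrier V = {v}" by (rule card_1_singletonE)
        then show False using irrV V.one_closed by (auto simp: irreducible_on_def)
      qed
      show ?thesis
      proof (cases "p ^ r = 2")
        case two: True
        have p2: "p \<ge> 2" using prime_ge_2_nat[OF p(1)] .
        have "r = 1"
        proof (rule ccontr)
          assume "r \<noteq> 1"
          then have "(2::nat) ^ 2 \<le> 2 ^ r" using r1 by (intro power_increasing) auto
          also have "\<dots> \<le> p ^ r" using p2 by (intro power_mono) auto
          finally show False using two by simp
        qed
        \<comment> \<open>With p = 2 and r = 1 the companion bound is the equality 4 = 4.\<close>
        then have "length_bound p r 0" using two by (simp add: length_bound_def)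
        moreover have "\<forall>g\<in>(derived G ^^ 0) (carrier G). \<forall>v\<in>carrier V. act g v = v"
          using trivial_of_card_two p(2) two by simp
        ultimately show ?thesis by blast
      next
        case ntwo: False
        show ?thesis
        proof (cases "\<exists>A. A \<lhd> G \<and> commuting A \<and> \<not> subfield (env A) (End V)")
          case True
          then obtain A where A: "A \<lhd> G" "commuting A" "\<not> subfield (env A) (End V)" by blast
          obtain M Y k where "subgroup M G" "card (carrier G) = k * card M" "k \<ge> 2"
            "irreducible_on M V act Y" "card Y ^ k \<le> card (carrier V)"
            using imprimitive_decomposition[OF irrV A] by metis
          then show ?thesis using imprimitive_bound[OF Suc solv IH' irrV p eq] by blast
        next
          case False
          let ?P = "\<lambda>A. A \<lhd> G \<and> commuting A"
          have "?P {\<one>\<^bsub>G\<^esub>}" using one_is_normal by (simp add: commuting_def)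
          moreover have "\<And>A. ?P A \<Longrightarrow> A \<subseteq> carrier G" by (simp add: normal_subset)
          ultimately obtain A where PA_mx: "?P A \<and> (\<forall>B. ?P B \<longrightarrow> A \<subseteq> B \<longrightarrow> B = A)"
            by (rule maximal_subset[of "carrier G" ?P, OF finG, THEN exE])
          note PA = PA_mx[THEN conjunct1] and mx = PA_mx[THEN conjunct2, rule_format]
          interpret pr: primitive_group_module G V act A
          proof (rule primitive_group_module.intro[OF gm], rule primitive_group_module_axioms.intro)
            show "solvable G" by (rule solv)
            show "A \<lhd> G" "commuting A" using PA by auto
            show "subfield (env A) (End V)" using False PA by blast
            show "B = A" if "B \<lhd> G" "commuting B" "A \<subseteq> B" for B using mx that by simp
          qed
          have "linear_bound_upto TYPE(('g, 'm) monoid_scheme) (p ^ r - 1)"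
            using linear_bound_upto_mono[OF Suc] eq by simp
          then obtain j where j: "length_bound p r j" "(derived G ^^ j) (carrier G) \<subseteq> Ker"
            using pr.primitive_bound[OF _ p r1 ntwo] by blast
          have "act g v = v" if gv: "g \<in> (derived G ^^ j) (carrier G)" "v \<in> carrier V" for g v
          proof -
            have "\<rho> g = \<one>\<^bsub>End V\<^esub>" using gv(1) j(2) by (auto simp: Ker_def)
            then have "\<rho> g v = \<one>\<^bsub>End V\<^esub> v" by simp
            then show ?thesis using gv(2) by (simp add: V.End_apply)
          qed
          then show ?thesis using j(1) by blast
        qed
      qed
    qed
  qed
qed

section \<open>Composition length and the main theorem\<close>

abbreviation \<Omega> :: "nat \<Rightarrow> nat" where "\<Omega> m \<equiv> size (prime_factorization m)"

lemma Omega_prime_power_mult: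
  assumes "Factorial_Ring.prime p" "m > 0"
  shows "\<Omega> (p ^ r * m) = r + \<Omega> m"
proof -
  have "p ^ r \<noteq> 0" using assms(1) prime_gt_0_nat by simp
  then show ?thesis
    using assms by (simp add: prime_factorization_mult prime_factorization_prime_power)
qed

context group
begin

text \<open>Take M maximal among the proper normal subgroups above the derived subgroup. G acts
  trivially on G/M, so a subgroup of order p from Sylow's theorem is invariant, and irreducibility
  makes it everything.\<close>

lemma normal_prime_index:
  assumes fin: "finite (carrier G)" and sol: "solvable G" and nt: "carrier G \<noteq> {\<one>}"
  obtains M p where "M \<lhd> G" "Factorial_Ring.prime p" "card (carrier G) = p * card M"
proof -
  have "derived G (carrier G) \<noteq> carrier G"
  proof
    assume e: "derived G (carrier G) = carrier G"
    have "(derived G ^^ m) (carrier G) = carrier G" for m by (induction m) (simp_all add: e)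
    then show False using nt sol solvable_iff_trivial_derived_seq by auto
  qed
  let ?P = "\<lambda>M. M \<lhd> G \<and> derived G (carrier G) \<subseteq> M \<and> M \<noteq> carrier G"
  have "?P (derived G (carrier G))"
    using derived_self_is_normal \<open>derived G (carrier G) \<noteq> carrier G\<close> by simp
  moreover have "\<And>M. ?P M \<Longrightarrow> M \<subseteq> carrier G" by (simp add: normal_subset)
  ultimately obtain M where PM_mx: "?P M \<and> (\<forall>B. ?P B \<longrightarrow> M \<subseteq> B \<longrightarrow> B = M)"
    by (rule maximal_subset[of "carrier G" ?P, OF fin, THEN exE])
  note PM = PM_mx[THEN conjunct1] and mx = PM_mx[THEN conjunct2, rule_format]
  have M: "M \<lhd> G" and DM: "derived G (carrier G) \<subseteq> M" using PM by auto
  have ch: "chief_factor G M (carrier G)"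
    unfolding chief_factor_def
  proof (intro conjI allI impI)
    show "M \<lhd> G" "carrier G \<lhd> G" using M normal_self by auto
    show "M \<subset> carrier G" using PM normal_subset[OF M] by blast
    fix K assume K: "K \<lhd> G \<and> M \<subseteq> K \<and> K \<subseteq> carrier G"
    show "K = M \<or> K = carrier G" using K DM mx[of K] by auto
  qed
  let ?Q = "(G\<lparr>carrier := carrier G\<rparr>) Mod M"
  note Q = quotient_group_module[OF ch sol fin]
  interpret Q: group_module G ?Q "conj_on_cosets G" by (rule Q(1))
  obtain p r where pr: "Factorial_Ring.prime p" "r \<ge> 1" "card (carrier ?Q) = p ^ r"
    using Q.irreducible_on_prime_power[OF Q(2)] by metis
  have "order ?Q = p ^ 1 * p ^ (r - 1)" using pr by (simp add: order_def power_eq_if)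
  then obtain T where T: "subgroup T ?Q" "card T = p ^ 1"
    using sylow_thm[OF pr(1) Q.V.is_group _ Q.finV] by blast
  have "conj_on_cosets G g A \<in> T" if gA: "g \<in> carrier G" "A \<in> T" for g A
  proof -
    have "A \<in> carrier ?Q" using subgroup.mem_carrier[OF T(1) gA(2)] .
    then obtain x where x: "x \<in> carrier G" "A = M #> x" by (auto simp: carrier_FactGroup)
    have "cmt G g x \<in> M" using DM cmt_mem_derived[OF gA(1) x(1)] by blast
    then have "M #> (g \<otimes> x \<otimes> inv g) = M #> x"
      using rcoset_eq_iff[OF normal_imp_subgroup[OF M], of "g \<otimes> x \<otimes> inv g" x] gA(1) x(1) by (simp add: cmt_def)
    then show ?thesis using conj_rcoset[OF M gA(1) x(1)] x(2) gA(2) by simp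
  qed
  then have "invariant_subgroup (carrier G) ?Q (conj_on_cosets G) T" using T(1) by (simp add: invariant_subgroup_def)
  moreover have "T \<subseteq> carrier ?Q" using subgroup.subset[OF T(1)] .
  ultimately have "T = {\<one>\<^bsub>?Q\<^esub>} \<or> T = carrier ?Q" using Q(2) unfolding irreducible_on_def by blast
  moreover have "card T \<noteq> 1" using T(2) pr(1) by auto
  ultimately have "T = carrier ?Q" by auto
  then have "card (carrier G) = p * card M" using Q(3) T(2) by simp
  then show thesis using that M pr(1) by blast
qed

text \<open>Collects the proper nontrivial members of a composition series of H, since these are
  what D(G) can count; a series with \<Omega> |H| steps has one fewer of them, hence the
  \<open>Suc\<close>. Being normal in a different subgroup K' is what excludes
  self-normalization.\<close>

lemma subnormal_chain:
  assumes fin: "finite (carrier G)" and sol: "solvable G"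
    and H: "subgroup H G" "H \<noteq> {\<one>}"
  shows "\<exists>S. finite S \<and> inj_on card S \<and> Suc (card S) = \<Omega> (card H) \<and>
    (\<forall>K\<in>S. card K < card H \<and> subgroup K G \<and> K \<noteq> {\<one>} \<and>
       (\<exists>K'. subgroup K' G \<and> K \<lhd> G\<lparr>carrier := K'\<rparr> \<and> K \<noteq> K'))"
  using H
proof (induction "card H" arbitrary: H rule: less_induct)
  case less
  let ?H = "G\<lparr>carrier := H\<rparr>"
  interpret H: group ?H using subgroup_imp_group[OF less.prems(1)] .
  have finH: "finite H" using finite_subset[OF subgroup.subset[OF less.prems(1)] fin] .
  obtain M p where M: "M \<lhd> ?H" "Factorial_Ring.prime p" "card H = p * card M"
    using H.normal_prime_index[OF _ solvable_restrict[OF less.prems(1) sol]] finH less.prems(2) by auto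
  have MH: "subgroup M ?H" using normal_imp_subgroup[OF M(1)] .
  have Ms: "subgroup M G" using incl_subgroup[OF less.prems(1) MH] .
  have "M \<subseteq> H" using subgroup.subset[OF MH] by simp
  then have M0: "card M > 0" using finite_subset[OF _ finH] subgroup.one_closed[OF Ms] card_gt_0_iff by blast
  have lt: "card M < card H" using M(3) M0 prime_gt_1_nat[OF M(2)] by simp
  have Om: "\<Omega> (card H) = Suc (\<Omega> (card M))" using Omega_prime_power_mult[OF M(2) M0, of 1] M(3) by simp
  show ?case
  proof (cases "M = {\<one>}")
    case True
    then show ?thesis using Om by (intro exI[of _ "{}"]) simp
  next
    case False
    obtain S where S0: "finite S \<and> inj_on card S \<and> Suc (card S) = \<Omega> (card M) \<and>
      (\<forall>K\<in>S. card K < card M \<and> subgroup K G \<and> K \<noteq> {\<one>} \<and>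
       (\<exists>K'. subgroup K' G \<and> K \<lhd> G\<lparr>carrier := K'\<rparr> \<and> K \<noteq> K'))"
      by (rule exE[OF less.hyps[OF lt Ms False]])
    note S = S0[THEN conjunct1] S0[THEN conjunct2, THEN conjunct1] S0[THEN conjunct2, THEN conjunct2, THEN conjunct1]
      S0[THEN conjunct2, THEN conjunct2, THEN conjunct2]
    have lt_M: "card K < card M" if "K \<in> S" for K using bspec[OF S(4) that] by (rule conjunct1)
    have MS: "card M \<notin> card ` S"
    proof
      assume "card M \<in> card ` S"
      then obtain K where "card M = card K" "K \<in> S" by (rule imageE)
      then show False using lt_M[of K] by simp
    qed
    have "M \<notin> S" using lt_M[of M] by auto
    have "M \<noteq> H" using lt by (intro notI) simp
    let ?P = "\<lambda>K. card K < card H \<and> subgroup K G \<and> K \<noteq> {\<one>} \<and>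
       (\<exists>K'. subgroup K' G \<and> K \<lhd> G\<lparr>carrier := K'\<rparr> \<and> K \<noteq> K')"
    have PM: "?P M" using lt Ms False less.prems(1) M(1) \<open>M \<noteq> H\<close> by (intro conjI exI[of _ H])
    have PS: "?P K" if K: "K \<in> S" for K
      by (rule conjI[OF less_trans[OF lt_M[OF K] lt] conjunct2[OF bspec[OF S(4) K]]])
    have all: "\<forall>K\<in>insert M S. ?P K"
    proof
      fix K assume K: "K \<in> insert M S"
      show "?P K"
      proof (cases "K = M")
        case True
        show ?thesis unfolding True by (rule PM)
      next
        case False
        then have "K \<in> S" using K by simp
        then show ?thesis by (rule PS)
      qed
    qed
    have "inj_on card (insert M S)" using S(2) MS \<open>M \<notin> S\<close> by simp
    moreover have "finite (insert M S)" "Suc (card (insert M S)) = \<Omega> (card H)"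
      using S(1,3) \<open>M \<notin> S\<close> Om by simp_all
    ultimately show ?thesis using all by (intro exI[of _ "insert M S"] conjI)
  qed
qed

lemma normalizer_neq:
  assumes "subgroup K' G" "K \<lhd> G\<lparr>carrier := K'\<rparr>" "K \<noteq> K'"
  shows "normalizer G K \<noteq> K"
proof -
  let ?K = "G\<lparr>carrier := K'\<rparr>"
  interpret K': group ?K using subgroup_imp_group[OF assms(1)] .
  have Ks: "subgroup K ?K" using normal_imp_subgroup[OF assms(2)] .
  have KK: "K \<subseteq> K'" using subgroup.subset[OF Ks] by simp
  have K'c: "x \<in> carrier G" if "x \<in> K'" for x using subgroup.mem_carrier[OF assms(1) that] .
  then have Kc: "K \<subseteq> carrier G" using KK by blast
  obtain g where g: "g \<in> K'" "g \<notin> K" using KK assms(3) by blast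
  have conj: "h \<otimes> x \<otimes> inv h \<in> K" if "h \<in> K'" "x \<in> K" for h x
    using K'.normal_conj[OF assms(2), of h x] that m_inv_consistent[OF assms(1)] by simp
  have gc: "g \<in> carrier G" using K'c g by blast
  have gi: "inv g \<in> K'" using subgroup.m_inv_closed[OF assms(1) g(1)] .
  have "g <# K #> inv g = K"
  proof (intro equalityI subsetI)
    fix y assume "y \<in> g <# K #> inv g"
    then obtain x where "x \<in> K" "y = g \<otimes> x \<otimes> inv g" by (auto simp: l_coset_def r_coset_def)
    then show "y \<in> K" using conj g by blast
  next
    fix y assume y: "y \<in> K"
    have "inv g \<otimes> y \<otimes> inv (inv g) \<in> K" using conj[OF gi y] .
    moreover have "y = g \<otimes> (inv g \<otimes> y \<otimes> inv (inv g)) \<otimes> inv g"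
      using gc y Kc by (simp add: m_assoc subset_iff)
    ultimately show "y \<in> g <# K #> inv g" unfolding l_coset_def r_coset_def by blast
  qed
  then have "g \<in> normalizer G K" using gc Kc by (simp add: normalizer_def stabilizer_def)
  then show ?thesis using g by blast
qed

lemma card_conj_class:
  assumes "subgroup K G" "finite (carrier G)" "T \<in> subgroup_conj_class G K"
  shows "card T = card K"
proof -
  obtain g where g: "g \<in> carrier G" "T = g <# K #> inv g" using assms(3) by (auto simp: subgroup_conj_class_def)
  have "T = (\<lambda>x. g \<otimes> x \<otimes> inv g) ` K" unfolding g(2) by (auto simp: l_coset_def r_coset_def)
  moreover have "inj_on (\<lambda>x. g \<otimes> x \<otimes> inv g) K"
    using subgroup.mem_carrier[OF assms(1)] g(1) by (intro inj_onI) simp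
  ultimately show ?thesis using card_image by blast
qed

lemma self_mem_conj_class: "subgroup K G \<Longrightarrow> K \<in> subgroup_conj_class G K"
proof -
  assume K: "subgroup K G"
  have "\<one> <# K #> inv \<one> = K" using lcos_mult_one coset_mult_one subgroup.subset[OF K] by simp
  then show ?thesis unfolding subgroup_conj_class_def by (metis (mono_tags, lifting) mem_Collect_eq one_closed)
qed

lemma D_count_ge:
  assumes fin: "finite (carrier G)" and sol: "solvable G"
  shows "\<Omega> (card (carrier G)) \<le> Suc (D_count G)"
proof (cases "carrier G = {\<one>}")
  case False
  obtain S where S: "finite S" "inj_on card S" "Suc (card S) = \<Omega> (card (carrier G))"
      "\<And>K. K \<in> S \<Longrightarrow> subgroup K G \<and> K \<noteq> {\<one>} \<and> (\<exists>K'. subgroup K' G \<and> K \<lhd> G\<lparr>carrier := K'\<rparr> \<and> K \<noteq> K')"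
    using subnormal_chain[OF fin sol subgroup_self False] by blast
  let ?D = "{subgroup_conj_class G H | H. subgroup H G \<and> H \<noteq> {\<one>} \<and> normalizer G H \<noteq> H}"
  have "finite {H. subgroup H G}"
    by (rule finite_subset[of _ "Pow (carrier G)"]) (use fin subgroup.subset in auto)
  moreover have "?D \<subseteq> subgroup_conj_class G ` {H. subgroup H G}" by blast
  \<comment> \<open>Without finiteness the cardinality defining D(G) could be the default value
    0.\<close>
  ultimately have finD: "finite ?D" using finite_surj by blast
  have "inj_on (subgroup_conj_class G) S"
  proof (rule inj_onI)
    fix K T assume KT: "K \<in> S" "T \<in> S" "subgroup_conj_class G K = subgroup_conj_class G T"
    have "K \<in> subgroup_conj_class G T" using self_mem_conj_class[of K] S(4)[OF KT(1)] KT(3) by simp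
    then have "card K = card T" using card_conj_class[OF _ fin] S(4)[OF KT(2)] by blast
    then show "K = T" using S(2) KT(1,2) by (meson inj_onD)
  qed
  moreover have "subgroup_conj_class G ` S \<subseteq> ?D"
  proof (rule image_subsetI)
    fix K assume "K \<in> S"
    then obtain K' where K': "subgroup K G" "K \<noteq> {\<one>}" "subgroup K' G" "K \<lhd> G\<lparr>carrier := K'\<rparr>" "K \<noteq> K'"
      using S(4) by meson
    have "normalizer G K \<noteq> K" using normalizer_neq[OF K'(3-5)] .
    then show "subgroup_conj_class G K \<in> ?D" using K'(1,2) by auto
  qed
  ultimately have "card S \<le> card ?D" using finD card_inj_on_le by blast
  then show ?thesis using S(3) by (simp add: D_count_def)
qed simp

section \<open>The derived series against a chief series\<close>

lemma chief_series:
  assumes fin: "finite (carrier G)" and N: "N \<lhd> G"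
  shows "\<exists>Z l. Z 0 = N \<and> Z l = carrier G \<and> (\<forall>i<l. chief_factor G (Z i) (Z (Suc i)))"
  using N
proof (induction "card (carrier G) - card N" arbitrary: N rule: less_induct)
  case less
  have Nc: "N \<subseteq> carrier G" using subgroup.subset[OF normal_imp_subgroup[OF less.prems]] .
  show ?case
  proof (cases "N = carrier G")
    case True
    then show ?thesis by (intro exI[of _ "\<lambda>_. N"] exI[of _ 0]) simp
  next
    case False
    then obtain L where L: "chief_factor G N L"
      using chief_factor_exists[OF less.prems normal_self _ fin] Nc by blast
    then have Ln: "L \<lhd> G" and NL: "N \<subset> L" by (auto simp: chief_factor_def)
    have Lc: "L \<subseteq> carrier G" using normal_subset[OF Ln] .
    have "card N < card L" "card L \<le> card (carrier G)"
      using psubset_card_mono[OF finite_subset[OF Lc fin] NL] card_mono[OF fin Lc] by auto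
    then obtain Z l where Z: "Z 0 = L" "Z l = carrier G" "\<forall>i<l. chief_factor G (Z i) (Z (Suc i))"
      using less.hyps[OF _ Ln] by (metis diff_less_mono2 order_less_le_trans)
    show ?thesis
      by (intro exI[of _ "case_nat N Z"] exI[of _ "Suc l"]) (use Z L in \<open>auto simp: less_Suc_eq_0_disj\<close>)
  qed
qed

text \<open>A group acting trivially on the factors of a normal series of length \<open>l\<close> within which it lies is
  nilpotent of class at most \<open>l\<close>; its derived series descends through the series with doubling steps.\<close>
lemma exp_of_derived_stabilizer:
  assumes Zn: "\<And>i. i \<le> l \<Longrightarrow> Z i \<lhd> G" and Z0: "Z 0 = {\<one>}" and Zl: "Z l = carrier G"
    and N: "subgroup N G" and st: "\<And>i. i < l \<Longrightarrow> N \<subseteq> cent_mod (Z i) (Z (Suc i))"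
  shows "(derived G ^^ k) N \<subseteq> Z (Suc l - 2 ^ k)"
proof -
  \<comment> \<open>The second conjunct is the strengthening: the k-th term lowers every index by 2
    ^ k. Subtraction is truncated, so an index below the bottom means Z 0, the trivial subgroup; for
    k = 0 the index Suc l - 1 is the top.\<close>
  have "(derived G ^^ k) N \<subseteq> Z (Suc l - 2 ^ k) \<and>
    (\<forall>b\<le>l. (derived G ^^ k) N \<subseteq> cent_mod (Z (b - 2 ^ k)) (Z b))"
  proof (induction k)
    case 0
    have "N \<subseteq> cent_mod (Z (b - 1)) (Z b)" if "b \<le> l" for b
    proof (cases b)
      case 0
      then show ?thesis using Z0 subgroup.mem_carrier[OF N] by (auto simp: cent_mod_def cmt_def)
    next
      case (Suc i)
      then show ?thesis using st[of i] that by simp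
    qed
    then show ?case using Zl subgroup.subset[OF N] by simp
  next
    case (Suc k)
    let ?N = "(derived G ^^ k) N" and ?m = "2 ^ k :: nat"
    have Nc: "?N \<subseteq> carrier G" using exp_of_derived_in_carrier[OF subgroup.subset[OF N]] .
    have m1: "?m \<ge> 1" by simp
    have c: "cmt G g x \<in> Z (b - ?m)" if "g \<in> ?N" "b \<le> l" "x \<in> Z b" for g b x
      using Suc that by (auto simp: cent_mod_def)
    have "derived G ?N \<subseteq> Z (Suc l - 2 ^ Suc k)"
    proof (rule derived_subsetI)
      have "Suc l - 2 ^ Suc k \<le> l" using one_le_power[of "2::nat" "Suc k"] by linarith
      then show "subgroup (Z (Suc l - 2 ^ Suc k)) G" by (rule normal_imp_subgroup[OF Zn])
      fix g h assume gh: "g \<in> ?N" "h \<in> ?N"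
      then have "h \<in> Z (Suc l - ?m)" using Suc by blast
      moreover have "Suc l - ?m \<le> l" using m1 by linarith
      ultimately have "cmt G g h \<in> Z (Suc l - ?m - ?m)" by (intro c gh(1))
      then show "cmt G g h \<in> Z (Suc l - 2 ^ Suc k)" by (simp add: mult_2)
    qed
    moreover have "derived G ?N \<subseteq> cent_mod (Z (b - 2 ^ Suc k)) (Z b)" if b: "b \<le> l" for b
    proof -
      let ?B = "Z (b - ?m - ?m)"
      have B: "?B \<lhd> G" and Zb: "Z b \<lhd> G" and Zbm: "Z (b - ?m) \<lhd> G" using Zn b by auto
      have cs: "cent_mod ?B (Z (b - ?m)) \<lhd> G" using normal_cent_mod[OF B Zbm] .
      have Zc: "x \<in> carrier G" if "x \<in> Z b" for x using normal_mem_carrier[OF Zb that] .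
      have "derived G ?N \<subseteq> cent_mod ?B (Z b)"
      proof (rule derived_subsetI[OF normal_imp_subgroup[OF normal_cent_mod[OF B Zb]]])
        fix g h assume gh: "g \<in> ?N" "h \<in> ?N"
        show "cmt G g h \<in> cent_mod ?B (Z b)"
        proof (rule cmt_mem_cent_mod[OF B Zb])
          show "g \<in> carrier G" "h \<in> carrier G" using gh Nc by auto
          fix x assume x: "x \<in> Z b"
          have y: "cmt G h x \<in> Z (b - ?m)" "cmt G g x \<in> Z (b - ?m)" using c gh b x by auto
          show "cmt G g (cmt G h x) \<in> ?B" "cmt G h (cmt G g x) \<in> ?B" using c[of _ "b - ?m"] gh b y by auto
          \<comment> \<open>The subgroup centralizing Z (b - 2 ^ k) modulo \<open>?B\<close> is
            normal and contains h, hence also [h,x]; this gives the third condition.\<close>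
          have hc: "h \<in> cent_mod ?B (Z (b - ?m))"
            using gh(2) b Suc.IH by (meson diff_le_self le_trans subsetD)
          then have "cmt G h x \<in> cent_mod ?B (Z (b - ?m))" using normal_cmt(2)[OF cs Zc[OF x]] by blast
          then show "cmt G (cmt G h x) (cmt G g x) \<in> ?B" using y(2) by (simp add: cent_mod_def)
        qed
      qed
      then show ?thesis by (simp add: mult_2)
    qed
    ultimately show ?case by simp
  qed
  then show ?thesis by (rule conjunct1)
qed

end

text \<open>The inequality of the means for R/2, R/2, l, obtained from a polynomial identity with a
  square factor: 27 R^2 l <= 4 (R + l)^3. For c >= 10 one has c + 1 <= 11/10 c, and 16/27 times
  1.331 is less than 1.\<close>

lemma four_square_mult_le_cube:
  assumes "R + l \<le> Suc c" "c \<ge> 10"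
  shows "4 * R\<^sup>2 * l \<le> (c::nat) ^ 3"
proof -
  have id: "4 * (x + y) ^ 3 - 27 * x\<^sup>2 * y = (x - 2 * y)\<^sup>2 * (4 * x + y)" for x y :: real
    by (simp add: power2_eq_square power3_eq_cube algebra_simps)
  have "(real R - 2 * real l)\<^sup>2 * (4 * real R + real l) \<ge> 0" by simp
  then have "27 * (real R)\<^sup>2 * real l \<le> 4 * (real R + real l) ^ 3" using id[of "real R" "real l"] by linarith
  also have "\<dots> \<le> 4 * (real c + 1) ^ 3"
    using assms(1) by (intro mult_left_mono power_mono) linarith+
  also have "\<dots> \<le> 4 * (11 / 10 * real c) ^ 3"
    using assms(2) by (intro mult_left_mono power_mono) linarith+
  also have "\<dots> = 5324 / 1000 * real c ^ 3" by (simp add: power_mult_distrib power_divide)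
  finally have "4 * (real R)\<^sup>2 * real l \<le> real c ^ 3" using zero_le_power[of "real c" 3] by linarith
  then have "real (4 * R\<^sup>2 * l) \<le> real (c ^ 3)" by simp
  then show ?thesis by (simp only: of_nat_le_iff)
qed

theorem derived_length_Omega_bound:
  fixes G :: "('g, 'm) monoid_scheme" (structure)
  assumes "group G" and fin: "finite (carrier G)" and sol: "solvable G" and nt: "carrier G \<noteq> {\<one>}"
  shows "2 ^ derived_length G \<le> 512 * \<Omega> (card (carrier G)) ^ 3"
proof -
  interpret group G by (rule assms(1))
  define c where "c = \<Omega> (card (carrier G))"
  obtain Z l where Z: "Z 0 = {\<one>}" "Z l = carrier G" "\<And>i. i < l \<Longrightarrow> chief_factor G (Z i) (Z (Suc i))"
    using chief_series[OF fin one_is_normal] by blast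
  have l1: "l \<ge> 1" using Z(1,2) nt by (cases l) auto
  have Zn: "Z i \<lhd> G" if "i \<le> l" for i
    using Z(3)[of i] normal_self Z(2) that by (cases "i = l") (auto simp: chief_factor_def)
  have "\<forall>i\<in>{..<l}. \<exists>pr. Factorial_Ring.prime (fst pr) \<and> snd pr \<ge> 1 \<and> card (Z (Suc i)) = fst pr ^ snd pr * card (Z i)"
  proof
    fix i assume "i \<in> {..<l}"
    then obtain p r where "Factorial_Ring.prime p" "r \<ge> 1" "card (Z (Suc i)) = p ^ r * card (Z i)"
      using chief_factor_prime_power[OF Z(3) sol fin] by (metis lessThan_iff)
    then show "\<exists>pr. Factorial_Ring.prime (fst pr) \<and> snd pr \<ge> 1 \<and> card (Z (Suc i)) = fst pr ^ snd pr * card (Z i)"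
      by (intro exI[of _ "(p, r)"]) simp
  qed
  then obtain pr where pr: "\<And>i. i < l \<Longrightarrow> Factorial_Ring.prime (fst (pr i))" "\<And>i. i < l \<Longrightarrow> snd (pr i) \<ge> 1"
    "\<And>i. i < l \<Longrightarrow> card (Z (Suc i)) = fst (pr i) ^ snd (pr i) * card (Z i)"
    using bchoice[of "{..<l}"] by (metis lessThan_iff)
  define p r where "p i = fst (pr i)" and "r i = snd (pr i)" for i
  have pos: "card (Z i) > 0" if "i \<le> l" for i
    using Zn[OF that] subgroup.one_closed[OF normal_imp_subgroup[OF Zn[OF that]]]
      finite_subset[OF normal_subset[OF Zn[OF that]] fin] card_gt_0_iff by blast
  have Om: "\<Omega> (card (Z m)) = (\<Sum>i<m. r i)" if "m \<le> l" for m
    using that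
  proof (induction m)
    case (Suc m)
    then show ?case
      using Omega_prime_power_mult[OF pr(1) pos, of m m "r m"] pr(3)[of m] by (simp add: r_def)
  qed (simp add: Z(1))
  have c: "c = (\<Sum>i<l. r i)" using Om[of l] Z(2) by (simp add: c_def)
  \<comment> \<open>Every other chief factor has rank at least 1, so a large rank leaves room for
    few factors.\<close>
  have rl: "r i + l \<le> Suc c" if i: "i < l" for i
  proof -
    have "(\<Sum>j\<in>{..<l} - {i}. 1) \<le> (\<Sum>j\<in>{..<l} - {i}. r j)" using pr(2) by (intro sum_mono) (auto simp: r_def)
    moreover have "c = r i + (\<Sum>j\<in>{..<l} - {i}. r j)" unfolding c using i by (simp add: sum.remove)
    ultimately show ?thesis using i by simp
  qed
  have lc: "l \<le> c" using rl[of 0] pr(2)[of 0] l1 by (simp add: r_def)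
  have dl: "derived_length G \<le> m" if m: "(derived G ^^ m) (carrier G) \<subseteq> {\<one>}" for m
  proof -
    have "(derived G ^^ m) (carrier G) = {\<one>}"
      using m subgroup.one_closed[OF normal_imp_subgroup[OF exp_of_derived_normal]] by blast
    then show ?thesis unfolding derived_length_def by (rule Least_le)
  qed
  have "(derived G ^^ i) (carrier G) \<subseteq> Z (l - i)" if "i \<le> l" for i
    using that
  proof (induction i)
    case (Suc i)
    then have "derived G ((derived G ^^ i) (carrier G)) \<subseteq> derived G (Z (Suc (l - Suc i)))"
      by (intro mono_derived) (simp add: Suc_diff_Suc)
    also have "\<dots> \<subseteq> Z (l - Suc i)" using chief_factor_abelian[OF Z(3) sol, of "l - Suc i"] Suc.prems by simp
    finally show ?case by simp
  qed (simp add: Z(2))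
  from this[of l] have dll: "derived_length G \<le> l" using dl Z(1) by simp
  show ?thesis
  \<comment> \<open>Up to 9 the factor 512 = 2 ^ 9 alone suffices; beyond, derived length <= l <= c
    supplies c >= 10.\<close>
  proof (cases "derived_length G \<le> 9")
    case True
    then have "(2::nat) ^ derived_length G \<le> 2 ^ 9" by (intro power_increasing) auto
    also have "\<dots> \<le> 512 * c ^ 3" using lc l1 by simp
    finally show ?thesis by (simp add: c_def)
  next
    case False
    then have c10: "c \<ge> 10" using dll lc by linarith
    have "\<forall>i\<in>{..<l}. \<exists>j. length_bound (p i) (r i) j \<and> (derived G ^^ j) (carrier G) \<subseteq> cent_mod (Z i) (Z (Suc i))"
    proof
      fix i assume "i \<in> {..<l}"
      then have i: "i < l" by simp
      show "\<exists>j. length_bound (p i) (r i) j \<and> (derived G ^^ j) (carrier G) \<subseteq> cent_mod (Z i) (Z (Suc i))"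
        using chief_factor_bound[OF linear_bound fin sol Z(3)[OF i] pr(1)[OF i] pr(3)[OF i] order_refl]
        by (simp add: p_def r_def)
    qed
    then obtain j where j: "\<And>i. i < l \<Longrightarrow> length_bound (p i) (r i) (j i)"
      "\<And>i. i < l \<Longrightarrow> (derived G ^^ j i) (carrier G) \<subseteq> cent_mod (Z i) (Z (Suc i))"
      using bchoice[of "{..<l}"] by (metis lessThan_iff)
    \<comment> \<open>The maximum is attained at a single factor i0, so only that one rank enters
      the estimate.\<close>
    define J where "J = Max (j ` {..<l})"
    have "J \<in> j ` {..<l}" unfolding J_def using l1 by (intro Max_in) (auto simp: lessThan_empty_iff)
    then obtain i0 where i0: "i0 < l" "J = j i0" by auto
    have J: "2 ^ J \<le> 1024 * (r i0)\<^sup>2" using j(1)[OF i0(1)] i0(2) by (simp add: length_bound_def)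
    let ?N = "(derived G ^^ J) (carrier G)"
    have st: "?N \<subseteq> cent_mod (Z i) (Z (Suc i))" if i: "i < l" for i
    proof -
      have "j i \<le> J" unfolding J_def using i by (intro Max_ge) auto
      then show ?thesis using exp_of_derived_antimono j(2)[OF i] by blast
    qed
    \<comment> \<open>By minimality 2 ^ (k - 1) <= l, so descending through the l factors costs at
      most a factor 2 l.\<close>
    define k where "k = (LEAST k. Suc l \<le> 2 ^ k)"
    have ex: "Suc l \<le> 2 ^ l" using less_exp[of l] by (simp only: Suc_le_eq)
    have k: "Suc l \<le> 2 ^ k" unfolding k_def by (rule LeastI[of _ l]) (rule ex)
    have "k \<noteq> 0" using k l1 by (intro notI) simp
    then have "\<not> Suc l \<le> 2 ^ (k - 1)" using not_less_Least[of "k - 1" "\<lambda>k. Suc l \<le> 2 ^ k"] by (simp add: k_def)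
    then have k2: "2 ^ k \<le> 2 * l" using \<open>k \<noteq> 0\<close> by (simp add: power_eq_if)
    have "(derived G ^^ k) ?N \<subseteq> Z (Suc l - 2 ^ k)"
      by (rule exp_of_derived_stabilizer[where Z = Z and l = l and N = ?N, OF Zn Z(1,2) normal_imp_subgroup[OF exp_of_derived_normal] st])
    then have "(derived G ^^ (J + k)) (carrier G) \<subseteq> {\<one>}"
      unfolding exp_of_derived_add using k Z(1) by simp
    then have "derived_length G \<le> J + k" by (rule dl)
    then have "2 ^ derived_length G \<le> (2::nat) ^ (J + k)" by (intro power_increasing) auto
    also have "\<dots> \<le> (1024 * (r i0)\<^sup>2) * (2 * l)" unfolding power_add using J k2 by (rule mult_mono) auto
    also have "\<dots> = 512 * (4 * (r i0)\<^sup>2 * l)" by simp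
    also have "\<dots> \<le> 512 * c ^ 3" by (rule mult_le_mono2[OF four_square_mult_le_cube[OF rl[OF i0(1)] c10]])
    finally show ?thesis by (simp add: c_def)
  qed
qed

theorem mainTheorem20:
  fixes G (structure) and n :: nat
  assumes "group G" and "finite (carrier G)" and "solvable G"
    and "D_count G = n"
  shows "real (derived_length G) \<le> 3 * log 2 (real n + 1) + 9"
proof (cases "carrier G = {\<one>}")
  \<comment> \<open>For the trivial group \<Omega> is 0 and the cubic estimate is false, so it is
    treated apart.\<close>
  case True
  then have "(derived G ^^ 0) (carrier G) = {\<one>}" by simp
  then have "derived_length G \<le> 0" unfolding derived_length_def by (rule Least_le)
  then show ?thesis by (simp add: zero_le_log_cancel_iff)
next
  case False
  have "2 ^ derived_length G \<le> 512 * \<Omega> (card (carrier G)) ^ 3"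
    using derived_length_Omega_bound[OF assms(1-3) False] .
  also have "\<dots> \<le> 512 * (n + 1) ^ 3"
    using group.D_count_ge[OF assms(1-3)] assms(4) by (intro mult_left_mono power_mono) auto
  finally have "real (2 ^ derived_length G) \<le> real (512 * (n + 1) ^ 3)" by (simp only: of_nat_le_iff)
  then have "2 ^ derived_length G \<le> 2 ^ 9 * (real n + 1) ^ 3" by (simp add: add.commute)
  then have "log 2 (2 ^ derived_length G) \<le> log 2 (2 ^ 9 * (real n + 1) ^ 3)"
    by (subst log_le_cancel_iff) auto
  also have "\<dots> = log 2 (2 ^ 9) + log 2 ((real n + 1) ^ 3)" by (rule log_mult_pos) auto
  also have "\<dots> = 9 + 3 * log 2 (real n + 1)"
    using log_nat_power[of 2 2 9] log_nat_power[of "real n + 1" 2 3] by simp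
  also have "log 2 (2 ^ derived_length G) = real (derived_length G)"
    using log_nat_power[of 2 2 "derived_length G"] by simp
  finally show ?thesis by simp
qed

end
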